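(* Let $\mathcal{F}=(\mathcal{X}_n,K_n,\pi_n)_{n=1}^\infty$ be a family of irreducible birth and death chains with $\mathcal{X}_n=\{0,1,\dots,n\}$. For $n\ge 1$, let $(\Omega_n,\mathbb{P}^{(n)})$ be a probability space and let $C_{n,1},\dots,C_{n,n}:\Omega_n\to(0,1)$ be independent and identically distributed random variables. For $\omega_n\in\Omega_n$ let $(\mathcal{X}_n,L_n^{(\omega_n)},\pi_n)$ be the birth and death chain given by \[ L^{(\omega_n)}_n(i,i+1)=K_n(i,i+1)C_{n,i+1}(\omega_n),\quad L^{(\omega_n)}_n(i+1,i)=K_n(i+1,i)C_{n,i+1}(\omega_n)\quad(0\le i<n), \] \[ L^{(\omega_n)}_n(i,i)=1-L^{(\omega_n)}_n(i,i+1)-L^{(\omega_n)}_n(i,i-1)\quad(0\le i\le n), \] with the convention $L_n^{(\omega_n)}(0,-1)=L_n^{(\omega_n)}(n,n+1)=0$. For $\omega=(\omega_1,\omega_2,\dots)\in\prod_{n=1}^\infty\Omega_n$ let $\mathcal{F}^{(\omega)}=(\mathcal{X}_n,L_n^{(\omega_n)},\pi_n)_{n=1}^\infty$, and let $\mathcal{F}_c,\mathcal{F}_c^{(\omega)}$ be the families of continuous time chains associated with $\mathcal{F},\mathcal{F}^{(\omega)}$. Set $\mu_n=\mathbb{E}(1/C_{n,1})$ and $\nu_n^2=\mathrm{Var}(1/C_{n,1})$ (assumed finite). Let $M_n\in\mathcal{X}_n$ be a sequence with $\inf_{n}\pi_n([0,M_n])>0$ and $\inf_{n}\pi_n([M_n,n])>0$,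 and set \[ \theta_n=\max\{\mathbb{E}_0\tau^{(n)}_{M_n},\mathbb{E}_n\tau^{(n)}_{M_n}\},\quad \alpha_n^2=\max\{\mathrm{Var}_0\widetilde{\tau}^{(n)}_{M_n},\mathrm{Var}_n\widetilde{\tau}^{(n)}_{M_n}\},\quad \beta_n^2=\max\{\mathrm{Var}_0\tau^{(n)}_{M_n},\mathrm{Var}_n\tau^{(n)}_{M_n}\}, \] where $\tau^{(n)}_i$ and $\widetilde{\tau}^{(n)}_i$ are the first hitting times of state $i$ by the $n$th chains of $\mathcal{F}$ and $\mathcal{F}_c$. (1) If $\mathcal{F}_c$ has a maximum total variation cutoff and $\nu_n\alpha_n=o(\mu_n\theta_n)$, then there is a sequence of nonempty events $E_n\subset\Omega_n$ such that $\mathbb{P}^{(n)}(E_n)\to 1$ and, for any $\omega\in\prod_{n=1}^\infty E_n$, $\mathcal{F}_c^{(\omega)}$ has a maximum total variation cutoff with cutoff time $\mu_n\theta_n$. (2) Assume $\inf_{n,i}K_n(i,i)>0$. If $\mathcal{F}$ has a maximum total variation cutoff and $\nu_n\beta_n=o(\mu_n\theta_n)$, then there is a sequence of nonempty events $E_n\subset\Omega_n$ such that $\mathbb{P}^{(n)}(E_n)\to 1$ and, for any $\omega\in\prod_{n=1}^\infty E_n$, $\mathcal{F}^{(\omega)}$ has a maximum total variation cutoff with cutoff time $\mu_n\theta_n$.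
   Context: A birth and death chain on $\{0,1,\dots,n\}$ is a Markov chain with transition matrix $K$ such that $K(i,i+1)=p_i$, $K(i,i-1)=q_i$, $K(i,i)=r_i$, $p_i+q_i+r_i=1$, $p_n=q_0=0$ (all other entries zero); it is irreducible iff $p_iq_{i+1}>0$ for $0\le i<n$. In a triple $(\mathcal{X},K,\pi)$, $\pi$ is the stationary distribution of $K$. The associated continuous time chain has semigroup $H_t=e^{-t(I-K)}$; it is realized as $X_{N_t}$, where $(X_m)$ is the discrete time chain and $N_t$ is an independent Poisson process with parameter $1$. The hitting times are $\tau^{(n)}_i=\inf\{m\ge 0: X^{(n)}_m=i\}$ and $\widetilde{\tau}^{(n)}_i=\inf\{t\ge 0: X^{(n)}_{N_t}=i\}$. $\mathbb{E}_j,\mathrm{Var}_j$ are expectation and variance given $X_0^{(n)}=j$. $[a,b]$ denotes the integers from $a$ to $b$; $a_n=o(b_n)$ means $a_n/b_n\to0$. With $\|\mu-\nu\|_{TV}=\max_A\{\mu(A)-\nu(A)\}$, the maximum total variation distance of the $n$th chain is $d_n(m)=\max_{x}\|K_n^m(x,\cdot)-\pi_n\|_{TV}$ in discrete time and $d_n(t)=\max_x\|H_{n,t}(x,\cdot)-\pi_n\|_{TV}$ in continuous time. The mixing time is $T_n(\epsilon)=\min\{m\ge0: d_n(m)\le\epsilon\}$ over integers $m$ in discrete time, and $T_n(\epsilon)=\inf\{t\ge0: d_n(t)\le\epsilon\}$ in continuous time. The family has a maximum total variation cutoff with cutoff time $(t_n)$, $t_n>0$, if $\lim_{n}T_n(\epsilon)/t_n=1$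 for all $\epsilon\in(0,1)$; it has a cutoff if such a sequence exists. *)

theory Defs
  imports "HOL-Probability.Probability" "Jordan_Normal_Form.Matrix"
begin

text \<open>
  A transition matrix on the states \<open>0, \<dots>, n\<close> is an \<open>(n+1) \<times> (n+1)\<close> real matrix \<open>K\<close>
  with entries \<open>K $$ (i, j)\<close>; a distribution on these states is a function \<open>nat \<Rightarrow> real\<close>
  of which only the values on \<open>{0..n}\<close> matter.  Families are indexed by \<open>nat\<close>,
  and only the indices \<open>n \<ge> 1\<close> matter.
\<close>

section \<open>Birth and death chains\<close>

definition birth_death_chain :: "nat \<Rightarrow> real mat \<Rightarrow> bool" where
  "birth_death_chain n K \<longleftrightarrow> K \<in> carrier_mat (n + 1) (n + 1) \<and>
     (\<exists>p q r :: nat \<Rightarrow> real.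
        (\<forall>i\<le>n. 0 \<le> p i \<and> 0 \<le> q i \<and> 0 \<le> r i \<and> p i + q i + r i = 1) \<and> p n = 0 \<and> q 0 = 0 \<and>
        (\<forall>i\<le>n. \<forall>j\<le>n. K $$ (i, j) =
           (if j = i + 1 then p i else if i = j + 1 then q i else if j = i then r i else 0)))"

definition irreducible_chain :: "nat \<Rightarrow> real mat \<Rightarrow> bool" where
  "irreducible_chain n K \<longleftrightarrow> (\<forall>x\<le>n. \<forall>y\<le>n. \<exists>m. (K ^\<^sub>m m) $$ (x, y) > 0)"

definition stationary_distribution :: "nat \<Rightarrow> real mat \<Rightarrow> (nat \<Rightarrow> real) \<Rightarrow> bool" where
  "stationary_distribution n K \<pi> \<longleftrightarrow>
     (\<forall>x\<le>n. 0 \<le> \<pi> x) \<and> (\<Sum>x\<le>n. \<pi> x) = 1 \<and> (\<forall>y\<le>n. (\<Sum>x\<le>n. \<pi> x * K $$ (x, y)) = \<pi> y)"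

text \<open>
  The edge \<open>{i, i+1}\<close> is slowed down by the factor \<open>c (i + 1)\<close>; the two conditionals in the
  diagonal entry implement the convention \<open>L (0, -1) = L (n, n+1) = 0\<close>.
\<close>
definition slowed_chain :: "nat \<Rightarrow> real mat \<Rightarrow> (nat \<Rightarrow> real) \<Rightarrow> real mat" where
  "slowed_chain n K c = mat (n + 1) (n + 1) (\<lambda>(i, j).
     if j = i + 1 then K $$ (i, i + 1) * c (i + 1)
     else if i = j + 1 then K $$ (i, i - 1) * c i
     else if j = i then
       1 - (if i < n then K $$ (i, i + 1) * c (i + 1) else 0)
         - (if 0 < i then K $$ (i, i - 1) * c i else 0)
     else 0)"

section \<open>Mixing times and cutoff\<close>

definition mat_exp :: "real mat \<Rightarrow> real mat" where
  "mat_exp A = mat (dim_row A) (dim_row A) (\<lambda>(i, j). \<Sum>k. (A ^\<^sub>m k) $$ (i, j) / fact k)"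

definition semigroup_at :: "nat \<Rightarrow> real mat \<Rightarrow> real \<Rightarrow> real mat" where
  "semigroup_at n K t = mat_exp ((- t) \<cdot>\<^sub>m (1\<^sub>m (n + 1) - K))"

definition tv_dist :: "nat \<Rightarrow> (nat \<Rightarrow> real) \<Rightarrow> (nat \<Rightarrow> real) \<Rightarrow> real" where
  "tv_dist n \<mu> \<nu> = Max ((\<lambda>A. sum \<mu> A - sum \<nu> A) ` Pow {0..n})"

definition max_tv_dist :: "nat \<Rightarrow> real mat \<Rightarrow> (nat \<Rightarrow> real) \<Rightarrow> real" where
  "max_tv_dist n P \<pi> = Max ((\<lambda>x. tv_dist n (\<lambda>y. P $$ (x, y)) \<pi>) ` {0..n})"

text \<open>
  Mixing times take values in \<open>ereal\<close>, so that the infimum of the empty set (which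
  occurs in discrete time for periodic chains) is \<open>\<infinity>\<close>.
\<close>
definition mixing_time_disc :: "nat \<Rightarrow> real mat \<Rightarrow> (nat \<Rightarrow> real) \<Rightarrow> real \<Rightarrow> ereal" where
  "mixing_time_disc n K \<pi> \<epsilon> =
     (INF m \<in> {m :: nat. max_tv_dist n (K ^\<^sub>m m) \<pi> \<le> \<epsilon>}. ereal (real m))"

definition mixing_time_cont :: "nat \<Rightarrow> real mat \<Rightarrow> (nat \<Rightarrow> real) \<Rightarrow> real \<Rightarrow> ereal" where
  "mixing_time_cont n K \<pi> \<epsilon> =
     (INF t \<in> {t :: real. 0 \<le> t \<and> max_tv_dist n (semigroup_at n K t) \<pi> \<le> \<epsilon>}. ereal t)"

definition has_cutoff_time :: "(nat \<Rightarrow> real \<Rightarrow> ereal) \<Rightarrow> (nat \<Rightarrow> real) \<Rightarrow> bool" where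
  "has_cutoff_time T t \<longleftrightarrow> (\<forall>n\<ge>1. 0 < t n) \<and>
     (\<forall>\<epsilon>. 0 < \<epsilon> \<and> \<epsilon> < 1 \<longrightarrow> (\<lambda>n. T n \<epsilon> / ereal (t n)) \<longlonglongrightarrow> 1)"

definition has_cutoff :: "(nat \<Rightarrow> real \<Rightarrow> ereal) \<Rightarrow> bool" where
  "has_cutoff T \<longleftrightarrow> (\<exists>t. has_cutoff_time T t)"

section \<open>The chain as a process, and hitting times\<close>

text \<open>
  \<open>X\<close> is the Markov chain on \<open>{0..n}\<close> with transition matrix \<open>K\<close> started at \<open>j\<close>
  (given by its finite-dimensional distributions).
\<close>
definition markov_chain ::
  "'b measure \<Rightarrow> nat \<Rightarrow> real mat \<Rightarrow> nat \<Rightarrow> (nat \<Rightarrow> 'b \<Rightarrow> nat) \<Rightarrow> bool" where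
  "markov_chain Q n K j X \<longleftrightarrow> prob_space Q \<and>
     (\<forall>m. X m \<in> measurable Q (count_space UNIV)) \<and>
     (\<forall>m. \<forall>\<omega>\<in>space Q. X m \<omega> \<le> n) \<and>
     (\<forall>m x. (\<forall>k\<le>m. x k \<le> n) \<longrightarrow>
        measure Q {\<omega> \<in> space Q. \<forall>k\<le>m. X k \<omega> = x k} =
        (if x 0 = j then \<Prod>k<m. K $$ (x k, x (Suc k)) else 0))"

text \<open>
  The rate 1 Poisson process is the counting process of arrivals with i.i.d. standard
  exponential interarrival times \<open>S 0, S 1, \<dots>\<close>.  The pathwise conditions (which hold
  almost surely anyway) make every path finite-valued, nondecreasing and right-continuous.
\<close>
definition interarrival_times :: "'b measure \<Rightarrow> (nat \<Rightarrow> 'b \<Rightarrow> real) \<Rightarrow> bool" where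
  "interarrival_times Q S \<longleftrightarrow>
     prob_space.indep_vars Q (\<lambda>_. borel) S UNIV \<and>
     (\<forall>k. distributed Q lborel (S k) (exponential_density 1)) \<and>
     (\<forall>\<omega>\<in>space Q. (\<forall>k. 0 < S k \<omega>) \<and>
        filterlim (\<lambda>m. \<Sum>k<m. S k \<omega>) at_top sequentially)"

definition poisson_count :: "(nat \<Rightarrow> 'b \<Rightarrow> real) \<Rightarrow> real \<Rightarrow> 'b \<Rightarrow> nat" where
  "poisson_count S t \<omega> = card {m. 1 \<le> m \<and> (\<Sum>k<m. S k \<omega>) \<le> t}"

definition chain_with_clock ::
  "'b measure \<Rightarrow> nat \<Rightarrow> real mat \<Rightarrow> nat \<Rightarrow> (nat \<Rightarrow> 'b \<Rightarrow> nat) \<Rightarrow> (nat \<Rightarrow> 'b \<Rightarrow> real) \<Rightarrow> bool" where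
  "chain_with_clock Q n K j X S \<longleftrightarrow> markov_chain Q n K j X \<and> interarrival_times Q S \<and>
     prob_space.indep_var Q
       (PiM UNIV (\<lambda>_. count_space UNIV)) (\<lambda>\<omega> m. X m \<omega>)
       (PiM UNIV (\<lambda>_. borel)) (\<lambda>\<omega> k. S k \<omega>)"

text \<open>
  First hitting times are \<open>\<infinity>\<close> on paths that never hit \<open>i\<close>.  For irreducible chains this
  is a null event, so nothing is lost by applying \<open>real_of_ereal\<close> in means and variances.
\<close>
definition hit_disc :: "(nat \<Rightarrow> 'b \<Rightarrow> nat) \<Rightarrow> nat \<Rightarrow> 'b \<Rightarrow> ereal" where
  "hit_disc X i \<omega> = (INF m \<in> {m :: nat. X m \<omega> = i}. ereal (real m))"

definition hit_cont ::
  "(nat \<Rightarrow> 'b \<Rightarrow> nat) \<Rightarrow> (nat \<Rightarrow> 'b \<Rightarrow> real) \<Rightarrow> nat \<Rightarrow> 'b \<Rightarrow> ereal" where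
  "hit_cont X S i \<omega> = (INF t \<in> {t :: real. 0 \<le> t \<and> X (poisson_count S t \<omega>) \<omega> = i}. ereal t)"

definition mean :: "'b measure \<Rightarrow> ('b \<Rightarrow> ereal) \<Rightarrow> real" where
  "mean Q f = prob_space.expectation Q (\<lambda>\<omega>. real_of_ereal (f \<omega>))"

definition var :: "'b measure \<Rightarrow> ('b \<Rightarrow> ereal) \<Rightarrow> real" where
  "var Q f = prob_space.variance Q (\<lambda>\<omega>. real_of_ereal (f \<omega>))"

end

theory Submission
  imports Defs
begin

text \<open>
  Everything about a birth and death chain with split state \<open>M\<close> that matters here is carried by two
  numbers.  With \<open>F i = \<pi> [0, i]\<close>, the mean passage time from \<open>i\<close> to \<open>i + 1\<close> is
  \<open>a i = F i / (\<pi> i * p i)\<close>, the mean hitting time of \<open>M\<close> from \<open>0\<close> is \<open>\<Sum>i<M. a i\<close>, and the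
  variance of the continuous time hitting time is the quadratic form
  \<open>\<Sum>i<M. \<Sum>l<M. a i * a l * F (min i l) / F (max i l)\<close>.  Let \<open>\<theta>\<close> be the larger of the two mean hitting
  times of \<open>M\<close> from the two ends and \<open>\<alpha>\<^sup>2\<close> the larger of the two variances.  Slowing the edge \<open>{i, i+1}\<close> by
  \<open>C (i + 1)\<close> leaves \<open>\<pi>\<close> and \<open>F\<close> alone and divides \<open>a i\<close> by \<open>C (i + 1)\<close>.  So in the slowed chain the mean
  is a linear form and the variance a quadratic form in the independent variables \<open>1 / C (i + 1)\<close>; their
  expectations are \<open>\<mu>\<close> times the old mean, and at most \<open>\<mu>\<^sup>2 + \<nu>\<^sup>2\<close> times the old variance.  If
  \<open>\<alpha> = o(\<theta>)\<close> and \<open>\<nu> \<alpha> = o(\<mu> \<theta>)\<close>, the inequalities of Chebyshev and Markov give events of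
  probability tending to one on which the slowed chains have parameters \<open>\<theta>'\<close> asymptotic to \<open>\<mu> \<theta>\<close> and
  \<open>\<alpha>' = o(\<mu> \<theta>)\<close> (lemmas \<open>slowed_event\<close> and \<open>good_events\<close>).

  The theorem is thereby reduced to a deterministic statement: a family, in discrete time with holding
  probabilities bounded below, has a cutoff if and only if \<open>\<alpha> = o(\<theta>)\<close>, and then \<open>\<theta>\<close> is a cutoff time.  It
  rests on three bounds for a single chain, whose constants depend only on \<open>\<epsilon>\<close>, on the lower bound \<open>\<delta>\<close> for the holding
  probabilities and on the lower bound \<open>c0\<close> for the mass on either side of \<open>M\<close>.

  (a) The chain is mixed at time \<open>\<theta> + A \<alpha>\<close> (lemma \<open>mixing_upper\<close>).  To estimate \<open>E\<^sub>x f(X\<^sub>m)\<close> for bounded \<open>f\<close>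
  with mean zero, stop the chain when it first hits a state \<open>u\<close>: either this takes too long, or the value is one of
  the numbers \<open>(T ^^ k) f u\<close> with \<open>k\<close> large.  Averaging over \<open>u\<close> with weights \<open>\<pi> u\<close> turns the second alternative
  into a maximal inequality in \<open>L\<^sup>2(\<pi>)\<close> (lemma \<open>maximal_inequality\<close>); the first one is controlled by Chebyshev's
  inequality for the time to reach \<open>M\<close> and Markov's inequality for the time from \<open>M\<close> to \<open>u\<close>.  The relaxation time
  is at most of order \<open>\<alpha>\<close>, because \<open>\<alpha>\<close> is the larger of the Hilbert--Schmidt norms of the Green operators of the
  chain killed at \<open>M\<close> on the two sides of \<open>M\<close> (lemma \<open>poincare\<close>).

  (b) The chain is far from mixed at time \<open>\<theta> - A \<alpha>\<close> (lemma \<open>mixing_lower\<close>): by Chebyshev's inequality,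
  started at the slower end, it has not yet reached a state that cuts off small mass at that end.

  (c) If the total variation distance is at most \<open>\<epsilon>\<close> at time \<open>m\<close>, the \<open>m\<close>-th power contracts functions of mean zero
  by the factor \<open>2 \<epsilon>\<close>, so Dirichlet forms cannot be small compared with variances.  An explicit test function then gives
  \<open>\<alpha>\<^sup>2 \<le> const * \<theta> * (1 + m / ln (1 / (2 \<epsilon>)))\<close> (lemma \<open>variance_bound_disc\<close>).  By (a) and \<open>\<alpha> \<le> \<theta>\<close> the
  mixing time at level \<open>1/2\<close> is \<open>O(\<theta>)\<close>, and under a cutoff the mixing times at all levels are comparable; letting
  \<open>\<epsilon>\<close> tend to \<open>0\<close> yields \<open>\<alpha> = o(\<theta>)\<close>.

  In discrete time a holding probability bounded below keeps the spectrum away from \<open>- 1\<close>; it also makes the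
  discrete variance \<open>\<beta>\<^sup>2\<close> comparable to \<open>\<alpha>\<^sup>2\<close>.  In continuous time \<open>H\<^sub>t\<close> is the mixture, with Poisson weights
  of mean \<open>2 t\<close>, of the powers of the chain \<open>(I + K) / 2\<close>, for which both parameters are doubled; the fluctuations
  of the Poisson variable are of order \<open>sqrt \<theta>\<close> and negligible since \<open>\<theta> \<ge> n / 2\<close>.
\<close>

section \<open>Birth and death rates and survival functions\<close>

text \<open>
  The action \<open>f \<mapsto> K f\<close> of the transition matrix on functions.  At the ends the junk values \<open>f (n + 1)\<close> and
  \<open>f (0 - 1) = f 0\<close> are multiplied by the vanishing rates \<open>p n\<close> and \<open>q 0\<close>.
\<close>
definition bdop :: "(nat \<Rightarrow> real) \<Rightarrow> (nat \<Rightarrow> real) \<Rightarrow> (nat \<Rightarrow> real) \<Rightarrow> nat \<Rightarrow> real" where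
  "bdop p q f x = p x * f (x + 1) + q x * f (x - 1) + (1 - p x - q x) * f x"

definition cum :: "(nat \<Rightarrow> real) \<Rightarrow> nat \<Rightarrow> real" where
  "cum \<pi> i = (\<Sum>k\<le>i. \<pi> k)"

text \<open>
  The mean passage time from \<open>i\<close> to \<open>i + 1\<close>.
\<close>
definition passage_mean :: "(nat \<Rightarrow> real) \<Rightarrow> (nat \<Rightarrow> real) \<Rightarrow> nat \<Rightarrow> real" where
  "passage_mean p \<pi> i = cum \<pi> i / (\<pi> i * p i)"

definition mean_hit :: "(nat \<Rightarrow> real) \<Rightarrow> (nat \<Rightarrow> real) \<Rightarrow> nat \<Rightarrow> nat \<Rightarrow> real" where
  "mean_hit p \<pi> x M = (\<Sum>i=x..<M. passage_mean p \<pi> i)"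

text \<open>
  The variance of the passage time from \<open>i\<close> to \<open>i + 1\<close> of the continuous time chain; for the discrete time
  chain one has to subtract the mean \<open>passage_mean p \<pi> i\<close>.
\<close>
definition step_var :: "(nat \<Rightarrow> real) \<Rightarrow> (nat \<Rightarrow> real) \<Rightarrow> nat \<Rightarrow> real" where
  "step_var p \<pi> i =
     (passage_mean p \<pi> i)\<^sup>2 + 2 * passage_mean p \<pi> i * (\<Sum>l<i. passage_mean p \<pi> l * cum \<pi> l) / cum \<pi> i"

definition hit_var :: "(nat \<Rightarrow> real) \<Rightarrow> (nat \<Rightarrow> real) \<Rightarrow> nat \<Rightarrow> nat \<Rightarrow> real" where
  "hit_var p \<pi> x M = (\<Sum>i=x..<M. step_var p \<pi> i)"

text \<open>
  The probability, started at \<open>x\<close>, of not hitting \<open>u\<close> up to and including time \<open>m\<close>.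
\<close>
primrec survival :: "(nat \<Rightarrow> real) \<Rightarrow> (nat \<Rightarrow> real) \<Rightarrow> nat \<Rightarrow> nat \<Rightarrow> nat \<Rightarrow> real" where
  "survival p q u 0 = (\<lambda>x. of_bool (x \<noteq> u))"
| "survival p q u (Suc m) = (\<lambda>x. if x = u then 0 else bdop p q (survival p q u m) x)"

lemma bdop_const [simp]: "bdop p q (\<lambda>_. k) x = k"
  by (simp add: bdop_def algebra_simps)

lemma bdop_add: "bdop p q (\<lambda>y. f y + g y) x = bdop p q f x + bdop p q g x"
  by (simp add: bdop_def algebra_simps)

lemma bdop_diff: "bdop p q (\<lambda>y. f y - g y) x = bdop p q f x - bdop p q g x"
  by (simp add: bdop_def algebra_simps)

lemma bdop_cmult: "bdop p q (\<lambda>y. k * f y) x = k * bdop p q f x"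
  by (simp add: bdop_def algebra_simps)

lemma bdop_funpow_add: "(bdop p q ^^ m) (\<lambda>y. f y + g y) x = (bdop p q ^^ m) f x + (bdop p q ^^ m) g x"
proof (induction m arbitrary: x)
  case (Suc m)
  have "(bdop p q ^^ m) (\<lambda>y. f y + g y) = (\<lambda>y. (bdop p q ^^ m) f y + (bdop p q ^^ m) g y)"
    using Suc by auto
  thus ?case by (simp add: bdop_add)
qed simp

lemma bdop_funpow_diff: "(bdop p q ^^ m) (\<lambda>y. f y - g y) x = (bdop p q ^^ m) f x - (bdop p q ^^ m) g x"
proof (induction m arbitrary: x)
  case (Suc m)
  have "(bdop p q ^^ m) (\<lambda>y. f y - g y) = (\<lambda>y. (bdop p q ^^ m) f y - (bdop p q ^^ m) g y)"
    using Suc by auto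
  thus ?case by (simp add: bdop_diff)
qed simp

lemma bdop_funpow_cmult: "(bdop p q ^^ m) (\<lambda>y. k * f y) x = k * (bdop p q ^^ m) f x"
proof (induction m arbitrary: x)
  case (Suc m)
  have "(bdop p q ^^ m) (\<lambda>y. k * f y) = (\<lambda>y. k * (bdop p q ^^ m) f y)"
    using Suc by auto
  thus ?case by (simp add: bdop_cmult)
qed simp

lemma bdop_funpow_const [simp]: "(bdop p q ^^ m) (\<lambda>_. k) x = k"
proof (induction m arbitrary: x)
  case (Suc m)
  have "(bdop p q ^^ m) (\<lambda>_. k) = (\<lambda>_. k)"
    using Suc by auto
  thus ?case by simp
qed simp

text \<open>
  The rates of an irreducible birth and death chain on \<open>{0..n}\<close> with its reversible distribution.  The locale is
  closed under reflection and under slowing, which a formulation with matrices would hide.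
\<close>
locale bd_rates =
  fixes n :: nat and p q \<pi> :: "nat \<Rightarrow> real"
  assumes n_pos: "1 \<le> n"
    and p_pos: "i < n \<Longrightarrow> 0 < p i"
    and q_pos: "0 < i \<Longrightarrow> i \<le> n \<Longrightarrow> 0 < q i"
    and p_top: "p n = 0"
    and q_bot: "q 0 = 0"
    and pq_le: "i \<le> n \<Longrightarrow> p i + q i \<le> 1"
    and pi_pos: "i \<le> n \<Longrightarrow> 0 < \<pi> i"
    and pi_sum: "(\<Sum>i\<le>n. \<pi> i) = 1"
    and balance: "i < n \<Longrightarrow> \<pi> i * p i = \<pi> (Suc i) * q (Suc i)"
begin

abbreviation "T \<equiv> bdop p q"
abbreviation "a \<equiv> passage_mean p \<pi>"
abbreviation "h \<equiv> mean_hit p \<pi>"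
abbreviation "W \<equiv> hit_var p \<pi>"
abbreviation "F \<equiv> cum \<pi>"

text \<open>
  The conductance of the edge \<open>{i, i+1}\<close>.
\<close>
definition "c i = \<pi> i * p i"
definition "ip f g = (\<Sum>x\<le>n. \<pi> x * f x * g x)"

lemma p_nonneg: "i \<le> n \<Longrightarrow> 0 \<le> p i"
  using p_pos[of i] p_top by (cases "i = n") auto

lemma q_nonneg: "i \<le> n \<Longrightarrow> 0 \<le> q i"
  using q_pos[of i] q_bot by (cases "i = 0") auto

lemma c_pos: "i < n \<Longrightarrow> 0 < c i"
  by (simp add: c_def p_pos pi_pos)

lemma bdop_cong:
  assumes "\<And>y. y \<le> n \<Longrightarrow> f y = g y" "x \<le> n"
  shows "T f x = T g x"
  using assms p_top by (cases "x = n") (auto simp: bdop_def)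

lemma bdop_mono:
  assumes "\<And>y. y \<le> n \<Longrightarrow> f y \<le> g y" "x \<le> n"
  shows "T f x \<le> T g x"
proof -
  have 1: "p x * f (x + 1) \<le> p x * g (x + 1)"
    using assms p_top p_nonneg[of x] by (cases "x = n") (auto intro: mult_left_mono)
  have 2: "q x * f (x - 1) \<le> q x * g (x - 1)"
    using assms q_nonneg[of x] by (auto intro: mult_left_mono)
  have 3: "(1 - p x - q x) * f x \<le> (1 - p x - q x) * g x"
    using assms pq_le[of x] by (auto intro: mult_left_mono)
  show ?thesis unfolding bdop_def using 1 2 3 by linarith
qed

lemma bdop_mono_nbr:
  assumes "x < n" "f (x + 1) \<le> g (x + 1)" "f (x - 1) \<le> g (x - 1)" "f x \<le> g x"
  shows "T f x \<le> T g x"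
  unfolding bdop_def using assms p_nonneg[of x] q_nonneg[of x] pq_le[of x]
  by (intro add_mono mult_left_mono) auto

lemma funpow_cong:
  assumes "\<And>y. y \<le> n \<Longrightarrow> f y = g y" "x \<le> n"
  shows "(T ^^ m) f x = (T ^^ m) g x"
  using assms(2) by (induction m arbitrary: x) (auto intro: bdop_cong simp: assms)

lemma funpow_mono:
  assumes "\<And>y. y \<le> n \<Longrightarrow> f y \<le> g y" "x \<le> n"
  shows "(T ^^ m) f x \<le> (T ^^ m) g x"
  using assms(2) by (induction m arbitrary: x) (auto intro: bdop_mono simp: assms)

lemma funpow_bound:
  assumes "\<And>y. y \<le> n \<Longrightarrow> \<bar>f y\<bar> \<le> b" "x \<le> n"
  shows "\<bar>(T ^^ m) f x\<bar> \<le> b"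
proof -
  have b: "f y \<le> b" "- b \<le> f y" if "y \<le> n" for y
    using assms(1)[OF that] by auto
  have "(T ^^ m) f x \<le> (T ^^ m) (\<lambda>_. b) x" "(T ^^ m) (\<lambda>_. - b) x \<le> (T ^^ m) f x"
    by (rule funpow_mono; use assms(2) b in simp)+
  thus ?thesis by simp
qed

text \<open>
  Summation by parts; detailed balance lets the contributions of \<open>x \<rightarrow> x + 1\<close> and \<open>x + 1 \<rightarrow> x\<close> share the
  weight \<open>c x\<close>.
\<close>
lemma dirichlet_form:
  "ip f (\<lambda>x. g x - T g x) = (\<Sum>i<n. c i * (f i - f (Suc i)) * (g i - g (Suc i)))"
proof -
  have "ip f (\<lambda>x. g x - T g x) =
      (\<Sum>x\<le>n. \<pi> x * p x * f x * (g x - g (Suc x))) + (\<Sum>x\<le>n. \<pi> x * q x * f x * (g x - g (x - 1)))"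
    unfolding ip_def bdop_def sum.distrib[symmetric]
    by (intro sum.cong) (auto simp: algebra_simps)
  also have "(\<Sum>x\<le>n. \<pi> x * p x * f x * (g x - g (Suc x))) = (\<Sum>x<n. c x * f x * (g x - g (Suc x)))"
    by (simp add: lessThan_Suc_atMost[symmetric] p_top c_def)
  also have "(\<Sum>x\<le>n. \<pi> x * q x * f x * (g x - g (x - 1))) =
      (\<Sum>x<n. \<pi> (Suc x) * q (Suc x) * f (Suc x) * (g (Suc x) - g x))"
    by (simp add: sum.atMost_shift q_bot)
  also have "\<dots> = (\<Sum>x<n. c x * f (Suc x) * (g (Suc x) - g x))"
    by (intro sum.cong) (auto simp: balance c_def)
  finally show ?thesis
    by (simp add: sum.distrib[symmetric] algebra_simps)
qed

definition "energy f = (\<Sum>i<n. c i * (f i - f (Suc i))\<^sup>2)"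

lemma ip_commute: "ip f g = ip g f"
  by (simp add: ip_def mult_ac)

lemma ip_diff_right: "ip f (\<lambda>x. g x - k x) = ip f g - ip f k"
  by (simp add: ip_def sum_subtractf algebra_simps)
lemma ip_diff_left: "ip (\<lambda>x. g x - k x) f = ip g f - ip k f"
  by (simp add: ip_def sum_subtractf algebra_simps)
lemma ip_add_right: "ip f (\<lambda>x. g x + k x) = ip f g + ip f k"
  by (simp add: ip_def sum.distrib algebra_simps)
lemma ip_add_left: "ip (\<lambda>x. g x + k x) f = ip g f + ip k f"
  by (simp add: ip_def sum.distrib algebra_simps)
lemma ip_cmult_right: "ip f (\<lambda>x. b * g x) = b * ip f g"
  by (simp add: ip_def sum_distrib_left algebra_simps)
lemma ip_cmult_left: "ip (\<lambda>x. b * g x) f = b * ip g f"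
  by (simp add: ip_def sum_distrib_left algebra_simps)

lemma ip_self_nonneg: "0 \<le> ip f f"
  unfolding ip_def by (intro sum_nonneg) (auto simp: mult.assoc pi_pos less_imp_le)

lemma self_adjoint: "ip (T f) g = ip f (T g)"
proof -
  have "ip f (\<lambda>x. g x - T g x) = ip g (\<lambda>x. f x - T f x)"
    unfolding dirichlet_form by (intro sum.cong) (auto simp: mult_ac)
  thus ?thesis by (simp add: ip_diff_right ip_commute)
qed

lemma self_adjoint_funpow: "ip ((T ^^ m) f) g = ip f ((T ^^ m) g)"
  by (induction m arbitrary: f g) (auto simp: self_adjoint funpow_swap1)

lemma energy_alt: "energy f = ip f f - ip f (T f)"
proof -
  have "energy f = ip f (\<lambda>x. f x - T f x)"
    unfolding dirichlet_form energy_def by (simp add: power2_eq_square mult.assoc)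
  thus ?thesis by (simp add: ip_diff_right)
qed

definition "avg f = (\<Sum>x\<le>n. \<pi> x * f x)"

lemma avg_ip: "avg f = ip (\<lambda>_. 1) f"
  by (simp add: avg_def ip_def)

lemma avg_T [simp]: "avg (T f) = avg f"
proof -
  have "ip (\<lambda>_. 1) (T f) = ip (T (\<lambda>_. 1)) f" by (simp add: self_adjoint)
  also have "T (\<lambda>_. 1) = (\<lambda>_. 1)" by auto
  finally show ?thesis by (simp add: avg_ip)
qed

lemma avg_funpow [simp]: "avg ((T ^^ m) f) = avg f"
  by (induction m) auto

lemma ip_cauchy: "(ip f g)\<^sup>2 \<le> ip f f * ip g g"
proof -
  have "(\<Sum>x\<le>n. (sqrt (\<pi> x) * f x) * (sqrt (\<pi> x) * g x))\<^sup>2 \<le>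
      (\<Sum>x\<le>n. (sqrt (\<pi> x) * f x)\<^sup>2) * (\<Sum>x\<le>n. (sqrt (\<pi> x) * g x)\<^sup>2)"
    by (rule Cauchy_Schwarz_ineq_sum)
  moreover have "(\<Sum>x\<le>n. (sqrt (\<pi> x) * f x) * (sqrt (\<pi> x) * g x)) = ip f g"
    unfolding ip_def
  proof (intro sum.cong refl)
    fix x assume "x \<in> {..n}"
    then have "sqrt (\<pi> x) * sqrt (\<pi> x) = \<pi> x" using pi_pos[of x] by simp
    then show "sqrt (\<pi> x) * f x * (sqrt (\<pi> x) * g x) = \<pi> x * f x * g x"
      by (metis mult.assoc mult.left_commute)
  qed
  moreover have "(\<Sum>x\<le>n. (sqrt (\<pi> x) * k x)\<^sup>2) = ip k k" for k
    unfolding ip_def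
    by (intro sum.cong refl) (use pi_pos in \<open>auto simp: power_mult_distrib power2_eq_square less_imp_le\<close>)
  ultimately show ?thesis by simp
qed

text \<open>
  The rates seen after the reflection \<open>i \<mapsto> n - i\<close>.  Every statement about hitting times from the left is
  applied to the reflected chain to obtain its counterpart from the right.
\<close>
abbreviation "rp \<equiv> (\<lambda>i. q (n - i))"
abbreviation "rq \<equiv> (\<lambda>i. p (n - i))"
abbreviation "r\<pi> \<equiv> (\<lambda>i. \<pi> (n - i))"

lemma sum_reflect: "(\<Sum>i\<le>n. f (n - i)) = (\<Sum>i\<le>n. f i)"
  by (rule sum.reindex_bij_witness[of _ "\<lambda>i. n - i" "\<lambda>i. n - i"]) auto

lemma reflect: "bd_rates n rp rq r\<pi>"
proof
  fix i assume i: "i < n"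
  have "\<pi> (n - Suc i) * p (n - Suc i) = \<pi> (Suc (n - Suc i)) * q (Suc (n - Suc i))"
    using i by (intro balance) auto
  moreover have "Suc (n - Suc i) = n - i" using i by simp
  ultimately show "\<pi> (n - i) * q (n - i) = \<pi> (n - Suc i) * p (n - Suc i)" by simp
qed (use n_pos p_pos q_pos p_top q_bot pi_pos pi_sum sum_reflect[of \<pi>] pq_le in
      \<open>auto simp: add.commute\<close>)

lemma bdop_reflect:
  assumes "x \<le> n"
  shows "bdop rp rq f x = T (\<lambda>y. f (n - y)) (n - x)"
proof (cases "x = 0")
  case True
  then show ?thesis using n_pos by (auto simp: bdop_def p_top)
next
  case False
  then have "n - (n - x + 1) = x - 1" "n - (n - x) = x" "n - Suc (n - x) = x - 1" using assms by auto
  moreover have "q (n - x) * f (n - (n - x - 1)) = q (n - x) * f (Suc x)"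
    using assms q_bot by (cases "x = n") auto
  ultimately show ?thesis by (auto simp: bdop_def algebra_simps)
qed

lemma funpow_reflect:
  assumes "x \<le> n"
  shows "(bdop rp rq ^^ m) f x = (T ^^ m) (\<lambda>y. f (n - y)) (n - x)"
  using assms
proof (induction m arbitrary: x)
  case (Suc m)
  have "(bdop rp rq ^^ Suc m) f x = T (\<lambda>y. (bdop rp rq ^^ m) f (n - y)) (n - x)"
    using Suc.prems by (simp add: bdop_reflect)
  also have "\<dots> = T ((T ^^ m) (\<lambda>y. f (n - y))) (n - x)"
    by (intro bdop_cong) (auto simp: Suc.IH)
  finally show ?case by simp
qed simp

lemma survival_reflect:
  assumes "x \<le> n" "u \<le> n"
  shows "survival rp rq u m x = survival p q (n - u) m (n - x)"
  using assms(1)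
proof (induction m arbitrary: x)
  case 0
  then show ?case using assms by auto
next
  case (Suc m)
  have "bdop rp rq (survival rp rq u m) x = T (\<lambda>y. survival rp rq u m (n - y)) (n - x)"
    by (rule bdop_reflect) fact
  also have "\<dots> = T (survival p q (n - u) m) (n - x)"
    by (intro bdop_cong) (auto simp: Suc.IH)
  moreover have "x = u \<longleftrightarrow> n - x = n - u" using Suc.prems assms by auto
  ultimately show ?case by simp
qed

lemma survival_bounds: "x \<le> n \<Longrightarrow> 0 \<le> survival p q u m x \<and> survival p q u m x \<le> 1"
proof (induction m arbitrary: x)
  case (Suc m)
  have "T (\<lambda>_. 0) x \<le> T (survival p q u m) x" "T (survival p q u m) x \<le> T (\<lambda>_. 1) x"
    by (rule bdop_mono; use Suc in simp)+
  then show ?case by simp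
qed auto

lemma survival_Suc_le: "x \<le> n \<Longrightarrow> survival p q u (Suc m) x \<le> survival p q u m x"
proof (induction m arbitrary: x)
  case 0
  have "T (survival p q u 0) x \<le> T (\<lambda>_. 1) x"
    by (rule bdop_mono; use 0 in simp)
  then show ?case by auto
next
  case (Suc m)
  have "T (survival p q u (Suc m)) x \<le> T (survival p q u m) x"
    using Suc by (intro bdop_mono) auto
  then show ?case by auto
qed

lemma survival_antimono: "x \<le> n \<Longrightarrow> m \<le> k \<Longrightarrow> survival p q u k x \<le> survival p q u m x"
  by (rule lift_Suc_antimono_le[of "\<lambda>m. survival p q u m x"]) (auto simp: survival_Suc_le simp del: survival.simps)

lemma survival_at [simp]: "survival p q u m u = 0"
  by (cases m) auto

text \<open>
  To miss \<open>u\<close> for \<open>m1 + m2\<close> steps the chain must miss \<open>M\<close> for \<open>m1\<close> steps, or else miss \<open>u\<close> for at least \<open>m2\<close>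
  steps after its first visit to \<open>M\<close>.
\<close>
lemma survival_via:
  assumes "M \<le> n" "x \<le> n"
  shows "survival p q u (m1 + m2) x \<le> survival p q M m1 x + survival p q u m2 M"
  using assms(2)
proof (induction m1 arbitrary: x)
  case 0
  show ?case
    using survival_bounds[of x u m2] survival_bounds[of M u m2] 0 assms by auto
next
  case (Suc m)
  show ?case
  proof (cases "x = M")
    case True
    then show ?thesis using survival_antimono[OF assms(1), of m2 "Suc m + m2" u] by simp
  next
    case False
    show ?thesis
    proof (cases "x = u")
      case True
      then show ?thesis using survival_bounds[of x M "Suc m"] survival_bounds[of M u m2] Suc.prems assms by simp
    next
      case xu: False
      have "T (survival p q u (m + m2)) x \<le> T (\<lambda>y. survival p q M m y + survival p q u m2 M) x"
        using Suc.prems by (intro bdop_mono Suc.IH) auto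
      then show ?thesis using xu False by (simp add: bdop_add)
    qed
  qed
qed

text \<open>
  The strong Markov property at the hitting time of \<open>u\<close>: if \<open>u\<close> is hit at a time \<open>j \<le> m0\<close>, the conditional
  expectation of \<open>f (X m)\<close> is \<open>(T ^^ (m - j)) f u\<close>.
\<close>
lemma first_passage_bound:
  assumes "\<And>y. y \<le> n \<Longrightarrow> \<bar>f y\<bar> \<le> 1" "u \<le> n" "x \<le> n" "m0 \<le> m"
    and B: "\<And>k. m - m0 \<le> k \<Longrightarrow> k \<le> m \<Longrightarrow> \<bar>(T ^^ k) f u\<bar> \<le> B"
  shows "\<bar>(T ^^ m) f x\<bar> \<le> B + survival p q u m0 x"
  using assms(3-)
proof (induction m0 arbitrary: x m)
  case 0
  have "0 \<le> B" using 0(3)[of m] by auto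
  then show ?case using 0 funpow_bound[of f 1 x m] assms(1) by (cases "x = u") fastforce+
next
  case (Suc m0)
  show ?case
  proof (cases "x = u")
    case True
    then show ?thesis using Suc.prems(3)[of m] by simp
  next
    case False
    obtain m' where m: "m = Suc m'" using Suc.prems by (cases m) auto
    have *: "\<bar>(T ^^ m') f y\<bar> \<le> B + survival p q u m0 y" if "y \<le> n" for y
      using Suc.prems m that by (intro Suc.IH) auto
    have "T ((T ^^ m') f) x \<le> T (\<lambda>y. B + survival p q u m0 y) x"
      using * Suc.prems by (intro bdop_mono) (auto simp: abs_le_iff)
    moreover have "T (\<lambda>y. - 1 * (T ^^ m') f y) x \<le> T (\<lambda>y. B + survival p q u m0 y) x"
      using * Suc.prems by (intro bdop_mono) (auto simp: abs_le_iff)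
    ultimately show ?thesis using m False by (simp only: bdop_add bdop_cmult) (simp add: bdop_const)
  qed
qed

end

section \<open>Moments of hitting times and the Poincare inequality\<close>

text \<open>
  The second components of the two maxima belong to the reflected chain, that is, to hitting \<open>M\<close> from \<open>n\<close>.
\<close>
definition bd_theta where
  "bd_theta n p q \<pi> M = max (mean_hit p \<pi> 0 M) (mean_hit (\<lambda>i. q (n - i)) (\<lambda>i. \<pi> (n - i)) 0 (n - M))"

definition bd_alpha where
  "bd_alpha n p q \<pi> M =
     sqrt (max (hit_var p \<pi> 0 M) (hit_var (\<lambda>i. q (n - i)) (\<lambda>i. \<pi> (n - i)) 0 (n - M)))"

context bd_rates begin

lemma F_Suc: "F (Suc i) = F i + \<pi> (Suc i)" by (simp add: cum_def)
lemma F_0: "F 0 = \<pi> 0" by (simp add: cum_def)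
lemma F_top: "F n = 1" by (simp add: cum_def pi_sum)

lemma F_ge: "i \<le> n \<Longrightarrow> \<pi> i \<le> F i"
  unfolding cum_def by (rule member_le_sum) (auto intro!: less_imp_le pi_pos)

lemma F_pos: "i \<le> n \<Longrightarrow> 0 < F i"
  using F_ge[of i] pi_pos[of i] by linarith

lemma F_mono: "i \<le> j \<Longrightarrow> j \<le> n \<Longrightarrow> F i \<le> F j"
  unfolding cum_def by (rule sum_mono2) (auto intro!: order.strict_implies_order[OF pi_pos])

lemma F_le_1: "i \<le> n \<Longrightarrow> F i \<le> 1"
  using F_mono[of i n] F_top by simp

lemma p_le: "i \<le> n \<Longrightarrow> p i \<le> 1"
  using pq_le[of i] q_nonneg[of i] by linarith

lemma c_a: "i < n \<Longrightarrow> c i * a i = F i"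
  using p_pos[of i] pi_pos[of i] by (simp add: c_def passage_mean_def)

lemma a_eq: "a i = F i / c i"
  by (simp add: c_def passage_mean_def)

lemma a_ge_inverse: "i < n \<Longrightarrow> 1 / p i \<le> a i"
  using F_ge[of i] p_pos[of i] pi_pos[of i] by (simp add: passage_mean_def field_simps)

lemma a_ge_1: "i < n \<Longrightarrow> 1 \<le> a i"
  using a_ge_inverse[of i] p_le[of i] p_pos[of i] by (smt (verit) le_divide_eq_1 less_or_eq_imp_le)

lemma a_pos: "i < n \<Longrightarrow> 0 < a i"
  using a_ge_1[of i] by linarith

lemma step_var_ge: "i < n \<Longrightarrow> (a i)\<^sup>2 \<le> step_var p \<pi> i"
proof -
  assume i: "i < n"
  have "0 \<le> (\<Sum>l<i. a l * F l)"
    using i by (intro sum_nonneg mult_nonneg_nonneg) (auto intro!: less_imp_le a_pos F_pos)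
  then have "0 \<le> 2 * a i * (\<Sum>l<i. a l * F l) / F i"
    using a_pos[OF i] F_pos[of i] i by simp
  then show ?thesis by (simp add: step_var_def)
qed

lemma step_var_nonneg: "i < n \<Longrightarrow> 0 \<le> step_var p \<pi> i"
  using step_var_ge[of i] zero_le_power2[of "a i"] by linarith

lemma h_step: "x < M \<Longrightarrow> h x M = a x + h (Suc x) M"
  by (simp add: mean_hit_def sum.atLeast_Suc_lessThan)

lemma W_step: "x < M \<Longrightarrow> W x M = step_var p \<pi> x + W (Suc x) M"
  by (simp add: hit_var_def sum.atLeast_Suc_lessThan)

lemma h_end [simp]: "h M M = 0" by (simp add: mean_hit_def)
lemma W_end [simp]: "W M M = 0" by (simp add: hit_var_def)

lemma h_nonneg: "M \<le> n \<Longrightarrow> 0 \<le> h x M"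
  unfolding mean_hit_def by (intro sum_nonneg) (auto intro!: less_imp_le a_pos)

lemma W_nonneg: "M \<le> n \<Longrightarrow> 0 \<le> W x M"
  unfolding hit_var_def by (intro sum_nonneg step_var_nonneg) auto

lemma h_antimono: "M \<le> n \<Longrightarrow> h x M \<le> h 0 M"
  unfolding mean_hit_def by (intro sum_mono2) (auto intro!: less_imp_le a_pos)

lemma W_antimono: "M \<le> n \<Longrightarrow> W x M \<le> W 0 M"
  unfolding hit_var_def by (intro sum_mono2) (auto intro!: step_var_nonneg)

text \<open>
  The first step equation for the mean.
\<close>
lemma poisson_mean:
  assumes "x < M" "M \<le> n"
  shows "T (\<lambda>y. h y M) x = h x M - 1"
proof (cases x)
  case 0
  have "p 0 * a 0 = 1"
    using c_a[of 0] pi_pos[of 0] assms F_0 by (simp add: c_def)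
  then show ?thesis using 0 assms h_step[of 0 M] q_bot by (simp add: bdop_def algebra_simps)
next
  case (Suc k)
  have "\<pi> x * (p x * a x - q x * a k) = c x * a x - c k * a k"
    using balance[of k] Suc assms by (simp add: c_def algebra_simps)
  also have "\<dots> = \<pi> x" using Suc assms by (simp add: c_a F_Suc)
  finally have "p x * a x - q x * a k = 1" using pi_pos[of x] assms by simp
  then show ?thesis using Suc assms h_step[of k M] h_step[of x M] by (simp add: bdop_def algebra_simps)
qed

text \<open>
  The first step equation for the second moment in continuous time, whose source term is \<open>2 * h x M\<close>.  Multiplied
  by \<open>\<pi> x\<close>, both sides telescope in \<open>x\<close>.
\<close>
lemma poisson_second_moment:
  assumes "x < M" "M \<le> n"
  shows "T (\<lambda>y. W y M + (h y M)\<^sup>2) x = W x M + (h x M)\<^sup>2 - 2 * h x M"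
proof -
  define U where "U = (\<lambda>y. W y M + (h y M)\<^sup>2)"
  define \<sigma> where "\<sigma> = (\<lambda>i. \<Sum>l<i. a l * F l)"
  have U: "c i * (U i - U (Suc i)) = 2 * (F i * h i M + \<sigma> i)" if "i < M" for i
  proof -
    have i: "i < n" using that assms by simp
    have "U i - U (Suc i) = step_var p \<pi> i + a i * (2 * h i M - a i)"
      using h_step[OF that] W_step[OF that] by (simp add: U_def power2_eq_square algebra_simps)
    also have "\<dots> = 2 * a i * (h i M + \<sigma> i / F i)"
      by (simp add: step_var_def \<sigma>_def power2_eq_square algebra_simps)
    finally have "c i * (U i - U (Suc i)) = 2 * (c i * a i) * (h i M + \<sigma> i / F i)" by simp
    also have "\<dots> = 2 * (F i * h i M + \<sigma> i)"
      using c_a[OF i] F_pos[of i] i by (simp add: field_simps)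
    finally show ?thesis .
  qed
  have "\<pi> x * (U x - T U x) = 2 * \<pi> x * h x M"
  proof (cases x)
    case 0
    have "\<pi> 0 * (U 0 - T U 0) = c 0 * (U 0 - U (Suc 0))"
      using q_bot by (simp add: bdop_def c_def algebra_simps)
    then show ?thesis using U[of 0] 0 assms by (simp add: F_0 \<sigma>_def)
  next
    case (Suc k)
    have "\<pi> x * (U x - T U x) = c x * (U x - U (Suc x)) - \<pi> x * q x * (U k - U x)"
      using Suc by (simp add: bdop_def c_def algebra_simps)
    also have "\<pi> x * q x = c k" using Suc assms balance[of k] by (simp add: c_def)
    also have "c x * (U x - U (Suc x)) - c k * (U k - U x) =
        2 * (F x * h x M + \<sigma> x) - 2 * (F k * h k M + \<sigma> k)"
      using U[of x] U[of k] Suc assms by simp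
    also have "\<dots> = 2 * \<pi> x * h x M"
      using h_step[of k M] Suc assms by (simp add: F_Suc \<sigma>_def algebra_simps)
    finally show ?thesis .
  qed
  then have "U x - T U x = 2 * h x M" using pi_pos[of x] assms by simp
  then show ?thesis by (simp add: U_def)
qed

text \<open>
  The function \<open>W x M + (h x M - k)\<^sup>2\<close> plays the part of \<open>E\<^sub>x (\<tau> - k)\<^sup>2\<close>.  For the discrete chain it is a strict
  supersolution of the first step equation, since \<open>W\<close> is the larger, continuous time variance; this is why
  the two Chebyshev inequalities below follow by induction on time.
\<close>
lemma shifted_second_moment:
  assumes "x < M" "M \<le> n"
  shows "T (\<lambda>y. W y M + (h y M - (k - 1))\<^sup>2) x = W x M + (h x M - k)\<^sup>2 - 1"
proof -
  have "(\<lambda>y. W y M + (h y M - (k - 1))\<^sup>2) =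
      (\<lambda>y. ((W y M + (h y M)\<^sup>2) - 2 * (k - 1) * h y M) + (k - 1)\<^sup>2)"
    by (auto simp: power2_eq_square algebra_simps)
  then have "T (\<lambda>y. W y M + (h y M - (k - 1))\<^sup>2) x =
      (W x M + (h x M)\<^sup>2 - 2 * h x M - 2 * (k - 1) * (h x M - 1)) + (k - 1)\<^sup>2"
    using poisson_mean[OF assms] poisson_second_moment[OF assms]
    by (simp only: bdop_add bdop_diff bdop_cmult bdop_const)
  then show ?thesis by (simp add: power2_eq_square algebra_simps)
qed

text \<open>
  On the event that \<open>M\<close> is missed up to time \<open>m \<ge> k\<close> one has \<open>(\<tau> - k)\<^sup>2 \<ge> (m - k)\<^sup>2\<close>.  One step of the chain turns
  the pair \<open>(m + 1, k)\<close> into \<open>(m, k - 1)\<close>.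
\<close>
lemma survival_chebyshev_upper:
  assumes "x \<le> M" "M \<le> n" "k \<le> real m"
  shows "survival p q M m x * (real m - k)\<^sup>2 \<le> W x M + (h x M - k)\<^sup>2"
  using assms(1,3)
proof (induction m arbitrary: x k)
  case 0
  have "k\<^sup>2 \<le> (h x M - k)\<^sup>2"
    using 0 h_nonneg[OF assms(2), of x] by (smt (verit) power2_commute of_nat_0 power_mono)
  then show ?case using W_nonneg[OF assms(2), of x] zero_le_power2[of "h x M - k"] by (auto simp: of_bool_def)
next
  case (Suc m)
  show ?case
  proof (cases "x = M")
    case True
    then show ?thesis by simp
  next
    case False
    then have x: "x < M" using Suc.prems by simp
    have "T (\<lambda>y. (real m - (k - 1))\<^sup>2 * survival p q M m y) x \<le> T (\<lambda>y. W y M + (h y M - (k - 1))\<^sup>2) x"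
    proof -
      have "(real m - (k - 1))\<^sup>2 * survival p q M m y \<le> W y M + (h y M - (k - 1))\<^sup>2" if "y \<le> M" for y
        using Suc.IH[OF that, of "k - 1"] Suc.prems by (simp add: mult.commute)
      then show ?thesis using x assms by (intro bdop_mono_nbr) auto
    qed
    then have "(real m - (k - 1))\<^sup>2 * T (survival p q M m) x \<le> W x M + (h x M - k)\<^sup>2 - 1"
      using shifted_second_moment[OF x assms(2)] by (simp only: bdop_cmult)
    then show ?thesis using False by (simp add: algebra_simps)
  qed
qed

lemma survival_chebyshev_lower:
  assumes "x \<le> M" "M \<le> n" "real m \<le> k"
  shows "(1 - survival p q M m x) * (k - real m)\<^sup>2 \<le> W x M + (h x M - k)\<^sup>2"
  using assms(1,3)
proof (induction m arbitrary: x k)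
  case 0
  have "0 \<le> W x M + (h x M - k)\<^sup>2" using W_nonneg[OF assms(2), of x] by simp
  then show ?case by (auto simp: of_bool_def)
next
  case (Suc m)
  show ?case
  proof (cases "x = M")
    case True
    then show ?thesis using Suc.prems by (simp add: power_mono)
  next
    case False
    then have x: "x < M" using Suc.prems by simp
    have "T (\<lambda>y. ((k - 1) - real m)\<^sup>2 * (1 - survival p q M m y)) x \<le> T (\<lambda>y. W y M + (h y M - (k - 1))\<^sup>2) x"
    proof -
      have "((k - 1) - real m)\<^sup>2 * (1 - survival p q M m y) \<le> W y M + (h y M - (k - 1))\<^sup>2" if "y \<le> M" for y
        using Suc.IH[OF that, of "k - 1"] Suc.prems by (simp add: mult.commute)
      then show ?thesis using x assms by (intro bdop_mono_nbr) auto
    qed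
    then have "((k - 1) - real m)\<^sup>2 * (1 - T (survival p q M m) x) \<le> W x M + (h x M - k)\<^sup>2 - 1"
      using shifted_second_moment[OF x assms(2)] by (simp only: bdop_cmult bdop_diff bdop_const)
    then show ?thesis using False by (simp add: algebra_simps)
  qed
qed

lemma survival_markov:
  assumes "x \<le> M" "M \<le> n"
  shows "survival p q M m x * real m \<le> h x M"
proof -
  have "survival p q M m x * (real m - k) \<le> h x M - k" if "x \<le> M" "k \<le> 0" for k x
    using that
  proof (induction m arbitrary: x k)
    case 0
    then show ?case using h_nonneg[OF assms(2), of x] by (auto simp: of_bool_def)
  next
    case (Suc m)
    show ?case
    proof (cases "x = M")
      case True
      then show ?thesis using Suc.prems by simp
    next
      case False
      then have x: "x < M" using Suc.prems by simp
      have "T (\<lambda>y. (real m - (k - 1)) * survival p q M m y) x \<le> T (\<lambda>y. h y M - (k - 1)) x"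
      proof -
        have "(real m - (k - 1)) * survival p q M m y \<le> h y M - (k - 1)" if "y \<le> M" for y
          using Suc.IH[OF that, of "k - 1"] Suc.prems by (simp add: mult.commute)
        then show ?thesis using x assms by (intro bdop_mono_nbr) auto
      qed
      then have "(real m - (k - 1)) * T (survival p q M m) x \<le> h x M - 1 - (k - 1)"
        using poisson_mean[OF x assms(2)] by (simp only: bdop_cmult bdop_diff bdop_const)
      then show ?thesis using False by (simp add: algebra_simps)
    qed
  qed
  from this[of x 0] assms show ?thesis by simp
qed

text \<open>
  The correlation coefficients of the quadratic form behind the variance.
\<close>
definition corr :: "nat \<Rightarrow> nat \<Rightarrow> real" where
  "corr i l = F (min i l) / F (max i l)"

lemma corr_nonneg: "i \<le> n \<Longrightarrow> l \<le> n \<Longrightarrow> 0 \<le> corr i l"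
  using F_pos[of "min i l"] F_pos[of "max i l"] by (auto simp: corr_def intro!: divide_nonneg_nonneg less_imp_le)

lemma corr_le_1: "i \<le> n \<Longrightarrow> l \<le> n \<Longrightarrow> corr i l \<le> 1"
  using F_mono[of "min i l" "max i l"] F_pos[of "max i l"] by (auto simp: corr_def divide_le_eq_1)

text \<open>
  This form of the variance shows how it reacts to slowing: \<open>corr\<close> depends on \<open>\<pi>\<close> only, so that each
  edge enters through the two factors \<open>a\<close> alone.
\<close>
lemma W_double_sum:
  assumes "M \<le> n"
  shows "W 0 M = (\<Sum>i<M. \<Sum>l<M. a i * a l * corr i l)"
  using assms
proof (induction M)
  case (Suc M)
  have 1: "corr M M = 1" using F_pos[of M] Suc.prems by (simp add: corr_def)
  have 2: "(\<Sum>l<M. a M * a l * corr M l) = a M * (\<Sum>l<M. a l * F l) / F M"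
    by (simp add: corr_def sum_distrib_left sum_divide_distrib mult_ac min_def max_def)
  have 3: "(\<Sum>l<M. a l * a M * corr l M) = a M * (\<Sum>l<M. a l * F l) / F M"
    unfolding 2[symmetric] by (simp add: corr_def mult_ac min.commute max.commute)
  have "W 0 (Suc M) = W 0 M + step_var p \<pi> M"
    by (simp add: hit_var_def)
  then show ?case using Suc 1 2 3
    by (simp add: sum.distrib step_var_def power2_eq_square)
qed (simp add: hit_var_def)

lemma W_le_square:
  assumes "M \<le> n" shows "W 0 M \<le> (h 0 M)\<^sup>2"
proof -
  have "W 0 M \<le> (\<Sum>i<M. \<Sum>l<M. a i * a l)"
    unfolding W_double_sum[OF assms]
  proof (intro sum_mono)
    fix i l assume "i \<in> {..<M}" "l \<in> {..<M}"
    then show "a i * a l * corr i l \<le> a i * a l"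
      using corr_le_1[of i l] a_pos[of i] a_pos[of l] assms by (auto intro!: mult_right_le_one_le corr_nonneg)
  qed
  then show ?thesis
    by (simp add: mean_hit_def power2_eq_square sum_product atLeast0LessThan)
qed

lemma sum_a_square_le: "M \<le> n \<Longrightarrow> (\<Sum>i<M. (a i)\<^sup>2) \<le> W 0 M"
  unfolding hit_var_def atLeast0LessThan by (intro sum_mono step_var_ge) auto

lemma h_le_W: "M \<le> n \<Longrightarrow> h 0 M \<le> W 0 M"
proof -
  assume M: "M \<le> n"
  have "h 0 M \<le> (\<Sum>i<M. (a i)\<^sup>2)"
    unfolding mean_hit_def atLeast0LessThan
  proof (intro sum_mono)
    fix i assume "i \<in> {..<M}"
    then have "1 \<le> a i" using M a_ge_1[of i] by auto
    then show "a i \<le> (a i)\<^sup>2" by (simp add: power2_eq_square)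
  qed
  then show ?thesis using sum_a_square_le[OF M] by linarith
qed

lemma h_ge: "M \<le> n \<Longrightarrow> real M \<le> h 0 M"
  unfolding mean_hit_def atLeast0LessThan
  using sum_mono[of "{..<M}" "\<lambda>_. 1::real" a] a_ge_1 by auto

text \<open>
  Between two states of the bulk the chain travels quickly: the mean travel time from \<open>M'\<close> to \<open>M\<close> is at most
  the standard deviation divided by \<open>sqrt (F M')\<close>.
\<close>
lemma W_ge_tail:
  assumes "M' \<le> M" "M \<le> n"
  shows "F M' * (h M' M)\<^sup>2 \<le> W 0 M"
proof -
  have nn: "0 \<le> a i * a l * corr i l" if "i < M" "l < M" for i l
    using that assms by (intro mult_nonneg_nonneg corr_nonneg) (auto intro!: less_imp_le a_pos)
  have "F M' * (h M' M)\<^sup>2 = (\<Sum>i=M'..<M. \<Sum>l=M'..<M. a i * a l * F M')"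
    by (simp add: mean_hit_def power2_eq_square sum_product sum_distrib_left mult_ac)
  also have "\<dots> \<le> (\<Sum>i=M'..<M. \<Sum>l=M'..<M. a i * a l * corr i l)"
  proof (intro sum_mono mult_left_mono)
    fix i l assume il: "i \<in> {M'..<M}" "l \<in> {M'..<M}"
    have "F M' \<le> F (min i l)" using il assms by (intro F_mono) auto
    also have "\<dots> \<le> F (min i l) / F (max i l)"
      using il assms F_le_1[of "max i l"] F_pos[of "max i l"] F_pos[of "min i l"]
      by (simp add: le_divide_eq min_def max_def split: if_splits)
    finally show "F M' \<le> corr i l" by (simp add: corr_def)
    show "0 \<le> a i * a l" using il assms a_pos[of i] a_pos[of l] by simp
  qed
  also have "\<dots> \<le> (\<Sum>i=M'..<M. \<Sum>l<M. a i * a l * corr i l)"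
    by (intro sum_mono sum_mono2) (auto intro!: nn)
  also have "\<dots> \<le> (\<Sum>i<M. \<Sum>l<M. a i * a l * corr i l)"
    by (intro sum_mono2) (auto intro!: nn sum_nonneg)
  also have "\<dots> = W 0 M" by (rule W_double_sum[symmetric]) fact
  finally show ?thesis .
qed

text \<open>
  For functions vanishing at \<open>M\<close>, the squared norm is a quadratic form in the increments with kernel
  \<open>F (min i l)\<close>; measured in the norm of the Dirichlet form, the Hilbert--Schmidt norm of this kernel is exactly
  \<open>sqrt (W 0 M)\<close>.
\<close>
lemma poincare_left:
  assumes "M \<le> n"
  shows "(\<Sum>x<M. \<pi> x * (f x - f M)\<^sup>2) \<le> sqrt (W 0 M) * (\<Sum>i<M. c i * (f i - f (Suc i))\<^sup>2)"
proof -
  define g where "g = (\<lambda>i. f i - f (Suc i))"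
  define E where "E = (\<Sum>i<M. c i * (g i)\<^sup>2)"
  define I where "I = {..<M} \<times> {..<M}"
  have cp: "0 < c i" if "i < M" for i using that assms c_pos by auto
  have tel: "f x - f M = (\<Sum>i<M. of_bool (x \<le> i) * g i)" if "x < M" for x
  proof -
    have "(\<Sum>i<M. of_bool (x \<le> i) * g i) = (\<Sum>i=x..<M. g i)"
      by (intro sum.mono_neutral_cong_right) auto
    also have "\<dots> = f x - f M" using that unfolding g_def
      by (subst sum_Suc_diff'[of x M "\<lambda>i. - f i", simplified, symmetric]) auto
    finally show ?thesis by simp
  qed
  have "(\<Sum>x<M. \<pi> x * (f x - f M)\<^sup>2) =
      (\<Sum>x<M. \<Sum>(i,l)\<in>I. \<pi> x * of_bool (x \<le> min i l) * (g i * g l))"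
  proof (intro sum.cong refl)
    fix x assume "x \<in> {..<M}"
    then have "(f x - f M)\<^sup>2 = (\<Sum>i<M. \<Sum>l<M. (of_bool (x \<le> i) * g i) * (of_bool (x \<le> l) * g l))"
      by (simp only: tel lessThan_iff power2_eq_square sum_product)
    then show "\<pi> x * (f x - f M)\<^sup>2 = (\<Sum>(i,l)\<in>I. \<pi> x * of_bool (x \<le> min i l) * (g i * g l))"
      unfolding I_def sum.cartesian_product[symmetric]
      by (simp only: sum_distrib_left) (intro sum.cong refl, simp add: of_bool_conj mult_ac)
  qed
  also have "\<dots> = (\<Sum>(i,l)\<in>I. F (min i l) * (g i * g l))"
  proof (subst sum.swap, intro sum.cong refl, clarify)
    fix i l assume "(i, l) \<in> I"
    then have "(\<Sum>x<M. \<pi> x * of_bool (x \<le> min i l)) = F (min i l)"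
      unfolding cum_def by (intro sum.mono_neutral_cong_right) (auto simp: I_def)
    then show "(\<Sum>x<M. \<pi> x * of_bool (x \<le> min i l) * (g i * g l)) = F (min i l) * (g i * g l)"
      by (simp add: sum_distrib_right[symmetric])
  qed
  finally have lhs: "(\<Sum>x<M. \<pi> x * (f x - f M)\<^sup>2) = (\<Sum>(i,l)\<in>I. F (min i l) * (g i * g l))" .
  have "(\<Sum>(i,l)\<in>I. F (min i l) * (g i * g l))\<^sup>2 =
      (\<Sum>z\<in>I. (sqrt (c (fst z) * c (snd z)) * (g (fst z) * g (snd z))) *
               (F (min (fst z) (snd z)) / sqrt (c (fst z) * c (snd z))))\<^sup>2"
    by (intro arg_cong[where f = "\<lambda>x. x\<^sup>2"] sum.cong) (use cp in \<open>force simp: I_def\<close>)+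
  also have "\<dots> \<le> (\<Sum>z\<in>I. (sqrt (c (fst z) * c (snd z)) * (g (fst z) * g (snd z)))\<^sup>2) *
      (\<Sum>z\<in>I. (F (min (fst z) (snd z)) / sqrt (c (fst z) * c (snd z)))\<^sup>2)"
    by (rule Cauchy_Schwarz_ineq_sum)
  also have "(\<Sum>z\<in>I. (sqrt (c (fst z) * c (snd z)) * (g (fst z) * g (snd z)))\<^sup>2) = E\<^sup>2"
  proof -
    have "(\<Sum>z\<in>I. (sqrt (c (fst z) * c (snd z)) * (g (fst z) * g (snd z)))\<^sup>2) =
        (\<Sum>(i,l)\<in>I. (c i * (g i)\<^sup>2) * (c l * (g l)\<^sup>2))"
      by (intro sum.cong) (use cp in \<open>auto simp: I_def power_mult_distrib less_imp_le\<close>)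
    then show ?thesis
      by (simp add: E_def I_def power2_eq_square[of "sum _ _"] sum_product sum.cartesian_product)
  qed
  also have "(\<Sum>z\<in>I. (F (min (fst z) (snd z)) / sqrt (c (fst z) * c (snd z)))\<^sup>2) = W 0 M"
  proof -
    have "(F (min i l) / sqrt (c i * c l))\<^sup>2 = a i * a l * corr i l" if "i < M" "l < M" for i l
    proof -
      have "(F (min i l) / sqrt (c i * c l))\<^sup>2 = (F (min i l))\<^sup>2 / (c i * c l)"
        using cp that by (simp add: power_divide less_imp_le)
      moreover have "F i * F l = F (min i l) * F (max i l)" by (simp add: min_def max_def)
      then have "a i * a l * corr i l = (F (min i l))\<^sup>2 / (c i * c l)"
        using F_pos[of "max i l"] that assms cp[of i] cp[of l]
        by (simp add: a_eq corr_def field_simps power2_eq_square)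
      ultimately show ?thesis by simp
    qed
    then show ?thesis unfolding W_double_sum[OF assms] I_def sum.cartesian_product
      by (intro sum.cong) auto
  qed
  finally have "(\<Sum>(i,l)\<in>I. F (min i l) * (g i * g l))\<^sup>2 \<le> E\<^sup>2 * W 0 M" .
  moreover have "0 \<le> E" unfolding E_def by (intro sum_nonneg) (use cp in \<open>auto intro!: mult_nonneg_nonneg order.strict_implies_order[OF cp]\<close>)
  ultimately have "(\<Sum>(i,l)\<in>I. F (min i l) * (g i * g l)) \<le> sqrt (E\<^sup>2 * W 0 M)"
    by (intro real_le_rsqrt)
  with \<open>0 \<le> E\<close> show ?thesis unfolding lhs by (simp add: real_sqrt_mult E_def g_def mult.commute)
qed

abbreviation "\<theta> \<equiv> bd_theta n p q \<pi>"
abbreviation "\<alpha> \<equiv> bd_alpha n p q \<pi>"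

lemma reflect_c: assumes "i < n" shows "bd_rates.c rp r\<pi> i = c (n - Suc i)"
proof -
  interpret R: bd_rates n rp rq r\<pi> by (rule reflect)
  have "Suc (n - Suc i) = n - i" using assms by simp
  then show ?thesis using balance[of "n - Suc i"] assms by (simp add: R.c_def c_def)
qed

text \<open>
  Subtracting \<open>f M\<close> instead of the mean can only increase the squared norm, and decouples the two sides of \<open>M\<close>.
\<close>
lemma poincare:
  assumes "M \<le> n" "avg f = 0"
  shows "ip f f \<le> \<alpha> M * energy f"
proof -
  interpret R: bd_rates n rp rq r\<pi> by (rule reflect)
  have "ip f f \<le> ip f f + (f M)\<^sup>2" by simp
  also have "\<dots> = (\<Sum>x\<le>n. \<pi> x * (f x - f M)\<^sup>2)"
  proof -
    have "(\<Sum>x\<le>n. \<pi> x * (f x - f M)\<^sup>2) = ip f f - 2 * f M * avg f + (f M)\<^sup>2 * (\<Sum>x\<le>n. \<pi> x)"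
      unfolding ip_def avg_def sum_distrib_left sum_subtractf[symmetric] sum.distrib[symmetric]
      by (intro sum.cong) (auto simp: power2_eq_square algebra_simps)
    then show ?thesis using assms by (simp add: pi_sum)
  qed
  also have "\<dots> = (\<Sum>x<M. \<pi> x * (f x - f M)\<^sup>2) + (\<Sum>x=M..n. \<pi> x * (f x - f M)\<^sup>2)"
  proof -
    have "{..n} = {..<M} \<union> {M..n}" using assms by auto
    then show ?thesis by (simp add: sum.union_disjoint ivl_disj_int)
  qed
  also have "(\<Sum>x=M..n. \<pi> x * (f x - f M)\<^sup>2) = (\<Sum>x<n-M. r\<pi> x * (f (n - x) - f (n - (n - M)))\<^sup>2)"
  proof -
    have "(\<Sum>x=M..n. \<pi> x * (f x - f M)\<^sup>2) = (\<Sum>x=Suc M..n. \<pi> x * (f x - f M)\<^sup>2)"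
      using assms by (simp add: sum.atLeast_Suc_atMost)
    also have "\<dots> = (\<Sum>x<n-M. r\<pi> x * (f (n - x) - f (n - (n - M)))\<^sup>2)"
      using assms by (intro sum.reindex_bij_witness[of _ "\<lambda>x. n - x" "\<lambda>x. n - x"]) auto
    finally show ?thesis .
  qed
  also have "(\<Sum>x<M. \<pi> x * (f x - f M)\<^sup>2) \<le> \<alpha> M * (\<Sum>i<M. c i * (f i - f (Suc i))\<^sup>2)"
  proof -
    have "sqrt (W 0 M) \<le> \<alpha> M" by (simp add: bd_alpha_def)
    then show ?thesis using poincare_left[OF assms(1), of f] c_pos assms(1)
      by (smt (verit) mult_right_mono sum_nonneg lessThan_iff less_le_trans mult_nonneg_nonneg zero_le_power2)
  qed
  also have "(\<Sum>x<n-M. r\<pi> x * (f (n - x) - f (n - (n - M)))\<^sup>2) \<le>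
      \<alpha> M * (\<Sum>i=M..<n. c i * (f i - f (Suc i))\<^sup>2)"
  proof -
    have 1: "sqrt (R.W 0 (n - M)) \<le> \<alpha> M" by (simp add: bd_alpha_def)
    have 2: "(\<Sum>i<n-M. R.c i * (f (n - i) - f (n - Suc i))\<^sup>2) = (\<Sum>i=M..<n. c i * (f i - f (Suc i))\<^sup>2)"
    proof (rule sum.reindex_bij_witness[of _ "\<lambda>i. n - Suc i" "\<lambda>i. n - Suc i"])
      fix i assume i: "i \<in> {..<n - M}"
      then have "Suc (n - Suc i) = n - i" by auto
      then show "c (n - Suc i) * (f (n - Suc i) - f (Suc (n - Suc i)))\<^sup>2 = R.c i * (f (n - i) - f (n - Suc i))\<^sup>2"
        using i by (simp add: reflect_c power2_commute)
    qed auto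
    have "0 \<le> (\<Sum>i=M..<n. c i * (f i - f (Suc i))\<^sup>2)"
      by (intro sum_nonneg mult_nonneg_nonneg) (auto intro!: less_imp_le c_pos)
    then have "sqrt (R.W 0 (n - M)) * (\<Sum>i=M..<n. c i * (f i - f (Suc i))\<^sup>2) \<le> \<alpha> M * (\<Sum>i=M..<n. c i * (f i - f (Suc i))\<^sup>2)"
      using 1 by (intro mult_right_mono)
    then show ?thesis using R.poincare_left[of "n - M" "\<lambda>x. f (n - x)"] unfolding 2 by linarith
  qed
  also have "\<alpha> M * (\<Sum>i<M. c i * (f i - f (Suc i))\<^sup>2) + \<alpha> M * (\<Sum>i=M..<n. c i * (f i - f (Suc i))\<^sup>2) = \<alpha> M * energy f"
  proof -
    have "{..<n} = {..<M} \<union> {M..<n}" using assms by auto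
    then show ?thesis by (simp add: energy_def sum.union_disjoint ivl_disj_int distrib_left)
  qed
  finally show ?thesis by simp
qed

end

section \<open>Decay in mean square and the upper bound on mixing\<close>

text \<open>
  The decrements over the window \<open>{j..<j + s}\<close> telescope to at most \<open>H j\<close>, and none of them is smaller than the one that
  follows the window.
\<close>
lemma antimono_increment_bound:
  fixes H :: "nat \<Rightarrow> real"
  assumes "\<And>i. 0 \<le> H i" "\<And>i. H (Suc i) - H (Suc (Suc i)) \<le> H i - H (Suc i)"
  shows "real s * (H (j + s) - H (Suc (j + s))) \<le> H j"
proof -
  let ?G = "\<lambda>i. H i - H (Suc i)"
  have "antimono ?G" by (intro decseq_SucI assms)
  then have "(\<Sum>i=j..<j+s. ?G (j + s)) \<le> (\<Sum>i=j..<j+s. ?G i)"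
    by (intro sum_mono antimonoD[of ?G]) auto
  also have "\<dots> = H j - H (j + s)"
    using sum_Suc_diff'[of j "j + s" "\<lambda>i. - H i"] by simp
  finally show ?thesis using assms(1)[of "j + s"] by simp
qed

lemma hit_var_cong:
  assumes "\<And>i. i < M \<Longrightarrow> p i = p' i" "\<And>i. i < M \<Longrightarrow> \<pi> i = \<pi>' i"
  shows "hit_var p \<pi> x M = hit_var p' \<pi>' x M"
proof -
  have 1: "cum \<pi> i = cum \<pi>' i" if "i < M" for i
    unfolding cum_def using assms that by (intro sum.cong) auto
  have 2: "passage_mean p \<pi> i = passage_mean p' \<pi>' i" if "i < M" for i
    using assms that 1 by (simp add: passage_mean_def)
  show ?thesis unfolding hit_var_def step_var_def
    by (intro sum.cong arg_cong2[where f = "(+)"] arg_cong2[where f = "(/)"] arg_cong2[where f = "(*)"])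
       (auto simp: 1 2)
qed

lemma mean_hit_cong:
  assumes "\<And>i. i < M \<Longrightarrow> p i = p' i" "\<And>i. i < M \<Longrightarrow> \<pi> i = \<pi>' i"
  shows "mean_hit p \<pi> x M = mean_hit p' \<pi>' x M"
  unfolding mean_hit_def passage_mean_def cum_def using assms
  by (intro sum.cong arg_cong2[where f = "(/)"]) auto

context bd_rates begin

lemma reflect_alpha: "M \<le> n \<Longrightarrow> bd_alpha n rp rq r\<pi> (n - M) = \<alpha> M"
  unfolding bd_alpha_def
  by (subst hit_var_cong[of "n - (n - M)" "\<lambda>i. rq (n - i)" p "\<lambda>i. r\<pi> (n - i)" \<pi>])
     (auto simp: max.commute)

lemma reflect_theta: "M \<le> n \<Longrightarrow> bd_theta n rp rq r\<pi> (n - M) = \<theta> M"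
  unfolding bd_theta_def
  by (subst mean_hit_cong[of "n - (n - M)" "\<lambda>i. rq (n - i)" p "\<lambda>i. r\<pi> (n - i)" \<pi>])
     (auto simp: max.commute)

lemma reflect_F: "i \<le> n \<Longrightarrow> cum r\<pi> (n - i) = (\<Sum>k=i..n. \<pi> k)"
  unfolding cum_def by (rule sum.reindex_bij_witness[of _ "\<lambda>k. n - k" "\<lambda>k. n - k"]) auto

lemma W_le_alpha: "M \<le> n \<Longrightarrow> x \<le> M \<Longrightarrow> W x M \<le> (\<alpha> M)\<^sup>2"
  using W_antimono[of M x] W_nonneg[of M 0] by (simp add: bd_alpha_def)

lemma h_le_theta: "M \<le> n \<Longrightarrow> h x M \<le> \<theta> M"
  using h_antimono[of M x] by (simp add: bd_theta_def)

lemma theta_ge: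
  assumes "M \<le> n" shows "real n / 2 \<le> \<theta> M"
proof -
  interpret R: bd_rates n rp rq r\<pi> by (rule reflect)
  have "real M \<le> \<theta> M" "real (n - M) \<le> \<theta> M"
    using h_ge[OF assms] R.h_ge[of "n - M"] by (auto simp: bd_theta_def)
  then show ?thesis using assms by (simp add: of_nat_diff)
qed

lemma alpha_le_theta:
  assumes "M \<le> n" shows "\<alpha> M \<le> \<theta> M"
proof -
  interpret R: bd_rates n rp rq r\<pi> by (rule reflect)
  have 1: "sqrt (W 0 M) \<le> h 0 M"
    using W_le_square[OF assms] h_nonneg[OF assms] by (simp add: real_le_lsqrt)
  have 2: "sqrt (R.W 0 (n - M)) \<le> R.h 0 (n - M)"
    using R.W_le_square[of "n - M"] R.h_nonneg[of "n - M"] by (simp add: real_le_lsqrt)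
  show ?thesis using 1 2 by (simp add: bd_theta_def bd_alpha_def max_def)
qed

lemma alpha_ge_1:
  assumes "M \<le> n" shows "1 \<le> \<alpha> M"
proof -
  interpret R: bd_rates n rp rq r\<pi> by (rule reflect)
  have "1 \<le> W 0 M \<or> 1 \<le> R.W 0 (n - M)"
  proof (cases "M = 0")
    case True
    then show ?thesis using R.h_ge[of "n - M"] R.h_le_W[of "n - M"] n_pos by auto
  next
    case False
    then show ?thesis using h_ge[OF assms] h_le_W[OF assms] by auto
  qed
  then show ?thesis by (auto simp: bd_alpha_def)
qed

text \<open>
  From \<open>M\<close> to a state \<open>u\<close> on its right: the travel time from \<open>M\<close> to \<open>u\<close> is at most the sum of \<open>1 / c i\<close> over the
  edges in between, and on these edges the reflected passage times from \<open>u\<close> down to \<open>M\<close> are at least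
  \<open>\<eta> / c i\<close>.  The latter are controlled by the variance of the reflected chain.
\<close>
lemma h_right_of:
  assumes "M \<le> u" "u \<le> n" "0 < \<eta>" "\<eta> \<le> (\<Sum>k=u..n. \<pi> k)"
  shows "h M u \<le> \<alpha> M / (\<eta> * sqrt \<eta>)"
proof -
  interpret R: bd_rates n rp rq r\<pi> by (rule reflect)
  have eta: "\<eta> \<le> R.F (n - u)" using assms reflect_F by simp
  have "\<eta> * (R.h (n - u) (n - M))\<^sup>2 \<le> R.F (n - u) * (R.h (n - u) (n - M))\<^sup>2"
    using eta by (intro mult_right_mono) auto
  also have "\<dots> \<le> R.W 0 (n - M)" using assms by (intro R.W_ge_tail) auto
  finally have "sqrt (\<eta> * (R.h (n - u) (n - M))\<^sup>2) \<le> sqrt (R.W 0 (n - M))" by simp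
  moreover have "0 \<le> R.h (n - u) (n - M)" by (rule R.h_nonneg) simp
  moreover have "sqrt (R.W 0 (n - M)) \<le> \<alpha> M" by (simp add: bd_alpha_def)
  ultimately have 1: "sqrt \<eta> * R.h (n - u) (n - M) \<le> \<alpha> M"
    by (simp add: real_sqrt_mult)
  have "\<eta> * h M u = (\<Sum>i=M..<u. \<eta> * a i)" by (simp add: mean_hit_def sum_distrib_left)
  also have "\<dots> \<le> (\<Sum>i=M..<u. R.a (n - Suc i))"
  proof (intro sum_mono)
    fix i assume i: "i \<in> {M..<u}"
    then have ii: "n - Suc (n - Suc i) = i" using assms by auto
    have "R.F (n - u) \<le> R.F (n - Suc i)" using i by (intro R.F_mono) auto
    then have "\<eta> \<le> R.F (n - Suc i)" using eta by linarith
    moreover have "F i \<le> 1" using i assms by (intro F_le_1) auto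
    moreover have "0 < F i" "0 < c i" using i assms by (auto intro!: F_pos c_pos)
    moreover have "R.a (n - Suc i) = R.F (n - Suc i) / c i"
      unfolding R.a_eq using i assms by (subst reflect_c) (auto simp: ii)
    ultimately show "\<eta> * a i \<le> R.a (n - Suc i)"
      using assms(3) mult_mono[of \<eta> "R.F (n - Suc i)" "F i" 1] by (simp add: a_eq divide_right_mono)
  qed
  also have "\<dots> = R.h (n - u) (n - M)"
    unfolding mean_hit_def using assms
    by (intro sum.reindex_bij_witness[of _ "\<lambda>i. n - Suc i" "\<lambda>i. n - Suc i"]) auto
  finally have "sqrt \<eta> * (\<eta> * h M u) \<le> sqrt \<eta> * R.h (n - u) (n - M)"
    using assms by (intro mult_left_mono) auto
  then have "h M u * (\<eta> * sqrt \<eta>) \<le> \<alpha> M" using 1 by (simp add: mult_ac)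
  then show ?thesis using assms by (simp add: pos_le_divide_eq)
qed

lemma survival_right_of:
  assumes "M \<le> u" "u \<le> n" "0 < \<eta>" "\<eta> \<le> (\<Sum>k=u..n. \<pi> k)" "0 < s"
  shows "survival p q u s M \<le> \<alpha> M / (\<eta> * sqrt \<eta>) / real s"
proof -
  have "survival p q u s M * real s \<le> \<alpha> M / (\<eta> * sqrt \<eta>)"
    using survival_markov[OF assms(1,2), of s] h_right_of[OF assms(1-4)] by linarith
  then show ?thesis using assms(5) by (subst pos_le_divide_eq) auto
qed

lemma survival_good_state:
  assumes "M \<le> n" "u \<le> n" "0 < \<eta>" "\<eta> \<le> F u" "\<eta> \<le> (\<Sum>k=u..n. \<pi> k)" "0 < s"
  shows "survival p q u s M \<le> \<alpha> M / (\<eta> * sqrt \<eta>) / real s"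
proof (cases "M \<le> u")
  case True
  then show ?thesis using survival_right_of assms by blast
next
  case False
  interpret R: bd_rates n rp rq r\<pi> by (rule reflect)
  have "(\<Sum>k=n-u..n. r\<pi> k) = F u"
    unfolding cum_def using assms by (intro sum.reindex_bij_witness[of _ "\<lambda>k. n - k" "\<lambda>k. n - k"]) auto
  then have "survival rp rq (n - u) s (n - M) \<le> R.\<alpha> (n - M) / (\<eta> * sqrt \<eta>) / real s"
    using False assms by (intro R.survival_right_of) auto
  then show ?thesis using survival_reflect[of "n - M" "n - u" s] reflect_alpha assms by simp
qed

lemma survival_M_left:
  assumes "M \<le> n" "x \<le> M" "\<theta> M + s \<le> real m" "0 < s"
  shows "survival p q M m x \<le> (\<alpha> M)\<^sup>2 / s\<^sup>2"
proof -
  have hx: "h x M + s \<le> real m" using h_le_theta[OF assms(1), of x] assms by linarith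
  have sv: "0 \<le> survival p q M m x" using survival_bounds[of x M m] assms by auto
  have "survival p q M m x * s\<^sup>2 \<le> survival p q M m x * (real m - h x M)\<^sup>2"
    using hx assms sv by (intro mult_left_mono power_mono) auto
  also have "\<dots> \<le> W x M + (h x M - h x M)\<^sup>2"
    using hx assms by (intro survival_chebyshev_upper) auto
  also have "\<dots> \<le> (\<alpha> M)\<^sup>2" using W_le_alpha assms by simp
  finally show ?thesis using assms by (simp add: pos_le_divide_eq)
qed

lemma survival_M:
  assumes "M \<le> n" "x \<le> n" "\<theta> M + s \<le> real m" "0 < s"
  shows "survival p q M m x \<le> (\<alpha> M)\<^sup>2 / s\<^sup>2"
proof (cases "x \<le> M")
  case True
  then show ?thesis using survival_M_left assms by blast
next
  case False
  interpret R: bd_rates n rp rq r\<pi> by (rule reflect)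
  have "survival rp rq (n - M) m (n - x) \<le> (R.\<alpha> (n - M))\<^sup>2 / s\<^sup>2"
    using False assms reflect_theta[of M] by (intro R.survival_M_left) auto
  then show ?thesis using survival_reflect[of "n - x" "n - M" m] reflect_alpha assms by simp
qed

lemma mass_low: "0 < \<eta> \<Longrightarrow> (\<Sum>u | u \<le> n \<and> F u < \<eta>. \<pi> u) \<le> \<eta>"
proof (cases "{u. u \<le> n \<and> F u < \<eta>} = {}")
  case False
  define S where "S = {u. u \<le> n \<and> F u < \<eta>}"
  assume "0 < \<eta>"
  have fin: "finite S" unfolding S_def by auto
  define v where "v = Max S"
  have v: "v \<in> S" unfolding v_def using False fin by (intro Max_in) (auto simp: S_def)
  have "sum \<pi> S \<le> sum \<pi> {..v}"
  proof (rule sum_mono2)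
    show "S \<subseteq> {..v}" using fin by (auto simp: v_def)
  qed (use v in \<open>auto simp: S_def intro!: order.strict_implies_order[OF pi_pos]\<close>)
  also have "\<dots> \<le> \<eta>" using v by (auto simp: S_def cum_def)
  finally show ?thesis by (simp add: S_def)
qed (metis less_imp_le sum.empty)

lemma mass_high: "0 < \<eta> \<Longrightarrow> (\<Sum>u | u \<le> n \<and> (\<Sum>k=u..n. \<pi> k) < \<eta>. \<pi> u) \<le> \<eta>"
proof -
  assume "0 < \<eta>"
  interpret R: bd_rates n rp rq r\<pi> by (rule reflect)
  have "(\<Sum>u | u \<le> n \<and> (\<Sum>k=u..n. \<pi> k) < \<eta>. \<pi> u) = (\<Sum>u | u \<le> n \<and> R.F u < \<eta>. r\<pi> u)"
  proof (rule sum.reindex_bij_witness[of _ "\<lambda>k. n - k" "\<lambda>k. n - k"])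
    fix b assume "b \<in> {u. u \<le> n \<and> R.F u < \<eta>}"
    then show "n - b \<in> {u. u \<le> n \<and> (\<Sum>k=u..n. \<pi> k) < \<eta>}" using reflect_F[of "n - b"] by auto
  qed (auto simp: reflect_F)
  then show ?thesis using R.mass_low[OF \<open>0 < \<eta>\<close>] by simp
qed

text \<open>
  Pointwise Jensen inequality for the three-point average \<open>T g x\<close>, keeping the terms of the variance that pair the
  centre \<open>x\<close>, whose weight is at least \<open>\<delta>\<close>, with its two neighbours.
\<close>
lemma lazy_contraction:
  assumes holding: "\<And>i. i \<le> n \<Longrightarrow> p i + q i \<le> 1 - \<delta>"
  shows "ip (T g) (T g) + 2 * \<delta> * energy g \<le> ip g g"
proof -
  let ?g2 = "\<lambda>y. (g y)\<^sup>2"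
  let ?k = "\<lambda>x. T ?g2 x - 2 * g x * T g x + (g x)\<^sup>2"
  have "(T g x)\<^sup>2 + \<delta> * ?k x \<le> T ?g2 x" if "x \<le> n" for x
  proof -
    define A where "A = g (x + 1)" define B where "B = g (x - 1)" define C where "C = g x"
    define P where "P = p x" define Q where "Q = q x"
    have nn: "0 \<le> P" "0 \<le> Q" "\<delta> \<le> 1 - P - Q"
      using holding[OF that] p_nonneg[OF that] q_nonneg[OF that] by (auto simp: P_def Q_def)
    have "T ?g2 x - (T g x)\<^sup>2 - \<delta> * ?k x =
       P * Q * (A - B)\<^sup>2 + (1 - P - Q - \<delta>) * (P * (A - C)\<^sup>2 + Q * (B - C)\<^sup>2)"
      unfolding bdop_def A_def[symmetric] B_def[symmetric] C_def[symmetric] P_def[symmetric] Q_def[symmetric]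
      by (simp add: power2_eq_square algebra_simps)
    also have "\<dots> \<ge> 0" using nn by (intro add_nonneg_nonneg mult_nonneg_nonneg) auto
    finally show ?thesis by simp
  qed
  then have "(\<Sum>x\<le>n. \<pi> x * ((T g x)\<^sup>2 + \<delta> * ?k x)) \<le> (\<Sum>x\<le>n. \<pi> x * T ?g2 x)"
    by (intro sum_mono mult_left_mono) (auto intro!: less_imp_le pi_pos)
  moreover have "(\<Sum>x\<le>n. \<pi> x * T ?g2 x) = ip g g"
    using avg_T[of ?g2] by (simp add: avg_def ip_def power2_eq_square mult_ac)
  moreover have "(\<Sum>x\<le>n. \<pi> x * ((T g x)\<^sup>2 + \<delta> * ?k x)) =
      ip (T g) (T g) + \<delta> * ((\<Sum>x\<le>n. \<pi> x * T ?g2 x) - 2 * ip g (T g) + ip g g)"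
    by (simp add: ip_def sum_distrib_left sum.distrib sum_subtractf power2_eq_square algebra_simps)
  ultimately show ?thesis by (simp add: energy_alt algebra_simps)
qed

lemma ip_contract: "ip (T g) (T g) \<le> ip g g"
  using lazy_contraction[of 0 g] pq_le by simp

text \<open>
  The operator \<open>I + T\<close> is at least \<open>2 \<delta>\<close>: the average of \<open>(g y + g x)\<^sup>2\<close> over the next state \<open>y\<close> is at least
  the contribution \<open>4 \<delta> (g x)\<^sup>2\<close> of holding.
\<close>
lemma lazy_lower_bound:
  assumes holding: "\<And>i. i \<le> n \<Longrightarrow> p i + q i \<le> 1 - \<delta>"
  shows "2 * \<delta> * ip g g \<le> ip g g + ip g (T g)"
proof -
  let ?g2 = "\<lambda>y. (g y)\<^sup>2"
  have "4 * \<delta> * (g x)\<^sup>2 \<le> T ?g2 x + 2 * g x * T g x + (g x)\<^sup>2" if "x \<le> n" for x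
  proof -
    define A where "A = g (x + 1)" define B where "B = g (x - 1)" define C where "C = g x"
    define P where "P = p x" define Q where "Q = q x"
    have nn: "0 \<le> P" "0 \<le> Q" "\<delta> \<le> 1 - P - Q"
      using holding[OF that] p_nonneg[OF that] q_nonneg[OF that] by (auto simp: P_def Q_def)
    have "T ?g2 x + 2 * g x * T g x + (g x)\<^sup>2 - 4 * \<delta> * (g x)\<^sup>2 =
       P * (A + C)\<^sup>2 + Q * (B + C)\<^sup>2 + 4 * (1 - P - Q - \<delta>) * C\<^sup>2"
      unfolding bdop_def A_def[symmetric] B_def[symmetric] C_def[symmetric] P_def[symmetric] Q_def[symmetric]
      by (simp add: power2_eq_square algebra_simps)
    also have "\<dots> \<ge> 0" using nn by (intro add_nonneg_nonneg mult_nonneg_nonneg) auto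
    finally show ?thesis by simp
  qed
  then have "(\<Sum>x\<le>n. \<pi> x * (4 * \<delta> * (g x)\<^sup>2)) \<le> (\<Sum>x\<le>n. \<pi> x * (T ?g2 x + 2 * g x * T g x + (g x)\<^sup>2))"
    by (intro sum_mono mult_left_mono) (auto intro!: less_imp_le pi_pos)
  moreover have "(\<Sum>x\<le>n. \<pi> x * T ?g2 x) = ip g g"
    using avg_T[of ?g2] by (simp add: avg_def ip_def power2_eq_square mult_ac)
  moreover have "(\<Sum>x\<le>n. \<pi> x * (T ?g2 x + 2 * g x * T g x + (g x)\<^sup>2)) =
      (\<Sum>x\<le>n. \<pi> x * T ?g2 x) + 2 * ip g (T g) + ip g g"
    by (simp add: ip_def sum_distrib_left sum.distrib sum_subtractf power2_eq_square algebra_simps)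
  moreover have "(\<Sum>x\<le>n. \<pi> x * (4 * \<delta> * (g x)\<^sup>2)) = 4 * \<delta> * ip g g"
    by (simp add: ip_def sum_distrib_left power2_eq_square mult_ac)
  ultimately show ?thesis by simp
qed

lemma lazy_lower_bound_norm:
  assumes holding: "\<And>i. i \<le> n \<Longrightarrow> p i + q i \<le> 1 - \<delta>" and "0 \<le> \<delta>"
  shows "4 * \<delta>\<^sup>2 * ip g g \<le> ip (\<lambda>x. g x + T g x) (\<lambda>x. g x + T g x)"
proof (cases "ip g g = 0")
  case True
  then show ?thesis by (simp add: ip_self_nonneg)
next
  case False
  then have pos: "0 < ip g g" using ip_self_nonneg[of g] by simp
  have "(2 * \<delta> * ip g g)\<^sup>2 \<le> (ip g (\<lambda>x. g x + T g x))\<^sup>2"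
    using lazy_lower_bound[OF holding, of g] pos assms by (intro power_mono) (auto simp: ip_add_right)
  also have "\<dots> \<le> ip g g * ip (\<lambda>x. g x + T g x) (\<lambda>x. g x + T g x)" by (rule ip_cauchy)
  finally have "ip g g * (4 * \<delta>\<^sup>2 * ip g g) \<le> ip g g * ip (\<lambda>x. g x + T g x) (\<lambda>x. g x + T g x)"
    by (simp add: power2_eq_square mult_ac)
  then show ?thesis using pos by simp
qed

lemma ip_cauchy_abs: "(\<Sum>x\<le>n. \<pi> x * \<bar>f x * g x\<bar>) \<le> sqrt (ip f f) * sqrt (ip g g)"
proof -
  have "(ip (\<lambda>x. \<bar>f x\<bar>) (\<lambda>x. \<bar>g x\<bar>))\<^sup>2 \<le> ip f f * ip g g"
    using ip_cauchy[of "\<lambda>x. \<bar>f x\<bar>" "\<lambda>x. \<bar>g x\<bar>"] by (simp add: ip_def mult.assoc)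
  then have "ip (\<lambda>x. \<bar>f x\<bar>) (\<lambda>x. \<bar>g x\<bar>) \<le> sqrt (ip f f * ip g g)"
    by (rule real_le_rsqrt)
  then show ?thesis by (simp add: ip_def abs_mult mult.assoc real_sqrt_mult)
qed

text \<open>
  Maximal functions over all times \<open>k \<ge> 2 s\<close> are controlled by a telescoping sum: with \<open>g k = (T ^^ k) f\<close>,
  the increments of \<open>(g k u)\<^sup>2\<close> are products \<open>(g k - g (k + 1)) (g k + g (k + 1))\<close>, to be summed in \<open>L\<^sup>1(\<pi>)\<close>.  The norm
  of \<open>g k - g (k + 1)\<close> is of order \<open>1 / s\<close> relative to \<open>g (k - 2 s)\<close>, because \<open>E k = \<parallel>g k\<parallel>\<^sup>2\<close> is completely monotone up
  to second order, and \<open>\<Sum>k. E k\<close> is bounded by the relaxation time.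
\<close>
lemma maximal_inequality:
  assumes holding: "\<And>i. i \<le> n \<Longrightarrow> p i + q i \<le> 1 - \<delta>" and d: "0 < \<delta>"
    and f: "\<And>y. y \<le> n \<Longrightarrow> \<bar>f y\<bar> \<le> 1" "avg f = 0" and M: "M \<le> n" and s: "0 < s"
  obtains B where "\<And>u k. 2 * s \<le> k \<Longrightarrow> k \<le> m \<Longrightarrow> \<bar>(T ^^ k) f u\<bar> \<le> B u"
    and "avg B \<le> sqrt (\<alpha> M / (\<delta>\<^sup>2 * s))"
proof -
  define g where "g = (\<lambda>k. (T ^^ k) f)"
  define E where "E = (\<lambda>k. ip (g k) (g k))"
  have g_Suc: "g (Suc k) = T (g k)" for k by (simp add: g_def)
  have avg_g: "avg (g k) = 0" for k by (simp add: g_def f)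
  have E_nn: "0 \<le> E k" for k by (simp add: E_def ip_self_nonneg)
  have al: "0 < \<alpha> M" using alpha_ge_1[OF M] by linarith
  have d1: "\<delta> \<le> 1" using holding[of 0] p_nonneg[of 0] q_nonneg[of 0] by simp
  have "E 0 \<le> (\<Sum>x\<le>n. \<pi> x * 1)"
    unfolding E_def ip_def g_def
  proof (intro sum_mono)
    fix x assume "x \<in> {..n}"
    then have "f x * f x \<le> 1" using f(1)[of x] abs_square_le_1[of "f x"] by (simp add: power2_eq_square)
    then show "\<pi> x * (T ^^ 0) f x * (T ^^ 0) f x \<le> \<pi> x * 1"
      using \<open>x \<in> {..n}\<close> pi_pos[of x] by (simp add: mult.assoc)
  qed
  then have E0: "E 0 \<le> 1" by (simp add: pi_sum)
  have E_dec: "2 * \<delta> / \<alpha> M * E k \<le> E k - E (Suc k)" for k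
  proof -
    have "E k / \<alpha> M \<le> energy (g k)"
      using poincare[OF M avg_g, of k] al by (simp add: E_def divide_le_eq mult.commute)
    then have "2 * \<delta> * (E k / \<alpha> M) \<le> 2 * \<delta> * energy (g k)" using d by (intro mult_left_mono) auto
    then show ?thesis using lazy_contraction[OF holding, of "g k"] by (simp add: E_def g_Suc)
  qed
  then have E_le: "E (Suc k) \<le> E k" for k using E_nn[of k] d al
    by (smt (verit) divide_nonneg_pos mult_nonneg_nonneg)
  have E_anti: "j \<le> k \<Longrightarrow> E k \<le> E j" for j k
    by (rule lift_Suc_antimono_le[of E]) (use E_le in auto)
  have E_sum: "(\<Sum>k<N. E k) \<le> \<alpha> M / (2 * \<delta>)" for N
  proof -
    have "(2 * \<delta> / \<alpha> M) * (\<Sum>k<N. E k) \<le> (\<Sum>k<N. E k - E (Suc k))"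
      unfolding sum_distrib_left by (intro sum_mono E_dec)
    also have "\<dots> = E 0 - E N" by (rule sum_lessThan_telescope')
    also have "\<dots> \<le> 1" using E0 E_nn[of N] by linarith
    finally show ?thesis using d al by (simp add: field_simps)
  qed
  define D where "D = (\<lambda>k. (E k - E (Suc k)) - (E (Suc k) - E (Suc (Suc k))))"
  define w where "w = (\<lambda>k x. g k x - g (Suc (Suc k)) x)"
  (* D is the second difference of E, and equals the squared norm of (I - T^2) g k. *)
  have D_eq: "D k = ip (w k) (w k)" for k
  proof -
    have "ip (g k) (g (Suc (Suc k))) = E (Suc k)"
      by (simp add: g_Suc E_def self_adjoint)
    then show ?thesis
      by (simp add: w_def ip_diff_left ip_diff_right ip_commute[of "g (Suc (Suc k))" "g k"] D_def E_def)
  qed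
  have D_nn: "0 \<le> D k" for k by (simp add: D_eq ip_self_nonneg)
  have D_anti: "D (Suc k) \<le> D k" for k
  proof -
    have "w (Suc k) = T (w k)" by (auto simp: w_def g_Suc bdop_diff)
    then show ?thesis by (simp add: D_eq ip_contract)
  qed
  (* Apply the decrement bound to E and then to its decrements. *)
  have D_bound: "(real s)\<^sup>2 * D (j + 2 * s) \<le> E j" for j
  proof -
    let ?F = "\<lambda>i. E i - E (Suc i)"
    have F_anti: "?F (Suc i) \<le> ?F i" for i using D_nn[of i] by (simp add: D_def)
    have "real s * (?F (j + s + s) - ?F (Suc (j + s + s))) \<le> ?F (j + s)"
      by (rule antimono_increment_bound[of ?F]) (use E_le D_anti in \<open>auto simp: D_def\<close>)
    moreover have "real s * (E (j + s) - E (Suc (j + s))) \<le> E j"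
      by (rule antimono_increment_bound[of E]) (use E_nn F_anti in auto)
    ultimately have "real s * (real s * D (j + s + s)) \<le> E j"
      unfolding D_def by (smt (verit) mult_left_mono of_nat_0_le_iff)
    moreover have "j + s + s = j + 2 * s" by simp
    ultimately show ?thesis by (simp add: power2_eq_square mult.assoc)
  qed
  define y where "y = (\<lambda>k u. g k u - g (Suc k) u)"
  define z where "z = (\<lambda>k u. g k u + g (Suc k) u)"
  have y_bound: "sqrt (ip (y (j + 2 * s)) (y (j + 2 * s))) \<le> sqrt (E j) / (2 * \<delta> * s)" for j
  proof -
    let ?y = "y (j + 2 * s)"
    (* I - T^2 = (I + T) (I - T), and I + T is bounded below. *)
    have "w (j + 2 * s) = (\<lambda>x. ?y x + T ?y x)"
      by (auto simp: w_def y_def g_Suc bdop_diff)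
    then have "4 * \<delta>\<^sup>2 * ip ?y ?y \<le> D (j + 2 * s)"
      using lazy_lower_bound_norm[OF holding, of ?y] d by (simp add: D_eq)
    then have "(real s)\<^sup>2 * (4 * \<delta>\<^sup>2 * ip ?y ?y) \<le> E j"
      using D_bound[of j] by (smt (verit) mult_left_mono zero_le_power2)
    then have "(2 * \<delta> * s)\<^sup>2 * ip ?y ?y \<le> E j" by (simp add: power_mult_distrib mult_ac)
    then have "sqrt ((2 * \<delta> * s)\<^sup>2 * ip ?y ?y) \<le> sqrt (E j)" by simp
    then show ?thesis using d s by (simp add: real_sqrt_mult field_simps)
  qed
  have z_bound: "sqrt (ip (z k) (z k)) \<le> 2 * sqrt (E k)" for k
  proof -
    have "ip (z k) (z k) + ip (y k) (y k) = 2 * E k + 2 * E (Suc k)"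
      by (simp add: z_def y_def ip_add_left ip_add_right ip_diff_left ip_diff_right E_def)
    then have "ip (z k) (z k) \<le> 4 * E k" using ip_self_nonneg[of "y k"] E_le[of k] by linarith
    then have "sqrt (ip (z k) (z k)) \<le> sqrt (4 * E k)" by simp
    then show ?thesis by (simp add: real_sqrt_mult)
  qed
  have yz: "(\<Sum>u\<le>n. \<pi> u * \<bar>y (j + 2 * s) u * z (j + 2 * s) u\<bar>) \<le> E j / (\<delta> * s)" for j
  proof -
    have "(\<Sum>u\<le>n. \<pi> u * \<bar>y (j + 2 * s) u * z (j + 2 * s) u\<bar>) \<le>
        sqrt (E j) / (2 * \<delta> * s) * (2 * sqrt (E j))"
    proof (rule order.trans[OF ip_cauchy_abs], rule mult_mono)
      have "sqrt (E (j + 2 * s)) \<le> sqrt (E j)" using E_anti by simp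
      then show "sqrt (ip (z (j + 2 * s)) (z (j + 2 * s))) \<le> 2 * sqrt (E j)"
        using z_bound[of "j + 2 * s"] by linarith
    qed (use y_bound d E_nn in \<open>auto simp: ip_self_nonneg\<close>)
    also have "\<dots> = E j / (\<delta> * s)" using E_nn[of j] by (simp add: field_simps)
    finally show ?thesis .
  qed
  define B2 where "B2 = (\<lambda>u. (g (2 * s) u)\<^sup>2 + (\<Sum>j<m. \<bar>y (j + 2 * s) u * z (j + 2 * s) u\<bar>))"
  define B where "B = (\<lambda>u. sqrt (B2 u))"
  have B2_nn: "0 \<le> B2 u" for u by (auto simp: B2_def intro!: add_nonneg_nonneg sum_nonneg)
  have "\<bar>(T ^^ k) f u\<bar> \<le> B u" if "2 * s \<le> k" "k \<le> m" for u k
  proof -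
    define i where "i = k - 2 * s"
    have i: "k = i + 2 * s" using that by (simp add: i_def)
    have e1: "(g k u)\<^sup>2 = (g (2 * s) u)\<^sup>2 + (\<Sum>j<i. (g (Suc (j + 2 * s)) u)\<^sup>2 - (g (j + 2 * s) u)\<^sup>2)"
      using sum_lessThan_telescope[of "\<lambda>j. (g (j + 2 * s) u)\<^sup>2" i] i by simp
    have e2: "(\<Sum>j<i. (g (Suc (j + 2 * s)) u)\<^sup>2 - (g (j + 2 * s) u)\<^sup>2) \<le>
        (\<Sum>j<i. \<bar>y (j + 2 * s) u * z (j + 2 * s) u\<bar>)"
    proof (rule sum_mono)
      fix j
      have "(g (Suc (j + 2 * s)) u)\<^sup>2 - (g (j + 2 * s) u)\<^sup>2 = - (y (j + 2 * s) u * z (j + 2 * s) u)"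
        by (simp add: y_def z_def power2_eq_square algebra_simps)
      then show "(g (Suc (j + 2 * s)) u)\<^sup>2 - (g (j + 2 * s) u)\<^sup>2 \<le> \<bar>y (j + 2 * s) u * z (j + 2 * s) u\<bar>"
        by linarith
    qed
    have e3: "(\<Sum>j<i. \<bar>y (j + 2 * s) u * z (j + 2 * s) u\<bar>) \<le> (\<Sum>j<m. \<bar>y (j + 2 * s) u * z (j + 2 * s) u\<bar>)"
      using that i by (intro sum_mono2) auto
    have "(g k u)\<^sup>2 \<le> B2 u" unfolding B2_def using e1 e2 e3 by linarith
    then have "sqrt ((g k u)\<^sup>2) \<le> B u" unfolding B_def by (rule real_sqrt_le_mono)
    then show ?thesis by (simp add: g_def)
  qed
  moreover have "avg B \<le> sqrt (\<alpha> M / (\<delta>\<^sup>2 * s))"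
  proof -
    have "real s * E (2 * s) = (\<Sum>k<s. E (2 * s))" by simp
    also have "\<dots> \<le> (\<Sum>k<s. E k)" by (intro sum_mono E_anti) auto
    also have "\<dots> \<le> \<alpha> M / (2 * \<delta>)" by (rule E_sum)
    finally have "E (2 * s) \<le> \<alpha> M / (2 * \<delta>) / s" using s by (subst pos_le_divide_eq) (auto simp: mult.commute)
    then have 1: "E (2 * s) \<le> \<alpha> M / (2 * \<delta> * s)" by simp
    have "avg B2 = E (2 * s) + (\<Sum>j<m. \<Sum>u\<le>n. \<pi> u * \<bar>y (j + 2 * s) u * z (j + 2 * s) u\<bar>)"
      by (subst sum.swap) (simp add: avg_def B2_def E_def ip_def sum.distrib distrib_left sum_distrib_left power2_eq_square mult.assoc)
    also have "\<dots> \<le> \<alpha> M / (2 * \<delta> * s) + (\<Sum>j<m. E j / (\<delta> * s))"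
      by (intro add_mono sum_mono 1 yz)
    also have "(\<Sum>j<m. E j / (\<delta> * s)) \<le> (\<alpha> M / (2 * \<delta>)) / (\<delta> * s)"
      unfolding sum_divide_distrib[symmetric] using d by (intro divide_right_mono E_sum) auto
    also have "\<alpha> M / (2 * \<delta> * s) \<le> \<alpha> M / (2 * \<delta>\<^sup>2 * s)"
      using al d d1 s by (intro divide_left_mono mult_mono mult_pos_pos) (auto simp: power2_eq_square mult_le_cancel_left1)
    also have "\<alpha> M / (2 * \<delta>\<^sup>2 * s) + (\<alpha> M / (2 * \<delta>)) / (\<delta> * s) = \<alpha> M / (\<delta>\<^sup>2 * s)"
      by (simp add: power2_eq_square field_simps)
    finally have 2: "avg B2 \<le> \<alpha> M / (\<delta>\<^sup>2 * s)" by simp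
    have "(avg B)\<^sup>2 \<le> ip (\<lambda>_. 1) (\<lambda>_. 1) * ip B B" unfolding avg_ip by (rule ip_cauchy)
    also have "ip (\<lambda>_. 1) (\<lambda>_. 1) = 1" by (simp add: ip_def pi_sum)
    also have "ip B B = avg B2" using B2_nn by (simp add: ip_def avg_def B_def mult.assoc)
    finally show ?thesis using 2 by (intro real_le_rsqrt) simp
  qed
  ultimately show ?thesis using that by blast
qed

lemma mixing_bound:
  assumes holding: "\<And>i. i \<le> n \<Longrightarrow> p i + q i \<le> 1 - \<delta>" and d: "0 < \<delta>"
    and f: "\<And>y. y \<le> n \<Longrightarrow> \<bar>f y\<bar> \<le> 1" "avg f = 0" and M: "M \<le> n" and s: "0 < s"
    and eta: "0 < \<eta>" and x: "x \<le> n" and m: "\<theta> M + 1 + 4 * real s \<le> real m"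
  shows "\<bar>(T ^^ m) f x\<bar> \<le>
     sqrt (\<alpha> M / (\<delta>\<^sup>2 * s)) + (\<alpha> M)\<^sup>2 / (real s)\<^sup>2 + \<alpha> M / (\<eta> * sqrt \<eta>) / s + 2 * \<eta>"
proof -
  obtain B where B: "\<And>u k. 2 * s \<le> k \<Longrightarrow> k \<le> m \<Longrightarrow> \<bar>(T ^^ k) f u\<bar> \<le> B u"
    and avgB: "avg B \<le> sqrt (\<alpha> M / (\<delta>\<^sup>2 * s))"
    using maximal_inequality[OF holding d f M s, of m] by metis
  (* Of the m steps, m1 are for reaching M, s for going from M to u, and the last 2 s for
     the maximal inequality. *)
  define m1 where "m1 = m - 3 * s"
  have th: "0 \<le> \<theta> M" using theta_ge[OF M] by linarith
  have "3 * s \<le> m" using m th by linarith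
  then have m1: "m1 + s \<le> m" "m - (m1 + s) = 2 * s" "\<theta> M + s \<le> real m1"
    using m by (auto simp: m1_def of_nat_diff)
  define G where "G = \<alpha> M / (\<eta> * sqrt \<eta>) / s"
  define lo where "lo = {u. u \<le> n \<and> F u < \<eta>}"
  define hi where "hi = {u. u \<le> n \<and> (\<Sum>k=u..n. \<pi> k) < \<eta>}"
  have G_nn: "0 \<le> G" using alpha_ge_1[OF M] eta by (simp add: G_def)
  have key: "\<bar>(T ^^ m) f x\<bar> \<le> B u + (\<alpha> M)\<^sup>2 / (real s)\<^sup>2 + G + of_bool (u \<in> lo) + of_bool (u \<in> hi)"
    if u: "u \<le> n" for u
  proof -
    have "\<bar>(T ^^ m) f x\<bar> \<le> B u + survival p q u (m1 + s) x"
      using m1 by (intro first_passage_bound f(1) u x B) auto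
    also have "survival p q u (m1 + s) x \<le> survival p q M m1 x + survival p q u s M"
      by (rule survival_via[OF M x])
    also have "survival p q M m1 x \<le> (\<alpha> M)\<^sup>2 / (real s)\<^sup>2"
      using m1 s by (intro survival_M M x) auto
    also have "survival p q u s M \<le> G + of_bool (u \<in> lo) + of_bool (u \<in> hi)"
    proof (cases "u \<in> lo \<or> u \<in> hi")
      case True
      then show ?thesis using survival_bounds[OF M, of u s] G_nn by (auto simp: of_bool_def)
    next
      case False
      then show ?thesis using survival_good_state[OF M u eta _ _ s] u by (auto simp: lo_def hi_def G_def)
    qed
    finally show ?thesis by simp
  qed
  have "\<bar>(T ^^ m) f x\<bar> = (\<Sum>u\<le>n. \<pi> u * \<bar>(T ^^ m) f x\<bar>)"
    by (simp add: sum_distrib_right[symmetric] pi_sum)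
  also have "\<dots> \<le> (\<Sum>u\<le>n. \<pi> u * (B u + ((\<alpha> M)\<^sup>2 / (real s)\<^sup>2 + G) + of_bool (u \<in> lo) + of_bool (u \<in> hi)))"
    using key by (intro sum_mono mult_left_mono) (auto intro!: less_imp_le pi_pos simp: add.assoc)
  also have "\<dots> = avg B + ((\<alpha> M)\<^sup>2 / (real s)\<^sup>2 + G) + (\<Sum>u\<le>n. \<pi> u * of_bool (u \<in> lo)) + (\<Sum>u\<le>n. \<pi> u * of_bool (u \<in> hi))"
    by (simp only: distrib_left sum.distrib avg_def sum_distrib_right[symmetric] pi_sum mult_1)
  also have "(\<Sum>u\<le>n. \<pi> u * of_bool (u \<in> lo)) = sum \<pi> lo"
    by (intro sum.mono_neutral_cong_right) (auto simp: lo_def)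
  also have "\<dots> \<le> \<eta>" unfolding lo_def by (rule mass_low[OF eta])
  also have "(\<Sum>u\<le>n. \<pi> u * of_bool (u \<in> hi)) = sum \<pi> hi"
    by (intro sum.mono_neutral_cong_right) (auto simp: hi_def)
  also have "\<dots> \<le> \<eta>" unfolding hi_def by (rule mass_high[OF eta])
  finally show ?thesis using avgB by (simp add: G_def)
qed

end

text \<open>
  The threshold \<open>A\<close> depends on \<open>\<epsilon>\<close> and \<open>\<delta>\<close> only, which is what makes the bound usable along a family.
\<close>
lemma mixing_upper:
  fixes \<epsilon> \<delta> :: real
  assumes "0 < \<epsilon>" "0 < \<delta>"
  obtains A where "0 < A"
    and "\<And>n p q \<pi> M f x m. bd_rates n p q \<pi> \<Longrightarrow> (\<And>i. i \<le> n \<Longrightarrow> p i + q i \<le> 1 - \<delta>) \<Longrightarrow> M \<le> n \<Longrightarrow>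
      (\<And>y. y \<le> n \<Longrightarrow> \<bar>f y\<bar> \<le> 1) \<Longrightarrow> (\<Sum>y\<le>n. \<pi> y * f y) = 0 \<Longrightarrow> x \<le> n \<Longrightarrow>
      bd_theta n p q \<pi> M + A * bd_alpha n p q \<pi> M \<le> real m \<Longrightarrow> \<bar>(bdop p q ^^ m) f x\<bar> \<le> \<epsilon>"
proof -
  (* Each of the four error terms of the single chain bound is to be at most \<epsilon> / 4. *)
  define \<eta> where "\<eta> = \<epsilon> / 8"
  define A where "A = max (max 1 (4 / \<epsilon>)) (max (16 / (\<delta>\<^sup>2 * \<epsilon>\<^sup>2)) (4 / (\<epsilon> * (\<eta> * sqrt \<eta>))))"
  have eta: "0 < \<eta>" using assms by (simp add: \<eta>_def)
  have A1: "1 \<le> A" "4 / \<epsilon> \<le> A" "16 / (\<delta>\<^sup>2 * \<epsilon>\<^sup>2) \<le> A" "4 / (\<epsilon> * (\<eta> * sqrt \<eta>)) \<le> A"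
    by (auto simp: A_def)
  (* With s = \<lceil>A \<alpha>\<rceil> the bound needs \<theta> + 1 + 4 s \<le> \<theta> + 4 A \<alpha> + 5 steps, and 1 \<le> \<alpha>. *)
  show ?thesis
  proof (rule that[of "4 * A + 5"])
    fix n p q \<pi> M f x m
    assume a: "bd_rates n p q \<pi>" "\<And>i. i \<le> n \<Longrightarrow> p i + q i \<le> 1 - \<delta>" "M \<le> n"
      "\<And>y. y \<le> n \<Longrightarrow> \<bar>f y\<bar> \<le> 1" "(\<Sum>y\<le>n. \<pi> y * f y) = 0" "x \<le> n"
      "bd_theta n p q \<pi> M + (4 * A + 5) * bd_alpha n p q \<pi> M \<le> real m"
    interpret bd_rates n p q \<pi> by fact
    define s where "s = nat \<lceil>A * \<alpha> M\<rceil>"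
    have al: "1 \<le> \<alpha> M" by (rule alpha_ge_1) fact
    have Aal: "1 \<le> A * \<alpha> M" using mult_mono[of 1 A 1 "\<alpha> M"] al A1 by simp
    have s: "A * \<alpha> M \<le> real s" "real s \<le> A * \<alpha> M + 1" "0 < s"
      using Aal by (auto simp: s_def)
    have spos: "0 < real s" using s by simp
    have "\<alpha> M / real s \<le> 1 / A"
      using s A1 al spos by (simp add: field_simps)
    define r where "r = \<alpha> M / real s"
    have r: "0 < r" "r \<le> 1 / A" using al spos \<open>\<alpha> M / real s \<le> 1 / A\<close> by (auto simp: r_def)
    have rb: "r \<le> k" if "1 / k \<le> A" "0 < k" for k
    proof -
      have "0 < A" using A1 by linarith
      then have "1 / A \<le> k" using that by (simp add: divide_le_eq mult.commute)
      then show ?thesis using r by linarith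
    qed
    have b1: "sqrt (\<alpha> M / (\<delta>\<^sup>2 * s)) \<le> \<epsilon> / 4"
    proof -
      have "r \<le> \<delta>\<^sup>2 * \<epsilon>\<^sup>2 / 16" using A1 assms by (intro rb) auto
      then have "r / \<delta>\<^sup>2 \<le> \<epsilon>\<^sup>2 / 16" using assms by (subst pos_divide_le_eq) (auto simp: mult_ac)
      moreover have "\<alpha> M / (\<delta>\<^sup>2 * s) = r / \<delta>\<^sup>2" by (simp add: r_def)
      ultimately have "\<alpha> M / (\<delta>\<^sup>2 * s) \<le> (\<epsilon> / 4)\<^sup>2" by (simp add: power_divide)
      then show ?thesis using assms by (intro real_le_lsqrt) auto
    qed
    have b2: "(\<alpha> M)\<^sup>2 / (real s)\<^sup>2 \<le> \<epsilon> / 4"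
    proof -
      have "r \<le> \<epsilon> / 4" using A1 assms by (intro rb) auto
      moreover have "r \<le> 1" using A1 by (intro rb) auto
      ultimately have "r * r \<le> \<epsilon> / 4 * 1" using r by (intro mult_mono) auto
      then show ?thesis by (simp add: r_def power2_eq_square)
    qed
    have b3: "\<alpha> M / (\<eta> * sqrt \<eta>) / s \<le> \<epsilon> / 4"
    proof -
      have "r \<le> \<epsilon> * (\<eta> * sqrt \<eta>) / 4" using A1 assms eta by (intro rb) auto
      then have "r / (\<eta> * sqrt \<eta>) \<le> \<epsilon> / 4" using eta by (simp add: divide_le_eq mult_ac)
      then show ?thesis by (simp add: r_def mult_ac)
    qed
    have m: "\<theta> M + 1 + 4 * real s \<le> real m"
      using s a(7) al by (simp add: algebra_simps)
    have "\<bar>(T ^^ m) f x\<bar> \<le> sqrt (\<alpha> M / (\<delta>\<^sup>2 * s)) + (\<alpha> M)\<^sup>2 / (real s)\<^sup>2 + \<alpha> M / (\<eta> * sqrt \<eta>) / s + 2 * \<eta>"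
      by (rule mixing_bound[of \<delta>]) (use a assms s eta m in \<open>auto simp: avg_def\<close>)
    then show "\<bar>(T ^^ m) f x\<bar> \<le> \<epsilon>" using b1 b2 b3 \<eta>_def by linarith
  qed (use A1 in simp)
qed

section \<open>The lower bound on mixing and the variance bound from mixing\<close>

text \<open>
  The ratio of consecutive terms of a log-convex sequence is nondecreasing.
\<close>
lemma log_convex_growth:
  fixes a :: "nat \<Rightarrow> real"
  assumes nn: "\<And>k. 0 \<le> a k" and lc: "\<And>k. (a (Suc k))\<^sup>2 \<le> a k * a (Suc (Suc k))"
    and r: "0 \<le> r" "r * a 0 \<le> a 1"
  shows "r ^ k * a 0 \<le> a k"
proof -
  have step: "r * a k \<le> a (Suc k)" for k
  proof (induction k)
    case 0
    then show ?case using r by simp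
  next
    case (Suc k)
    show ?case
    proof (cases "a k = 0")
      case True
      then have "a (Suc k) = 0" using lc[of k] by simp
      then show ?thesis using nn[of "Suc (Suc k)"] by simp
    next
      case False
      then have pos: "0 < a k" using nn[of k] by simp
      have "a k * (r * a (Suc k)) = (r * a k) * a (Suc k)" by simp
      also have "\<dots> \<le> a (Suc k) * a (Suc k)" using Suc nn by (intro mult_right_mono) auto
      also have "\<dots> \<le> a k * a (Suc (Suc k))" using lc[of k] by (simp add: power2_eq_square)
      finally show ?thesis using pos by simp
    qed
  qed
  show ?thesis
  proof (induction k)
    case (Suc k)
    have "r ^ Suc k * a 0 = r * (r ^ k * a 0)" by simp
    also have "\<dots> \<le> r * a k" using Suc r by (intro mult_left_mono) auto
    finally show ?case using step[of k] by linarith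
  qed simp
qed

context bd_rates begin

lemma survival_le_indicator:
  assumes "x \<le> u" "u \<le> n"
  shows "survival p q u m x \<le> (T ^^ m) (\<lambda>y. of_bool (y < u)) x"
  using assms(1)
proof (induction m arbitrary: x)
  case 0
  then show ?case by auto
next
  case (Suc m)
  show ?case
  proof (cases "x = u")
    case True
    have "(T ^^ Suc m) (\<lambda>_. 0) u \<le> (T ^^ Suc m) (\<lambda>y. of_bool (y < u)) u"
      by (rule funpow_mono) (use assms in auto)
    then have "0 \<le> (T ^^ Suc m) (\<lambda>y. of_bool (y < u)) u" by (simp only: bdop_funpow_const)
    then show ?thesis unfolding True by (simp only: survival_at)
  next
    case False
    then have "T (survival p q u m) x \<le> T ((T ^^ m) (\<lambda>y. of_bool (y < u))) x"
      using Suc.prems assms by (intro bdop_mono_nbr Suc.IH) auto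
    then show ?thesis using False by simp
  qed
qed

text \<open>
  Let \<open>u\<close> be the first state with \<open>F u \<ge> \<eta>\<close>.  The mean time from \<open>u\<close> to \<open>M\<close> is \<open>O(\<alpha>)\<close>, so hitting \<open>u\<close> from \<open>0\<close>
  still takes mean time \<open>\<theta> - O(\<alpha>)\<close>; before that the chain sits in \<open>{..<u}\<close>, a set of mass less than \<open>\<eta>\<close>.
\<close>
lemma mixing_lower_left:
  assumes M: "M \<le> n" and e: "0 < \<epsilon>" and eta: "0 < \<eta>" "\<eta> \<le> \<epsilon> / 2" "\<eta> \<le> F M"
    and th: "h 0 M = \<theta> M"
  shows "\<exists>u\<le>n. \<forall>m. real m \<le> \<theta> M - (1 / sqrt \<eta> + sqrt (2 / \<epsilon>)) * \<alpha> M \<longrightarrow>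
     1 - \<epsilon> \<le> (T ^^ m) (\<lambda>y. of_bool (y < u)) 0 - sum \<pi> {..<u}"
proof -
  define u where "u = (LEAST i. \<eta> \<le> F i)"
  have u: "\<eta> \<le> F u" "u \<le> M" using eta
    by (auto simp: u_def intro: LeastI[of "\<lambda>i. \<eta> \<le> F i" M] Least_le)
  have mass: "sum \<pi> {..<u} < \<eta>"
  proof (cases u)
    case (Suc v)
    then have "\<not> \<eta> \<le> F v" unfolding u_def by (metis lessI not_less_Least)
    then show ?thesis using Suc by (simp add: cum_def lessThan_Suc_atMost)
  qed (use eta in simp)
  have al: "1 \<le> \<alpha> M" by (rule alpha_ge_1[OF M])
  have "\<eta> * (h u M)\<^sup>2 \<le> F u * (h u M)\<^sup>2" using u by (intro mult_right_mono) auto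
  also have "\<dots> \<le> W 0 M" by (rule W_ge_tail[OF u(2) M])
  also have "\<dots> \<le> (\<alpha> M)\<^sup>2" by (rule W_le_alpha[OF M]) simp
  finally have "sqrt (\<eta> * (h u M)\<^sup>2) \<le> \<alpha> M" using al by (intro real_le_lsqrt) auto
  then have "sqrt \<eta> * h u M \<le> \<alpha> M" using h_nonneg[OF M, of u] by (simp add: real_sqrt_mult)
  then have hu: "h u M \<le> 1 / sqrt \<eta> * \<alpha> M" using eta by (simp add: field_simps)
  have split: "h 0 M = h 0 u + h u M"
    unfolding mean_hit_def using u(2) by (simp add: sum.atLeastLessThan_concat)
  have Wu: "W 0 u \<le> (\<alpha> M)\<^sup>2"
  proof -
    have "W 0 u \<le> W 0 M" unfolding hit_var_def using u M
      by (intro sum_mono2) (auto intro!: step_var_nonneg)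
    then show ?thesis using W_le_alpha[OF M, of 0] by simp
  qed
  have "1 - \<epsilon> \<le> (T ^^ m) (\<lambda>y. of_bool (y < u)) 0 - sum \<pi> {..<u}"
    if m: "real m \<le> \<theta> M - (1 / sqrt \<eta> + sqrt (2 / \<epsilon>)) * \<alpha> M" for m
  proof -
    have gap: "sqrt (2 / \<epsilon>) * \<alpha> M \<le> h 0 u - real m"
      using m hu split th by (simp add: algebra_simps)
    have gap0: "0 \<le> sqrt (2 / \<epsilon>) * \<alpha> M" using e al by simp
    have s1: "survival p q u m 0 \<le> 1" using survival_bounds[of 0 u m] by simp
    have "(1 - survival p q u m 0) * (2 / \<epsilon> * (\<alpha> M)\<^sup>2) = (1 - survival p q u m 0) * (sqrt (2 / \<epsilon>) * \<alpha> M)\<^sup>2"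
      using e by (simp add: power_mult_distrib)
    also have "\<dots> \<le> (1 - survival p q u m 0) * (h 0 u - real m)\<^sup>2"
      using gap gap0 s1 by (intro mult_left_mono power_mono) auto
    also have "\<dots> \<le> W 0 u + (h 0 u - h 0 u)\<^sup>2"
      using gap gap0 u M by (intro survival_chebyshev_lower) auto
    also have "\<dots> \<le> (\<alpha> M)\<^sup>2" using Wu by simp
    finally have "((1 - survival p q u m 0) * (2 / \<epsilon>)) * (\<alpha> M)\<^sup>2 \<le> 1 * (\<alpha> M)\<^sup>2"
      by (simp only: mult.assoc mult_1)
    then have "(1 - survival p q u m 0) * (2 / \<epsilon>) \<le> 1"
      using al by (subst (asm) mult_le_cancel_right_pos) auto
    then have "1 - survival p q u m 0 \<le> \<epsilon> / 2" using e by (simp add: field_simps)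
    moreover have "survival p q u m 0 \<le> (T ^^ m) (\<lambda>y. of_bool (y < u)) 0"
      using u M by (intro survival_le_indicator) auto
    ultimately show ?thesis using mass eta by linarith
  qed
  then show ?thesis using u M by (intro exI[of _ u]) auto
qed

text \<open>
  The witnesses \<open>x\<close> and \<open>S\<close> do not depend on \<open>m\<close>; this uniformity allows averaging over a random number of steps.
\<close>
lemma mixing_lower:
  assumes M: "M \<le> n" and e: "0 < \<epsilon>"
    and eta: "0 < \<eta>" "\<eta> \<le> \<epsilon> / 2" "\<eta> \<le> F M" "\<eta> \<le> (\<Sum>k=M..n. \<pi> k)"
  shows "\<exists>x\<le>n. \<exists>S\<subseteq>{..n}. \<forall>m. real m \<le> \<theta> M - (1 / sqrt \<eta> + sqrt (2 / \<epsilon>)) * \<alpha> M \<longrightarrow>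
     1 - \<epsilon> \<le> (T ^^ m) (\<lambda>y. of_bool (y \<in> S)) x - sum \<pi> S"
proof (cases "h 0 M = \<theta> M")
  case True
  obtain u where "u \<le> n" "\<And>m. real m \<le> \<theta> M - (1 / sqrt \<eta> + sqrt (2 / \<epsilon>)) * \<alpha> M \<Longrightarrow>
     1 - \<epsilon> \<le> (T ^^ m) (\<lambda>y. of_bool (y < u)) 0 - sum \<pi> {..<u}"
    using mixing_lower_left[OF M e eta(1-3) True] by blast
  then show ?thesis by (intro exI[of _ 0] conjI exI[of _ "{..<u}"]) auto
next
  case False
  interpret R: bd_rates n rp rq r\<pi> by (rule reflect)
  have th: "R.h 0 (n - M) = R.\<theta> (n - M)" using False reflect_theta[OF M] by (auto simp: bd_theta_def max_def split: if_splits)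
  obtain u where u: "u \<le> n" "\<And>m. real m \<le> R.\<theta> (n - M) - (1 / sqrt \<eta> + sqrt (2 / \<epsilon>)) * R.\<alpha> (n - M) \<Longrightarrow>
     1 - \<epsilon> \<le> (R.T ^^ m) (\<lambda>y. of_bool (y < u)) 0 - sum r\<pi> {..<u}"
    using R.mixing_lower_left[OF _ e eta(1,2) _ th] eta(4) reflect_F[OF M] by auto
  have 1: "(R.T ^^ m) (\<lambda>y. of_bool (y < u)) 0 = (T ^^ m) (\<lambda>y. of_bool (y \<in> {n-u<..n})) n" for m
    unfolding funpow_reflect[of 0, simplified] using u(1) by (intro funpow_cong) auto
  have 2: "sum r\<pi> {..<u} = sum \<pi> {n-u<..n}"
    using u(1) by (intro sum.reindex_bij_witness[of _ "\<lambda>k. n - k" "\<lambda>k. n - k"]) auto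
  have 3: "{n-u<..n} \<subseteq> {..n}" by auto
  show ?thesis
    by (intro exI[of _ n] conjI exI[of _ "{n-u<..n}"] allI impI)
       (use u(2) reflect_theta[OF M] reflect_alpha[OF M] in \<open>simp_all only: 1 2 3 order_refl\<close>)
qed

text \<open>
  The extremal function of the discrete Hardy inequality at \<open>l\<close>: constant on \<open>{..l}\<close>, zero from \<open>M\<close> on, and with
  constant flow \<open>c i * (f i - f (i + 1)) = 1\<close> in between.  As it vanishes on a set of mass at least \<open>c0\<close>, centring
  leaves at least the fraction \<open>c0\<close> of its squared norm.
\<close>
lemma test_function:
  assumes M: "M \<le> n" "l < M" and c0: "0 < c0" "c0 \<le> (\<Sum>k=M..n. \<pi> k)"
    and B: "B = F l * (\<Sum>i=l..<M. 1 / c i)"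
  shows "\<exists>f. avg f = 0 \<and> 0 < ip f f \<and> energy f \<le> ip f f / (c0 * B)"
proof -
  define R where "R = (\<Sum>i=l..<M. 1 / c i)"
  define f0 where "f0 = (\<lambda>x. \<Sum>i=max l x..<M. 1 / c i)"
  have cp: "0 < 1 / c i" if "i < M" for i using that M c_pos[of i] by simp
  have R: "0 < R" unfolding R_def using M cp by (intro sum_pos) auto
  have f0_diff: "f0 i - f0 (Suc i) = (if l \<le> i \<and> i < M then 1 / c i else 0)" for i
    by (auto simp: f0_def max_def sum.atLeast_Suc_lessThan not_le le_Suc_eq)
  have "energy f0 = (\<Sum>i<n. if l \<le> i \<and> i < M then 1 / c i else 0)"
    unfolding energy_def f0_diff using M cp by (intro sum.cong) (auto simp: power2_eq_square)
  also have "\<dots> = R" unfolding R_def using M by (intro sum.mono_neutral_cong_right) auto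
  finally have energy0: "energy f0 = R" .
  have f0_R: "f0 x = R" if "x \<le> l" for x using that by (simp add: f0_def R_def max_def)
  have f0_0: "f0 x = 0" if "M \<le> x" for x using that by (simp add: f0_def)
  have "F l * R\<^sup>2 = (\<Sum>x\<le>l. \<pi> x * f0 x * f0 x)"
    by (simp add: cum_def f0_R sum_distrib_right power2_eq_square mult.assoc)
  also have "\<dots> \<le> ip f0 f0"
    unfolding ip_def using M by (intro sum_mono2) (auto simp: mult.assoc intro!: mult_nonneg_nonneg[OF _ zero_le_square] order.strict_implies_order[OF pi_pos])
  finally have ip0: "F l * R\<^sup>2 \<le> ip f0 f0" .
  have "(avg f0)\<^sup>2 = (ip (\<lambda>x. of_bool (x < M)) f0)\<^sup>2"
    unfolding avg_def ip_def by (intro arg_cong[where f = "\<lambda>x. x\<^sup>2"] sum.cong) (auto simp: f0_0)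
  also have "\<dots> \<le> ip (\<lambda>x. of_bool (x < M)) (\<lambda>x. of_bool (x < M)) * ip f0 f0" by (rule ip_cauchy)
  also have "ip (\<lambda>x. of_bool (x < M)) (\<lambda>x. of_bool (x < M)) = sum \<pi> {..<M}"
    unfolding ip_def using M by (intro sum.mono_neutral_cong_right) auto
  also have "sum \<pi> {..<M} = 1 - sum \<pi> {M..n}"
  proof -
    have "{..n} = {..<M} \<union> {M..n}" using M by auto
    then show ?thesis using pi_sum by (simp add: sum.union_disjoint ivl_disj_int)
  qed
  also have "(1 - sum \<pi> {M..n}) * ip f0 f0 \<le> (1 - c0) * ip f0 f0"
    using c0 by (intro mult_right_mono ip_self_nonneg) auto
  finally have avg0: "(avg f0)\<^sup>2 \<le> (1 - c0) * ip f0 f0" .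
  define f where "f = (\<lambda>x. f0 x - avg f0)"
  have avgf: "avg f = 0" by (simp add: f_def avg_def right_diff_distrib sum_subtractf sum_distrib_right[symmetric] pi_sum)
  have ipf: "ip f f = ip f0 f0 - (avg f0)\<^sup>2"
  proof -
    have 1: "ip f0 (\<lambda>_. k) = k * avg f0" for k by (simp add: ip_def avg_def sum_distrib_left mult_ac)
    have 2: "ip (\<lambda>_. k) (\<lambda>_. k) = k * k" for k by (simp add: ip_def sum_distrib_right[symmetric] pi_sum)
    show ?thesis
      unfolding f_def ip_diff_left ip_diff_right
      by (simp add: ip_commute[of "\<lambda>_. avg f0" f0] 1 2 power2_eq_square)
  qed
  have energyf: "energy f = R" using energy0 by (simp add: energy_def f_def)
  have "c0 * (F l * R\<^sup>2) \<le> c0 * ip f0 f0" using ip0 c0 by simp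
  also have "\<dots> \<le> ip f f" using avg0 by (simp add: ipf algebra_simps)
  finally have low: "c0 * B * R \<le> ip f f" by (simp add: B R_def[symmetric] power2_eq_square mult_ac)
  have Bp: "0 < c0 * B" unfolding B R_def[symmetric] using c0 R F_pos[of l] M by simp
  have "0 < ip f f" using low Bp R by (smt (verit) mult_pos_pos)
  moreover have "energy f \<le> ip f f / (c0 * B)" using low Bp by (simp add: energyf pos_le_divide_eq mult.commute)
  ultimately show ?thesis using avgf by blast
qed

text \<open>
  Together with the test function this bounds the variance by the mean times the relaxation time.
\<close>
lemma W_le_bottleneck:
  assumes M: "M \<le> n" and B: "\<And>l. l < M \<Longrightarrow> F l * (\<Sum>i=l..<M. 1 / c i) \<le> b"
  shows "W 0 M \<le> 2 * b * h 0 M"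
proof -
  have "W 0 M = (\<Sum>i<M. step_var p \<pi> i)" by (simp add: hit_var_def atLeast0LessThan)
  also have "\<dots> \<le> (\<Sum>i<M. \<Sum>l\<le>i. 2 * a l * F l * (1 / c i))"
  proof (intro sum_mono)
    fix i assume "i \<in> {..<M}"
    then have i: "i < n" using M by auto
    have "(\<Sum>l\<le>i. 2 * a l * F l * (1 / c i)) = 2 * a i * F i / c i + (\<Sum>l<i. 2 * a l * F l * (1 / c i))"
      by (simp add: lessThan_Suc_atMost[symmetric])
    also have "(\<Sum>l<i. 2 * a l * F l * (1 / c i)) = 2 * a i * (\<Sum>l<i. a l * F l) / F i"
      using F_pos[of i] i by (simp add: a_eq[of i] sum_distrib_left sum_divide_distrib mult_ac)
    also have "2 * a i * F i / c i = 2 * (a i)\<^sup>2" by (simp add: a_eq[of i] power2_eq_square)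
    finally show "step_var p \<pi> i \<le> (\<Sum>l\<le>i. 2 * a l * F l * (1 / c i))"
      by (simp add: step_var_def)
  qed
  also have "\<dots> = (\<Sum>i<M. \<Sum>l<M. of_bool (l \<le> i) * (2 * a l * F l * (1 / c i)))"
    by (intro sum.cong refl sum.mono_neutral_cong_left) auto
  also have "\<dots> = (\<Sum>l<M. \<Sum>i<M. of_bool (l \<le> i) * (2 * a l * F l * (1 / c i)))" by (rule sum.swap)
  also have "\<dots> = (\<Sum>l<M. 2 * a l * (F l * (\<Sum>i=l..<M. 1 / c i)))"
    by (intro sum.cong refl, simp only: sum_distrib_left, intro sum.mono_neutral_cong_right) auto
  also have "\<dots> \<le> (\<Sum>l<M. 2 * a l * b)"
    using B M by (intro sum_mono mult_left_mono) (auto intro!: less_imp_le a_pos)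
  also have "\<dots> = 2 * b * h 0 M"
    by (simp add: mean_hit_def atLeast0LessThan sum_distrib_left mult_ac)
  finally show ?thesis .
qed

text \<open>
  Iterating \<open>P\<close>, the mean square norm of \<open>(P ^^ k) f\<close> decays at most like \<open>\<rho> ^ k\<close> and at least like the bound
  \<open>\<kappa> ^ k\<close> for the supremum norm; as \<open>k \<rightarrow> \<infinity>\<close> all constants disappear, in particular the ratio of the two norms of \<open>f\<close>,
  which is not bounded along a family.
\<close>
lemma contraction_ge_spectral:
  fixes P :: "(nat \<Rightarrow> real) \<Rightarrow> nat \<Rightarrow> real"
  assumes avgP: "\<And>f. avg f = 0 \<Longrightarrow> avg (P f) = 0"
    and sa: "\<And>f g. ip (P f) g = ip f (P g)"
    and con: "\<And>f b x. avg f = 0 \<Longrightarrow> (\<And>y. y \<le> n \<Longrightarrow> \<bar>f y\<bar> \<le> b) \<Longrightarrow> x \<le> n \<Longrightarrow> \<bar>P f x\<bar> \<le> \<kappa> * b"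
    and kappa: "0 < \<kappa>"
    and f: "avg f = 0" "0 < ip f f" "0 \<le> \<rho>" "\<rho>\<^sup>2 * ip f f \<le> ip (P f) (P f)"
  shows "\<rho> \<le> \<kappa>"
proof (rule ccontr)
  assume "\<not> \<rho> \<le> \<kappa>"
  then have less: "\<kappa> < \<rho>" by simp
  define b where "b = (\<Sum>y\<le>n. \<bar>f y\<bar>)"
  have b: "\<bar>f y\<bar> \<le> b" if "y \<le> n" for y unfolding b_def using that by (intro member_le_sum) auto
  define N where "N = (\<lambda>k. ip ((P ^^ k) f) ((P ^^ k) f))"
  have avg_k: "avg ((P ^^ k) f) = 0" for k by (induction k) (auto simp: f avgP)
  have sup_k: "\<bar>(P ^^ k) f x\<bar> \<le> \<kappa> ^ k * b" if "x \<le> n" for k x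
    using that
  proof (induction k arbitrary: x)
    case (Suc k)
    then show ?case using con[OF avg_k, of k "\<kappa> ^ k * b" x] by (simp add: mult.assoc)
  qed (use b in auto)
  have "(\<rho>\<^sup>2) ^ k * N 0 \<le> N k" for k
  proof (rule log_convex_growth)
    show "(N (Suc k))\<^sup>2 \<le> N k * N (Suc (Suc k))" for k
    proof -
      have "N (Suc k) = ip ((P ^^ k) f) ((P ^^ Suc (Suc k)) f)" by (simp add: N_def sa)
      then show ?thesis unfolding N_def by (simp only: ip_cauchy)
    qed
  qed (use f in \<open>auto simp: N_def ip_self_nonneg\<close>)
  moreover have "N k \<le> (\<kappa> ^ k * b)\<^sup>2" for k
  proof -
    have "N k \<le> (\<Sum>x\<le>n. \<pi> x * (\<kappa> ^ k * b)\<^sup>2)"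
      unfolding N_def ip_def
    proof (intro sum_mono)
      fix x assume x: "x \<in> {..n}"
      have "((P ^^ k) f x)\<^sup>2 \<le> (\<kappa> ^ k * b)\<^sup>2"
        using sup_k[of x k] x power_mono[of "\<bar>(P ^^ k) f x\<bar>" "\<kappa> ^ k * b" 2] by simp
      then show "\<pi> x * (P ^^ k) f x * (P ^^ k) f x \<le> \<pi> x * (\<kappa> ^ k * b)\<^sup>2"
        using x pi_pos[of x] by (simp add: mult.assoc power2_eq_square)
    qed
    then show ?thesis by (simp add: sum_distrib_right[symmetric] pi_sum)
  qed
  ultimately have "(\<rho>\<^sup>2) ^ k * N 0 \<le> (\<kappa> ^ k * b)\<^sup>2" for k by (meson order.trans)
  then have main: "N 0 \<le> ((\<kappa> / \<rho>)\<^sup>2) ^ k * b\<^sup>2" for k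
    using less kappa by (simp add: power_divide power_mult_distrib field_simps power2_eq_square power_mult[symmetric])
  have "(\<kappa> / \<rho>)\<^sup>2 < 1" using less kappa by (simp add: power_less_one_iff abs_square_less_1)
  then have "(\<lambda>k. ((\<kappa> / \<rho>)\<^sup>2) ^ k * b\<^sup>2) \<longlonglongrightarrow> 0 * b\<^sup>2"
    by (intro tendsto_mult LIMSEQ_realpow_zero tendsto_const) auto
  then have "N 0 \<le> 0 * b\<^sup>2" by (rule LIMSEQ_le_const) (use main in auto)
  then show False using f by (simp add: N_def)
qed

text \<open>
  The hypothesis \<open>con\<close> is what small total variation distance at time \<open>m\<close> provides, with \<open>\<kappa> = 2 \<epsilon>\<close>.
\<close>
lemma bottleneck_bound_disc:
  assumes M: "M \<le> n" "l < M" and c0: "0 < c0" "c0 \<le> (\<Sum>k=M..n. \<pi> k)"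
    and con: "\<And>f b x. avg f = 0 \<Longrightarrow> (\<And>y. y \<le> n \<Longrightarrow> \<bar>f y\<bar> \<le> b) \<Longrightarrow> x \<le> n \<Longrightarrow> \<bar>(T ^^ m) f x\<bar> \<le> \<kappa> * b"
    and k: "0 < \<kappa>" "\<kappa> < 1"
  shows "F l * (\<Sum>i=l..<M. 1 / c i) \<le> 2 / c0 + 2 * real m / (c0 * ln (1 / \<kappa>))"
proof -
  define B where "B = F l * (\<Sum>i=l..<M. 1 / c i)"
  have L: "0 < ln (1 / \<kappa>)" using k by simp
  show ?thesis
  proof (cases "B \<le> 2 / c0")
    case True
    have "0 \<le> 2 * real m / (c0 * ln (1 / \<kappa>))" using c0 L by simp
    then show ?thesis using True by (simp add: B_def)
  next
    case False
    obtain f where f: "avg f = 0" "0 < ip f f" "energy f \<le> ip f f / (c0 * B)"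
      using test_function[OF M c0 B_def] by blast
    define \<rho> where "\<rho> = 1 - 1 / (c0 * B)"
    have cB: "2 < c0 * B" using False c0 by (simp add: field_simps)
    have rho: "0 \<le> \<rho>" using cB by (simp add: \<rho>_def)
    have "\<rho> * ip f f \<le> ip f (T f)" using f by (simp add: \<rho>_def energy_alt algebra_simps)
    then have "(\<rho> * ip f f)\<^sup>2 \<le> (ip f (T f))\<^sup>2" using rho f by (intro power_mono) auto
    also have "\<dots> \<le> ip f f * ip (T f) (T f)" by (rule ip_cauchy)
    finally have "ip f f * (\<rho>\<^sup>2 * ip f f) \<le> ip f f * ip (T f) (T f)" by (simp add: power2_eq_square mult_ac)
    then have one: "\<rho>\<^sup>2 * ip f f \<le> ip (T f) (T f)" using f by simp
    define N where "N = (\<lambda>k. ip ((T ^^ k) f) ((T ^^ k) f))"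
    have "(\<rho>\<^sup>2) ^ m * N 0 \<le> N m"
    proof (rule log_convex_growth)
      show "(N (Suc k))\<^sup>2 \<le> N k * N (Suc (Suc k))" for k
      proof -
        have "N (Suc k) = ip ((T ^^ k) f) ((T ^^ Suc (Suc k)) f)" by (simp add: N_def self_adjoint)
        then show ?thesis unfolding N_def by (simp only: ip_cauchy)
      qed
    qed (use one in \<open>auto simp: N_def ip_self_nonneg\<close>)
    then have pw: "(\<rho> ^ m)\<^sup>2 * ip f f \<le> ip ((T ^^ m) f) ((T ^^ m) f)"
      by (simp add: N_def power_mult[symmetric] mult.commute)
    have "\<rho> ^ m \<le> \<kappa>"
      by (rule contraction_ge_spectral[where P = "T ^^ m" and f = f])
         (use f k rho pw con in \<open>auto simp: self_adjoint_funpow\<close>)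
    moreover have "0 < \<rho>" using cB by (simp add: \<rho>_def)
    ultimately have "ln (\<rho> ^ m) \<le> ln \<kappa>" by (intro ln_mono) auto
    then have 1: "real m * ln \<rho> \<le> - ln (1 / \<kappa>)" using cB k by (simp add: \<rho>_def ln_realpow ln_div)
    have "- (2 / (c0 * B)) \<le> ln \<rho>"
    proof -
      define y where "y = 1 / (c0 * B)"
      have y: "0 \<le> y" "y \<le> 1 / 2" using cB by (auto simp: y_def field_simps)
      have "- y - 2 * y\<^sup>2 \<le> ln (1 - y)" by (rule ln_one_minus_pos_lower_bound) (use y in auto)
      moreover have "2 * y\<^sup>2 \<le> y" using y mult_right_mono[of "2 * y" 1 y] by (simp add: power2_eq_square)
      ultimately show ?thesis by (simp add: \<rho>_def y_def)
    qed
    then have "real m * (- (2 / (c0 * B))) \<le> real m * ln \<rho>" by (intro mult_left_mono) auto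
    then have "ln (1 / \<kappa>) \<le> 2 * real m / (c0 * B)" using 1 by (simp add: mult.commute)
    then have "B \<le> 2 * real m / (c0 * ln (1 / \<kappa>))" using cB c0 L by (simp add: field_simps)
    then show ?thesis using c0 unfolding B_def[symmetric] by (smt (verit) divide_nonneg_pos)
  qed
qed

lemma variance_bound_disc:
  assumes M: "M \<le> n" and c0: "0 < c0" "c0 \<le> F M" "c0 \<le> (\<Sum>k=M..n. \<pi> k)"
    and con: "\<And>f b x. avg f = 0 \<Longrightarrow> (\<And>y. y \<le> n \<Longrightarrow> \<bar>f y\<bar> \<le> b) \<Longrightarrow> x \<le> n \<Longrightarrow> \<bar>(T ^^ m) f x\<bar> \<le> \<kappa> * b"
    and k: "0 < \<kappa>" "\<kappa> < 1"
  shows "(\<alpha> M)\<^sup>2 \<le> 2 * (2 / c0 + 2 * real m / (c0 * ln (1 / \<kappa>))) * \<theta> M"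
proof -
  interpret R: bd_rates n rp rq r\<pi> by (rule reflect)
  define b where "b = 2 / c0 + 2 * real m / (c0 * ln (1 / \<kappa>))"
  have b: "0 \<le> b" using c0 k by (auto simp: b_def intro!: add_nonneg_nonneg divide_nonneg_nonneg mult_nonneg_nonneg)
  have "W 0 M \<le> 2 * b * h 0 M"
    unfolding b_def using M c0 con k by (intro W_le_bottleneck bottleneck_bound_disc) auto
  moreover have "R.W 0 (n - M) \<le> 2 * b * R.h 0 (n - M)"
    unfolding b_def
  proof (intro R.W_le_bottleneck R.bottleneck_bound_disc)
    have "(\<Sum>k=n-M..n. r\<pi> k) = F M"
      unfolding cum_def using M by (intro sum.reindex_bij_witness[of _ "\<lambda>k. n - k" "\<lambda>k. n - k"]) auto
    then show "c0 \<le> (\<Sum>k=n-M..n. r\<pi> k)" using c0 by simp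
    fix f b x assume f: "R.avg f = 0" "\<And>y. y \<le> n \<Longrightarrow> \<bar>f y\<bar> \<le> b" "x \<le> n"
    have "avg (\<lambda>y. f (n - y)) = 0"
      using f(1) sum_reflect[of "\<lambda>x. \<pi> x * f (n - x)"] by (simp add: avg_def R.avg_def)
    then have "\<bar>(T ^^ m) (\<lambda>y. f (n - y)) (n - x)\<bar> \<le> \<kappa> * b" by (intro con) (auto simp: f)
    then show "\<bar>(R.T ^^ m) f x\<bar> \<le> \<kappa> * b" using f by (simp add: funpow_reflect)
  qed (use c0 k in auto)
  moreover have "2 * b * h 0 M \<le> 2 * b * \<theta> M" "2 * b * R.h 0 (n - M) \<le> 2 * b * \<theta> M"
    using b by (auto intro!: mult_left_mono simp: bd_theta_def)
  ultimately have "max (W 0 M) (R.W 0 (n - M)) \<le> 2 * b * \<theta> M" by linarith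
  then show ?thesis using W_nonneg[OF M, of 0] by (simp add: bd_alpha_def b_def)
qed

end

section \<open>Poisson mixtures of powers\<close>

definition pois :: "real \<Rightarrow> nat \<Rightarrow> real" where
  "pois r k = exp (- r) * r ^ k / fact k"

text \<open>
  The operator \<open>exp (- r * (I - T))\<close>.
\<close>
definition poisson_mix :: "(nat \<Rightarrow> real) \<Rightarrow> (nat \<Rightarrow> real) \<Rightarrow> real \<Rightarrow> (nat \<Rightarrow> real) \<Rightarrow> nat \<Rightarrow> real" where
  "poisson_mix p q r f x = (\<Sum>k. pois r k * (bdop p q ^^ k) f x)"

lemma pois_nonneg: "0 \<le> r \<Longrightarrow> 0 \<le> pois r k" by (simp add: pois_def)

lemma pois_generating: "(\<lambda>k. pois r k * z ^ k) sums exp (- (r * (1 - z)))"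
proof -
  have "(\<lambda>k. exp (- r) * ((r * z) ^ k /\<^sub>R fact k)) sums (exp (- r) * exp (r * z))"
    by (intro sums_mult exp_converges)
  moreover have "exp (- r) * exp (r * z) = exp (- (r * (1 - z)))"
    by (simp add: exp_add[symmetric] algebra_simps)
  ultimately show ?thesis
    by (simp add: pois_def power_mult_distrib divide_inverse mult_ac)
qed

lemma pois_sums_1: "pois r sums 1"
  using pois_generating[of r 1] by simp

lemma pois_Suc: "real (Suc k) * pois r (Suc k) = r * pois r k"
proof -
  have "fact (Suc k) = real (Suc k) * fact k" by simp
  then show ?thesis unfolding pois_def by (simp add: field_simps del: fact_Suc of_nat_Suc)
qed

lemma pois_variance: "(\<lambda>k. pois r k * (real k - r)\<^sup>2) sums r"
proof -
  have m1: "(\<lambda>k. real k * pois r k) sums r"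
  proof (rule sums_Suc_imp)
    show "(\<lambda>k. real (Suc k) * pois r (Suc k)) sums r"
      using sums_mult[OF pois_sums_1, of r r] by (simp only: pois_Suc) simp
  qed simp
  have m2: "(\<lambda>k. (real k)\<^sup>2 * pois r k) sums (r * r + r)"
  proof (rule sums_Suc_imp)
    have "(\<lambda>k. r * (real k * pois r k) + r * pois r k) sums (r * r + r * 1)"
      by (intro sums_add sums_mult m1 pois_sums_1)
    moreover have "(real (Suc k))\<^sup>2 * pois r (Suc k) = r * (real k * pois r k) + r * pois r k" for k
    proof -
      have "(real (Suc k))\<^sup>2 * pois r (Suc k) = real (Suc k) * (real (Suc k) * pois r (Suc k))"
        by (simp add: power2_eq_square)
      also have "\<dots> = real (Suc k) * (r * pois r k)" by (simp only: pois_Suc)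
      finally show ?thesis by (simp add: algebra_simps)
    qed
    ultimately show "(\<lambda>k. (real (Suc k))\<^sup>2 * pois r (Suc k)) sums (r * r + r)" by simp
  qed simp
  have "(\<lambda>k. (real k)\<^sup>2 * pois r k + (- 2 * r) * (real k * pois r k) + r\<^sup>2 * pois r k) sums
      (r * r + r + (- 2 * r) * r + r\<^sup>2 * 1)"
    by (intro sums_add sums_mult m1 m2 pois_sums_1)
  moreover have "r * r + r + (- 2 * r) * r + r\<^sup>2 * 1 = r" by (simp add: power2_eq_square)
  moreover have "(\<lambda>k. (real k)\<^sup>2 * pois r k + (- 2 * r) * (real k * pois r k) + r\<^sup>2 * pois r k) =
      (\<lambda>k. pois r k * (real k - r)\<^sup>2)" by (auto simp: power2_eq_square algebra_simps)
  ultimately show ?thesis by simp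
qed

lemma pois_summable_bounded:
  assumes "0 \<le> r" "\<And>k. \<bar>g k\<bar> \<le> b"
  shows "summable (\<lambda>k. pois r k * g k)"
proof (rule summable_comparison_test)
  show "\<exists>N. \<forall>k\<ge>N. norm (pois r k * g k) \<le> pois r k * b"
    using assms pois_nonneg[of r] by (auto simp: abs_mult intro!: mult_left_mono)
  show "summable (\<lambda>k. pois r k * b)"
    using pois_sums_1[of r] by (intro summable_mult2) (simp add: sums_iff)
qed

text \<open>
  Chebyshev's inequality for a Poisson variable of mean \<open>r\<close>, in the form needed for averages of sequences that are
  small from \<open>K\<close> on.
\<close>
lemma pois_tail_upper:
  assumes r: "0 \<le> r" and g: "\<And>k. \<bar>g k\<bar> \<le> 1" "\<And>k. K \<le> real k \<Longrightarrow> \<bar>g k\<bar> \<le> \<epsilon>" and e: "0 \<le> \<epsilon>" and K: "K < r"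
  shows "\<bar>\<Sum>k. pois r k * g k\<bar> \<le> \<epsilon> + r / (r - K)\<^sup>2"
proof -
  have s: "(\<lambda>k. \<epsilon> * pois r k + (1 / (r - K)\<^sup>2) * (pois r k * (real k - r)\<^sup>2)) sums (\<epsilon> * 1 + (1 / (r - K)\<^sup>2) * r)"
    by (intro sums_add sums_mult pois_sums_1 pois_variance)
  have le: "\<bar>pois r k * g k\<bar> \<le> \<epsilon> * pois r k + (1 / (r - K)\<^sup>2) * (pois r k * (real k - r)\<^sup>2)" for k
  proof -
    have "\<bar>g k\<bar> \<le> \<epsilon> + (real k - r)\<^sup>2 / (r - K)\<^sup>2"
    proof (cases "K \<le> real k")
      case True
      have "0 \<le> (real k - r)\<^sup>2 / (r - K)\<^sup>2" by simp
      then show ?thesis using g(2)[OF True] by linarith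
    next
      case False
      then have "(r - K)\<^sup>2 \<le> (r - real k)\<^sup>2" using K by (intro power_mono) auto
      then have "1 \<le> (real k - r)\<^sup>2 / (r - K)\<^sup>2" using K by (simp add: power2_commute)
      then show ?thesis using g(1)[of k] e by linarith
    qed
    then have "pois r k * \<bar>g k\<bar> \<le> pois r k * (\<epsilon> + (real k - r)\<^sup>2 / (r - K)\<^sup>2)"
      by (intro mult_left_mono pois_nonneg r)
    then show ?thesis using pois_nonneg[OF r, of k] by (simp add: abs_mult algebra_simps)
  qed
  have sm: "summable (\<lambda>k. \<bar>pois r k * g k\<bar>)"
    by (rule summable_comparison_test'[OF sums_summable[OF s]]) (use le in auto)
  have "\<bar>\<Sum>k. pois r k * g k\<bar> \<le> (\<Sum>k. \<bar>pois r k * g k\<bar>)" by (rule summable_rabs[OF sm])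
  also have "\<dots> \<le> \<epsilon> * 1 + (1 / (r - K)\<^sup>2) * r"
    using suminf_le[OF le sm sums_summable[OF s]] sums_unique[OF s] by simp
  finally show ?thesis by simp
qed

lemma pois_tail_lower:
  assumes r: "0 \<le> r" and g: "\<And>k. \<bar>g k\<bar> \<le> 1" "\<And>k. real k \<le> K \<Longrightarrow> 1 - \<epsilon> \<le> g k" and e: "0 \<le> \<epsilon>" and K: "r < K"
  shows "1 - \<epsilon> - 2 * r / (K - r)\<^sup>2 \<le> (\<Sum>k. pois r k * g k)"
proof -
  have s: "(\<lambda>k. (1 - \<epsilon>) * pois r k - (2 / (K - r)\<^sup>2) * (pois r k * (real k - r)\<^sup>2)) sums ((1 - \<epsilon>) * 1 - (2 / (K - r)\<^sup>2) * r)"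
    by (intro sums_diff sums_mult pois_sums_1 pois_variance)
  have le: "(1 - \<epsilon>) * pois r k - (2 / (K - r)\<^sup>2) * (pois r k * (real k - r)\<^sup>2) \<le> pois r k * g k" for k
  proof -
    have "1 - \<epsilon> - 2 * ((real k - r)\<^sup>2 / (K - r)\<^sup>2) \<le> g k"
    proof (cases "real k \<le> K")
      case True
      have "0 \<le> (real k - r)\<^sup>2 / (K - r)\<^sup>2" by simp
      then show ?thesis using g(2)[OF True] by linarith
    next
      case False
      then have "(K - r)\<^sup>2 \<le> (real k - r)\<^sup>2" using K by (intro power_mono) auto
      then have "1 \<le> (real k - r)\<^sup>2 / (K - r)\<^sup>2" using K by simp
      moreover have "- 1 \<le> g k" using g(1)[of k] by linarith
      ultimately show ?thesis using e by linarith
    qed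
    then have "pois r k * (1 - \<epsilon> - 2 * ((real k - r)\<^sup>2 / (K - r)\<^sup>2)) \<le> pois r k * g k"
      by (intro mult_left_mono pois_nonneg r)
    then show ?thesis by (simp add: algebra_simps)
  qed
  have "(1 - \<epsilon>) * 1 - (2 / (K - r)\<^sup>2) * r \<le> (\<Sum>k. pois r k * g k)"
    unfolding sums_unique[OF s]
    by (rule suminf_le[OF le sums_summable[OF s] pois_summable_bounded[OF r g(1)]])
  then show ?thesis by simp
qed

context bd_rates begin

abbreviation "mix \<equiv> poisson_mix p q"

lemma mix_summable:
  assumes "0 \<le> r" "x \<le> n"
  shows "summable (\<lambda>k. pois r k * (T ^^ k) f x)"
proof (rule pois_summable_bounded[OF assms(1)])
  show "\<bar>(T ^^ k) f x\<bar> \<le> (\<Sum>y\<le>n. \<bar>f y\<bar>)" for k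
    by (rule funpow_bound) (use assms in \<open>auto intro!: member_le_sum\<close>)
qed

lemma ip_mix_right:
  assumes "0 \<le> r"
  shows "(\<lambda>k. pois r k * ip g ((T ^^ k) f)) sums ip g (mix r f)"
proof -
  have "(\<lambda>k. \<Sum>x\<le>n. \<pi> x * g x * (pois r k * (T ^^ k) f x)) sums (\<Sum>x\<le>n. \<pi> x * g x * (mix r f x))"
    unfolding poisson_mix_def
    by (intro sums_sum sums_mult summable_sums mix_summable assms) auto
  then show ?thesis by (simp add: ip_def sum_distrib_left mult_ac)
qed

lemma mix_self_adjoint:
  assumes "0 \<le> r"
  shows "ip (mix r f) g = ip f (mix r g)"
proof -
  have "ip g ((T ^^ k) f) = ip f ((T ^^ k) g)" for k
    using self_adjoint_funpow[of k f g] ip_commute[of g "(T ^^ k) f"] by simp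
  then have "ip g (mix r f) = ip f (mix r g)"
    using ip_mix_right[OF assms, of g f] ip_mix_right[OF assms, of f g] sums_unique2 by fastforce
  then show ?thesis using ip_commute[of g "mix r f"] by simp
qed

lemma mix_avg: "0 \<le> r \<Longrightarrow> avg (mix r f) = avg f"
proof -
  assume r: "0 \<le> r"
  have "(\<lambda>k. pois r k * avg f) sums avg (mix r f)"
    using ip_mix_right[OF r, of "\<lambda>_. 1" f] by (simp add: avg_ip[symmetric])
  moreover have "(\<lambda>k. pois r k * avg f) sums (1 * avg f)" by (intro sums_mult2 pois_sums_1)
  ultimately show ?thesis using sums_unique2 by fastforce
qed

text \<open>
  Holding with probability at least \<open>1/2\<close> makes \<open>T\<close> positive semidefinite; odd powers are handled by splitting off
  one factor \<open>T\<close> in the middle.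
\<close>
lemma lazy_psd:
  assumes "\<And>i. i \<le> n \<Longrightarrow> p i + q i \<le> 1 / 2"
  shows "0 \<le> ip g ((T ^^ k) g)"
proof -
  define j where "j = k div 2"
  have "k = j + j \<or> k = Suc (j + j)" unfolding j_def by presburger
  then show ?thesis
  proof
    assume "k = j + j"
    then have "ip g ((T ^^ k) g) = ip ((T ^^ j) g) ((T ^^ j) g)"
      by (simp add: funpow_add self_adjoint_funpow)
    then show ?thesis by (simp add: ip_self_nonneg)
  next
    assume "k = Suc (j + j)"
    then have "k = j + Suc j" by simp
    then have "ip g ((T ^^ k) g) = ip ((T ^^ j) g) (T ((T ^^ j) g))"
      by (simp only: funpow_add o_apply self_adjoint_funpow) simp
    moreover have "ip ((T ^^ j) g) ((T ^^ j) g) \<le> ip ((T ^^ j) g) ((T ^^ j) g) + ip ((T ^^ j) g) (T ((T ^^ j) g))"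
      using lazy_lower_bound[of "1/2" "(T ^^ j) g"] assms by simp
    ultimately show ?thesis by simp
  qed
qed

lemma lazy_psd_cauchy:
  assumes "\<And>i. i \<le> n \<Longrightarrow> p i + q i \<le> 1 / 2"
  shows "(ip u ((T ^^ k) v))\<^sup>2 \<le> ip u ((T ^^ k) u) * ip v ((T ^^ k) v)"
proof -
  define A where "A = ip u ((T ^^ k) u)"
  define B where "B = ip u ((T ^^ k) v)"
  define C where "C = ip v ((T ^^ k) v)"
  have quad: "0 \<le> A + 2 * t * B + t\<^sup>2 * C" for t
  proof -
    let ?w = "\<lambda>x. u x + t * v x"
    have "(T ^^ k) ?w = (\<lambda>x. (T ^^ k) u x + t * (T ^^ k) v x)"
      by (auto simp: bdop_funpow_add bdop_funpow_cmult)
    moreover have "ip v ((T ^^ k) u) = B"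
      using self_adjoint_funpow[of k v u] ip_commute[of "(T ^^ k) v" u] by (simp add: B_def)
    ultimately have "ip ?w ((T ^^ k) ?w) = A + 2 * t * B + t\<^sup>2 * C"
      by (simp add: ip_add_left ip_add_right ip_cmult_left ip_cmult_right A_def B_def C_def power2_eq_square algebra_simps)
    then show ?thesis using lazy_psd[OF assms, of ?w k] by simp
  qed
  have C: "0 \<le> C" unfolding C_def by (rule lazy_psd[OF assms])
  have "B\<^sup>2 \<le> A * C"
  proof (cases "C = 0")
    case True
    have "B = 0"
    proof (rule ccontr)
      assume "B \<noteq> 0"
      then show False using quad[of "- (A + 1) / (2 * B)"] True by (simp add: field_simps)
    qed
    then show ?thesis using True by simp
  next
    case False
    then have C': "0 < C" using C by simp
    have "0 \<le> C * (A + 2 * (- B / C) * B + (- B / C)\<^sup>2 * C)"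
      using quad[of "- B / C"] C by (rule mult_nonneg_nonneg[rotated])
    also have "\<dots> = A * C - B\<^sup>2" using C' by (simp add: power2_eq_square divide_simps algebra_simps)
    finally show ?thesis by simp
  qed
  then show ?thesis by (simp add: A_def B_def C_def)
qed

text \<open>
  The moments \<open>ip f ((T ^^ j) f)\<close> of the half-lazy chain are log-convex in \<open>j\<close>, so they dominate a geometric sequence
  whose Poisson average is an exponential.
\<close>
lemma bottleneck_bound_mix:
  assumes M: "M \<le> n" "l < M" and c0: "0 < c0" "c0 \<le> (\<Sum>k=M..n. \<pi> k)"
    and holding: "\<And>i. i \<le> n \<Longrightarrow> p i + q i \<le> 1 / 2" and r: "0 \<le> r"
    and con: "\<And>f b x. avg f = 0 \<Longrightarrow> (\<And>y. y \<le> n \<Longrightarrow> \<bar>f y\<bar> \<le> b) \<Longrightarrow> x \<le> n \<Longrightarrow> \<bar>mix r f x\<bar> \<le> \<kappa> * b"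
    and k: "0 < \<kappa>" "\<kappa> < 1"
  shows "F l * (\<Sum>i=l..<M. 1 / c i) \<le> r / (c0 * ln (1 / \<kappa>))"
proof -
  define B where "B = F l * (\<Sum>i=l..<M. 1 / c i)"
  have "0 < (\<Sum>i=l..<M. 1 / c i)" using M by (intro sum_pos) (auto intro!: divide_pos_pos c_pos)
  then have cB: "0 < c0 * B" unfolding B_def using M c0 F_pos[of l] by simp
  have L: "0 < ln (1 / \<kappa>)" using k by simp
  obtain f where f: "avg f = 0" "0 < ip f f" "energy f \<le> ip f f / (c0 * B)"
    using test_function[OF M c0 B_def] by blast
  define s where "s = ip f (T f) / ip f f"
  have s0: "0 \<le> s" using lazy_psd[OF holding, of f 1] f by (simp add: s_def)
  have "1 - s = energy f / ip f f" using f by (simp add: s_def energy_alt diff_divide_distrib)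
  also have "\<dots> \<le> 1 / (c0 * B)" using f by (simp add: divide_le_eq)
  finally have s1: "1 - s \<le> 1 / (c0 * B)" .
  have grow: "s ^ j * ip f f \<le> ip f ((T ^^ j) f)" for j
  proof -
    define a where "a = (\<lambda>j. ip f ((T ^^ j) f))"
    have "s ^ j * a 0 \<le> a j"
    proof (rule log_convex_growth)
      show "0 \<le> a k" for k unfolding a_def by (rule lazy_psd[OF holding])
      show "(a (Suc k))\<^sup>2 \<le> a k * a (Suc (Suc k))" for k
        using lazy_psd_cauchy[OF holding, of f k "T f"]
        by (simp add: a_def self_adjoint funpow_swap1)
    qed (use s0 f in \<open>auto simp: a_def s_def\<close>)
    then show ?thesis by (simp add: a_def)
  qed
  define \<rho> where "\<rho> = exp (- (r * (1 - s)))"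
  have "(\<lambda>j. pois r j * s ^ j * ip f f) sums (\<rho> * ip f f)"
    unfolding \<rho>_def by (intro sums_mult2 pois_generating)
  moreover have "(\<lambda>k. pois r k * ip f ((T ^^ k) f)) sums ip f (mix r f)" by (rule ip_mix_right[OF r])
  ultimately have "\<rho> * ip f f \<le> ip f (mix r f)"
    by (rule sums_le[rotated]) (use grow r in \<open>auto simp: mult.assoc intro!: mult_left_mono pois_nonneg\<close>)
  then have "(\<rho> * ip f f)\<^sup>2 \<le> (ip f (mix r f))\<^sup>2" using f by (intro power_mono) (auto simp: \<rho>_def)
  also have "\<dots> \<le> ip f f * ip (mix r f) (mix r f)" by (rule ip_cauchy)
  finally have "ip f f * (\<rho>\<^sup>2 * ip f f) \<le> ip f f * ip (mix r f) (mix r f)" by (simp add: power2_eq_square mult_ac)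
  then have one: "\<rho>\<^sup>2 * ip f f \<le> ip (mix r f) (mix r f)" using f by simp
  have "\<rho> \<le> \<kappa>"
    by (rule contraction_ge_spectral[where P = "mix r" and f = f])
       (use f k one con r in \<open>auto simp: mix_self_adjoint mix_avg \<rho>_def\<close>)
  then have "ln \<rho> \<le> ln \<kappa>" by (intro ln_mono) (auto simp: \<rho>_def)
  then have "ln (1 / \<kappa>) \<le> r * (1 - s)" using k by (simp add: \<rho>_def ln_div)
  also have "\<dots> \<le> r * (1 / (c0 * B))" by (intro mult_left_mono s1 r)
  finally have "ln (1 / \<kappa>) * (c0 * B) \<le> r" using cB by (simp add: pos_le_divide_eq)
  then show ?thesis unfolding B_def[symmetric] using c0 L by (simp add: pos_le_divide_eq mult_ac)
qed

lemma poisson_mix_reflect: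
  assumes "x \<le> n"
  shows "poisson_mix rp rq r f x = mix r (\<lambda>y. f (n - y)) (n - x)"
  using assms by (simp add: poisson_mix_def funpow_reflect)

lemma variance_bound_mix:
  assumes M: "M \<le> n" and c0: "0 < c0" "c0 \<le> F M" "c0 \<le> (\<Sum>k=M..n. \<pi> k)"
    and holding: "\<And>i. i \<le> n \<Longrightarrow> p i + q i \<le> 1 / 2" and r: "0 \<le> r"
    and con: "\<And>f b x. avg f = 0 \<Longrightarrow> (\<And>y. y \<le> n \<Longrightarrow> \<bar>f y\<bar> \<le> b) \<Longrightarrow> x \<le> n \<Longrightarrow> \<bar>mix r f x\<bar> \<le> \<kappa> * b"
    and k: "0 < \<kappa>" "\<kappa> < 1"
  shows "(\<alpha> M)\<^sup>2 \<le> 2 * (r / (c0 * ln (1 / \<kappa>))) * \<theta> M"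
proof -
  interpret R: bd_rates n rp rq r\<pi> by (rule reflect)
  define b where "b = r / (c0 * ln (1 / \<kappa>))"
  have b: "0 \<le> b" using c0 k r by (auto simp: b_def)
  have "W 0 M \<le> 2 * b * h 0 M"
    unfolding b_def using M c0 con k holding r by (intro W_le_bottleneck bottleneck_bound_mix) auto
  moreover have "R.W 0 (n - M) \<le> 2 * b * R.h 0 (n - M)"
    unfolding b_def
  proof (intro R.W_le_bottleneck R.bottleneck_bound_mix)
    have "(\<Sum>k=n-M..n. r\<pi> k) = F M"
      unfolding cum_def using M by (intro sum.reindex_bij_witness[of _ "\<lambda>k. n - k" "\<lambda>k. n - k"]) auto
    then show "c0 \<le> (\<Sum>k=n-M..n. r\<pi> k)" using c0 by simp
    show "rp i + rq i \<le> 1 / 2" if "i \<le> n" for i using holding[of "n - i"] by simp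
    fix f b x assume f: "R.avg f = 0" "\<And>y. y \<le> n \<Longrightarrow> \<bar>f y\<bar> \<le> b" "x \<le> n"
    have "avg (\<lambda>y. f (n - y)) = 0"
      using f(1) sum_reflect[of "\<lambda>x. \<pi> x * f (n - x)"] by (simp add: avg_def R.avg_def)
    then have "\<bar>mix r (\<lambda>y. f (n - y)) (n - x)\<bar> \<le> \<kappa> * b" by (intro con) (auto simp: f)
    then show "\<bar>R.mix r f x\<bar> \<le> \<kappa> * b" using f by (simp add: poisson_mix_reflect)
  qed (use c0 k r in auto)
  moreover have "2 * b * h 0 M \<le> 2 * b * \<theta> M" "2 * b * R.h 0 (n - M) \<le> 2 * b * \<theta> M"
    using b by (auto intro!: mult_left_mono simp: bd_theta_def)
  ultimately have "max (W 0 M) (R.W 0 (n - M)) \<le> 2 * b * \<theta> M" by linarith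
  then show ?thesis using W_nonneg[OF M, of 0] by (simp add: bd_alpha_def b_def)
qed

end

section \<open>Transition matrices, semigroups and total variation distance\<close>

text \<open>
  The upward rate at \<open>n\<close> would be read outside the matrix, hence the explicit \<open>0\<close>; likewise for \<open>down_rate\<close> at \<open>0\<close>.
\<close>
definition up_rate :: "nat \<Rightarrow> real mat \<Rightarrow> nat \<Rightarrow> real" where
  "up_rate n K i = (if i < n then K $$ (i, i + 1) else 0)"

definition down_rate :: "real mat \<Rightarrow> nat \<Rightarrow> real" where
  "down_rate K i = (if i = 0 then 0 else K $$ (i, i - 1))"

definition bd_matrix :: "nat \<Rightarrow> real mat \<Rightarrow> (nat \<Rightarrow> real) \<Rightarrow> (nat \<Rightarrow> real) \<Rightarrow> bool" where
  "bd_matrix n K p q \<longleftrightarrow> K \<in> carrier_mat (n + 1) (n + 1) \<and> p n = 0 \<and> q 0 = 0 \<and>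
     (\<forall>x\<le>n. \<forall>y\<le>n. K $$ (x, y) =
        (if y = x + 1 then p x else if x = y + 1 then q x else if y = x then 1 - p x - q x else 0))"

lemma bd_matrix_row:
  assumes K: "bd_matrix n K p q" and x: "x \<le> n"
  shows "(\<Sum>y\<le>n. K $$ (x, y) * f y) = bdop p q f x"
proof -
  have "(\<Sum>y\<le>n. K $$ (x, y) * f y) =
      (\<Sum>y\<le>n. (if y = x + 1 then p x * f (x + 1) else 0) + (if 0 < x \<and> y = x - 1 then q x * f (x - 1) else 0)
             + (if y = x then (1 - p x - q x) * f x else 0))"
    using K x by (intro sum.cong) (auto simp: bd_matrix_def)
  also have "\<dots> = (if x + 1 \<le> n then p x * f (x + 1) else 0) + (if 0 < x then q x * f (x - 1) else 0)
             + (1 - p x - q x) * f x"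
    using x by (simp add: sum.distrib)
  also have "\<dots> = bdop p q f x"
    using K x by (cases "x = n"; cases "x = 0") (auto simp: bd_matrix_def bdop_def)
  finally show ?thesis .
qed

lemma mat_mult_entry:
  assumes "A \<in> carrier_mat (n + 1) (n + 1)" "B \<in> carrier_mat (n + 1) (n + 1)" "x \<le> n" "y \<le> n"
  shows "(A * B) $$ (x, y) = (\<Sum>z\<le>n. A $$ (x, z) * (B :: real mat) $$ (z, y))"
  using assms by (auto simp: scalar_prod_def atLeast0LessThan lessThan_Suc_atMost intro!: sum.cong)

lemma mat_pow_row:
  assumes A: "A \<in> carrier_mat (n + 1) (n + 1)"
    and row: "\<And>f x. x \<le> n \<Longrightarrow> (\<Sum>y\<le>n. (A :: real mat) $$ (x, y) * f y) = G f x"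
    and cong: "\<And>f g x. (\<And>y. y \<le> n \<Longrightarrow> f y = g y) \<Longrightarrow> x \<le> n \<Longrightarrow> G f x = G g x"
    and x: "x \<le> n"
  shows "(\<Sum>y\<le>n. (A ^\<^sub>m m) $$ (x, y) * f y) = (G ^^ m) f x"
  using x
proof (induction m arbitrary: f x)
  case 0
  have "(\<Sum>y\<le>n. (A ^\<^sub>m 0) $$ (x, y) * f y) = (\<Sum>y\<le>n. if y = x then f x else 0)"
    using 0 A by (intro sum.cong) auto
  then show ?case using 0 by simp
next
  case (Suc m)
  have "(\<Sum>y\<le>n. (A ^\<^sub>m Suc m) $$ (x, y) * f y) = (\<Sum>y\<le>n. \<Sum>z\<le>n. (A ^\<^sub>m m) $$ (x, z) * A $$ (z, y) * f y)"
    using Suc.prems A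
    by (intro sum.cong refl) (simp add: mat_mult_entry[of _ n] pow_carrier_mat sum_distrib_right del: index_mult_mat)
  also have "\<dots> = (\<Sum>z\<le>n. (A ^\<^sub>m m) $$ (x, z) * (\<Sum>y\<le>n. A $$ (z, y) * f y))"
    by (subst sum.swap) (simp add: sum_distrib_left mult.assoc)
  also have "\<dots> = (\<Sum>z\<le>n. (A ^\<^sub>m m) $$ (x, z) * G f z)"
    by (intro sum.cong refl) (simp add: row)
  also have "\<dots> = (G ^^ m) (G f) x" by (rule Suc.IH) fact
  finally show ?case by (simp add: funpow_swap1)
qed

lemma bdop_cong_le:
  assumes "p n = 0" "\<And>y. y \<le> n \<Longrightarrow> f y = g y" "x \<le> n"
  shows "bdop p q f x = bdop p q g x"
  using assms by (cases "x = n") (auto simp: bdop_def)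

lemma bd_matrix_pow:
  assumes "bd_matrix n K p q" "x \<le> n"
  shows "(\<Sum>y\<le>n. (K ^\<^sub>m m) $$ (x, y) * f y) = (bdop p q ^^ m) f x"
  using assms by (intro mat_pow_row bd_matrix_row bdop_cong_le) (auto simp: bd_matrix_def)

lemma bd_matrix_pow_set:
  assumes "bd_matrix n K p q" "x \<le> n" "S \<subseteq> {..n}"
  shows "(\<Sum>y\<in>S. (K ^\<^sub>m m) $$ (x, y)) = (bdop p q ^^ m) (\<lambda>y. of_bool (y \<in> S)) x"
proof -
  have "(\<Sum>y\<in>S. (K ^\<^sub>m m) $$ (x, y)) = (\<Sum>y\<le>n. (K ^\<^sub>m m) $$ (x, y) * of_bool (y \<in> S))"
    using assms(3) by (intro sum.mono_neutral_cong_left) auto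
  then show ?thesis using bd_matrix_pow[OF assms(1,2)] by simp
qed

lemma bd_matrix_pow_entry:
  assumes "bd_matrix n K p q" "x \<le> n" "y \<le> n"
  shows "(K ^\<^sub>m m) $$ (x, y) = (bdop p q ^^ m) (\<lambda>z. of_bool (z = y)) x"
  using bd_matrix_pow_set[of n K p q x "{y}" m] assms by simp

lemma birth_death_chain_matrix:
  assumes "birth_death_chain n K"
  shows "bd_matrix n K (up_rate n K) (down_rate K)"
    and "\<And>i. i \<le> n \<Longrightarrow> 0 \<le> up_rate n K i \<and> 0 \<le> down_rate K i \<and> up_rate n K i + down_rate K i \<le> 1"
proof -
  obtain p q r where pqr: "\<And>i. i \<le> n \<Longrightarrow> 0 \<le> p i \<and> 0 \<le> q i \<and> 0 \<le> r i \<and> p i + q i + r i = 1"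
    "p n = 0" "q 0 = 0" and car: "K \<in> carrier_mat (n + 1) (n + 1)"
    and K: "\<And>i j. i \<le> n \<Longrightarrow> j \<le> n \<Longrightarrow> K $$ (i, j) =
      (if j = i + 1 then p i else if i = j + 1 then q i else if j = i then r i else (0::real))"
    using assms unfolding birth_death_chain_def by blast
  have u: "up_rate n K i = p i" if "i \<le> n" for i
    using that K[of i "i + 1"] pqr(2) by (cases "i = n") (auto simp: up_rate_def)
  have d: "down_rate K i = q i" if "i \<le> n" for i
    using that K[of i "i - 1"] pqr(3) by (cases "i = 0") (auto simp: down_rate_def)
  have r: "r i = 1 - p i - q i" if "i \<le> n" for i using pqr(1)[OF that] by linarith
  show "bd_matrix n K (up_rate n K) (down_rate K)"
    unfolding bd_matrix_def using car pqr u d r K by auto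
  show "\<And>i. i \<le> n \<Longrightarrow> 0 \<le> up_rate n K i \<and> 0 \<le> down_rate K i \<and> up_rate n K i + down_rate K i \<le> 1"
    using u d pqr(1) by (metis add.commute add_increasing le_add_same_cancel2 order_refl)
qed

lemma bdop_funpow_zero_below:
  assumes "p i = 0" "\<And>x. x \<le> i \<Longrightarrow> f x = 0" "x \<le> i"
  shows "(bdop p q ^^ m) f x = 0"
  using assms(3)
proof (induction m arbitrary: x)
  case (Suc m)
  then show ?case using assms(1) by (cases "x = i") (auto simp: bdop_def)
qed (use assms in auto)

lemma bdop_funpow_zero_above:
  assumes "q i = 0" "\<And>x. i \<le> x \<Longrightarrow> f x = 0" "i \<le> x"
  shows "(bdop p q ^^ m) f x = 0"
  using assms(3)
proof (induction m arbitrary: x)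
  case (Suc m)
  then show ?case using assms(1) by (cases "x = i") (auto simp: bdop_def)
qed (use assms in auto)

text \<open>
  A vanishing rate would make \<open>{0..i}\<close> or \<open>{i..n}\<close> absorbing.  Detailed balance is stationarity tested against the
  indicator of \<open>{0..i}\<close>: only the flow across the edge \<open>{i, i+1}\<close> contributes.
\<close>
lemma irreducible_stationary_bd:
  assumes n: "1 \<le> n" and K: "birth_death_chain n K" and irr: "irreducible_chain n K"
    and stat: "stationary_distribution n K \<pi>"
  shows "bd_rates n (up_rate n K) (down_rate K) \<pi>"
proof -
  define p where "p = up_rate n K"
  define q where "q = down_rate K"
  note mat = birth_death_chain_matrix(1)[OF K, folded p_def q_def]
  note rates = birth_death_chain_matrix(2)[OF K, folded p_def q_def]
  have p_pos: "0 < p i" if i: "i < n" for i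
  proof (rule ccontr)
    assume "\<not> 0 < p i"
    then have "p i = 0" using rates[of i] i by simp
    then have "(K ^\<^sub>m m) $$ (i, Suc i) = 0" for m
      using bd_matrix_pow_entry[OF mat, of i "Suc i" m] i bdop_funpow_zero_below[where p = p and q = q and f = "\<lambda>z. of_bool (z = Suc i)" and x = i and i = i and m = m]
      by simp
    then show False using irr i unfolding irreducible_chain_def by (metis Suc_leI less_imp_le less_irrefl)
  qed
  have q_pos: "0 < q i" if i: "0 < i" "i \<le> n" for i
  proof (rule ccontr)
    assume "\<not> 0 < q i"
    then have "q i = 0" using rates[of i] i by simp
    then have "(K ^\<^sub>m m) $$ (i, i - 1) = 0" for m
      using bd_matrix_pow_entry[OF mat, of i "i - 1" m] i bdop_funpow_zero_above[where p = p and q = q and f = "\<lambda>z. of_bool (z = i - 1)" and x = i and i = i and m = m]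
      by simp
    then show False using irr i unfolding irreducible_chain_def
      by (metis diff_le_self le_trans less_irrefl)
  qed
  have stat': "0 \<le> \<pi> x" "(\<Sum>x\<le>n. \<pi> x) = 1" "(\<Sum>x\<le>n. \<pi> x * K $$ (x, y)) = \<pi> y" if "x \<le> n" "y \<le> n" for x y
    using stat that by (auto simp: stationary_distribution_def)
  have inv: "(\<Sum>x\<le>n. \<pi> x * (bdop p q f x - f x)) = 0" for f
  proof -
    have "(\<Sum>x\<le>n. \<pi> x * bdop p q f x) = (\<Sum>x\<le>n. \<Sum>y\<le>n. \<pi> x * K $$ (x, y) * f y)"
      by (intro sum.cong refl) (simp add: bd_matrix_row[OF mat, symmetric] sum_distrib_left mult.assoc)
    also have "\<dots> = (\<Sum>y\<le>n. (\<Sum>x\<le>n. \<pi> x * K $$ (x, y)) * f y)"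
      by (subst sum.swap) (simp add: sum_distrib_right)
    also have "\<dots> = (\<Sum>y\<le>n. \<pi> y * f y)" by (intro sum.cong refl) (simp add: stat')
    finally show ?thesis by (simp add: right_diff_distrib sum_subtractf)
  qed
  have bal: "\<pi> i * p i = \<pi> (Suc i) * q (Suc i)" if i: "i < n" for i
  proof -
    have "\<pi> x * (bdop p q (\<lambda>y. of_bool (y \<le> i)) x - of_bool (x \<le> i)) =
        (if x = i then - (\<pi> i * p i) else 0) + (if x = Suc i then \<pi> (Suc i) * q (Suc i) else 0)" for x
      by (cases "x < i"; cases "x = i"; cases "x = Suc i") (auto simp: bdop_def algebra_simps)
    then show ?thesis using inv[of "\<lambda>y. of_bool (y \<le> i)"] i by (simp add: sum.distrib)
  qed
  have pi_pos: "0 < \<pi> i" if "i \<le> n" for i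
  proof -
    have "\<pi> 0 \<noteq> 0"
    proof
      assume z: "\<pi> 0 = 0"
      have "\<pi> i = 0" if "i \<le> n" for i
        using that
      proof (induction i)
        case (Suc i)
        then show ?case using bal[of i] q_pos[of "Suc i"] by simp
      qed (use z in simp)
      then show False using stat'(2)[of 0 0] by simp
    qed
    then have "0 < \<pi> 0" using stat'(1)[of 0 0] by simp
    then show ?thesis using that
    proof (induction i)
      case (Suc i)
      then have "0 < \<pi> (Suc i) * q (Suc i)" using bal[of i] p_pos[of i] by (metis Suc_le_lessD less_imp_le mult_pos_pos)
      then show ?case using q_pos[of "Suc i"] Suc.prems by (simp add: zero_less_mult_iff)
    qed
  qed
  show ?thesis
    unfolding p_def[symmetric] q_def[symmetric]
  proof
    show "p n = 0" "q 0 = 0" using mat by (auto simp: bd_matrix_def)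
  qed (use n p_pos q_pos rates pi_pos stat'(2)[of 0 0] bal in auto)
qed

lemma slowed_chain_matrix:
  assumes "bd_matrix n K p q"
  shows "bd_matrix n (slowed_chain n K c) (\<lambda>i. p i * c (i + 1)) (\<lambda>i. q i * c i)"
  using assms unfolding bd_matrix_def slowed_chain_def
  by (auto simp: algebra_simps)

lemma bd_slowed:
  assumes "bd_rates n p q \<pi>" and c: "\<And>i. i \<in> {1..n} \<Longrightarrow> 0 < c i \<and> c i < 1"
  shows "bd_rates n (\<lambda>i. p i * c (i + 1)) (\<lambda>i. q i * c i) \<pi>"
    and "\<And>i. i \<le> n \<Longrightarrow> p i * c (i + 1) + q i * c i \<le> p i + q i"
proof -
  interpret bd_rates n p q \<pi> by fact
  have 1: "p i * c (i + 1) \<le> p i" if "i \<le> n" for i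
    using that p_nonneg[OF that] p_top c[of "i + 1"] by (cases "i = n") (auto intro!: mult_left_le)
  have 2: "q i * c i \<le> q i" if "i \<le> n" for i
    using that q_nonneg[OF that] q_bot c[of i] by (cases "i = 0") (auto intro!: mult_left_le)
  show 3: "\<And>i. i \<le> n \<Longrightarrow> p i * c (i + 1) + q i * c i \<le> p i + q i"
    using 1 2 by (simp add: add_mono)
  show "bd_rates n (\<lambda>i. p i * c (i + 1)) (\<lambda>i. q i * c i) \<pi>"
  proof
    show "p i * c (i + 1) + q i * c i \<le> 1" if "i \<le> n" for i
      using 3[OF that] pq_le[OF that] by linarith
    show "\<pi> i * (p i * c (i + 1)) = \<pi> (Suc i) * (q (Suc i) * c (Suc i))" if "i < n" for i
      using balance[OF that] by (simp add: mult.assoc[symmetric])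
  qed (use n_pos p_pos q_pos p_top q_bot pi_pos pi_sum c in auto)
qed

lemma bd_half:
  assumes "bd_rates n p q \<pi>"
  shows "bd_rates n (\<lambda>i. p i / 2) (\<lambda>i. q i / 2) \<pi>"
    and "\<And>i. i \<le> n \<Longrightarrow> p i / 2 + q i / 2 \<le> 1 / 2"
    and "bd_theta n (\<lambda>i. p i / 2) (\<lambda>i. q i / 2) \<pi> M = 2 * bd_theta n p q \<pi> M"
    and "bd_alpha n (\<lambda>i. p i / 2) (\<lambda>i. q i / 2) \<pi> M = 2 * bd_alpha n p q \<pi> M"
proof -
  interpret bd_rates n p q \<pi> by fact
  show half: "p i / 2 + q i / 2 \<le> 1 / 2" if "i \<le> n" for i using pq_le[OF that] by simp
  show "bd_rates n (\<lambda>i. p i / 2) (\<lambda>i. q i / 2) \<pi>"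
  proof
    show "p i / 2 + q i / 2 \<le> 1" if "i \<le> n" for i using half[OF that] by simp
  qed (use n_pos p_pos q_pos p_top q_bot pi_pos pi_sum balance in auto)
  have pass2: "passage_mean (\<lambda>i. P i / 2) \<pi>' i = 2 * passage_mean P \<pi>' i" for P \<pi>' i
    by (simp add: passage_mean_def)
  have m2: "mean_hit (\<lambda>i. P i / 2) \<pi>' x N = 2 * mean_hit P \<pi>' x N" for P \<pi>' x N
    by (simp add: mean_hit_def pass2 sum_distrib_left)
  have "(\<Sum>l<i. 2 * passage_mean P \<pi>' l * cum \<pi>' l) = 2 * (\<Sum>l<i. passage_mean P \<pi>' l * cum \<pi>' l)" for P \<pi>' i
    by (simp add: sum_distrib_left mult.assoc)
  then have s4: "step_var (\<lambda>i. P i / 2) \<pi>' i = 4 * step_var P \<pi>' i" for P \<pi>' i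
    unfolding step_var_def pass2 by (simp add: power2_eq_square)
  have v4: "hit_var (\<lambda>i. P i / 2) \<pi>' x N = 4 * hit_var P \<pi>' x N" for P \<pi>' x N
    by (simp add: hit_var_def s4 sum_distrib_left)
  show "bd_theta n (\<lambda>i. p i / 2) (\<lambda>i. q i / 2) \<pi> M = 2 * bd_theta n p q \<pi> M"
    by (simp add: bd_theta_def m2 max_mult_distrib_left)
  have "max (4 * a) (4 * b) = 4 * max a b" for a b :: real by (simp add: max_def)
  then show "bd_alpha n (\<lambda>i. p i / 2) (\<lambda>i. q i / 2) \<pi> M = 2 * bd_alpha n p q \<pi> M"
    by (simp add: bd_alpha_def v4 real_sqrt_mult)
qed

text \<open>
  The binomial theorem for the commuting operators \<open>s G\<close> and \<open>- s I\<close>.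
\<close>
lemma scaled_generator_pow:
  fixes G :: "(nat \<Rightarrow> real) \<Rightarrow> nat \<Rightarrow> real"
  assumes add: "\<And>f g x. G (\<lambda>y. f y + g y) x = G f x + G g x"
    and scale: "\<And>k f x. G (\<lambda>y. k * f y) x = k * G f x"
  shows "((\<lambda>f x. s * G f x - s * f x) ^^ k) f x =
      (\<Sum>l\<le>k. real (k choose l) * s ^ l * (- s) ^ (k - l) * (G ^^ l) f x)"
proof (induction k arbitrary: x)
  case 0
  then show ?case by simp
next
  case (Suc k)
  define u where "u = (\<lambda>x. \<Sum>l\<le>k. real (k choose l) * s ^ l * (- s) ^ (k - l) * (G ^^ l) f x)"
  have G_sum: "G (\<lambda>x. \<Sum>l\<in>A. w l * g l x) x = (\<Sum>l\<in>A. w l * G (g l) x)" if "finite A" for A w g x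
    using that
  proof (induction A)
    case empty
    show ?case using scale[of 0 "\<lambda>_. 0" x] by simp
  qed (simp add: add scale)
  have "((\<lambda>f x. s * G f x - s * f x) ^^ Suc k) f x = s * G u x - s * u x"
    using Suc.IH by (simp add: u_def cong: if_cong) (simp add: fun_eq_iff[symmetric] Suc.IH[abs_def] u_def)
  also have "G u x = (\<Sum>l\<le>k. real (k choose l) * s ^ l * (- s) ^ (k - l) * (G ^^ Suc l) f x)"
    unfolding u_def by (subst G_sum) auto
  also have "s * \<dots> = (\<Sum>l\<le>k. real (k choose l) * s ^ Suc l * (- s) ^ (k - l) * (G ^^ Suc l) f x)"
    by (simp add: sum_distrib_left mult_ac)
  also have "\<dots> = (\<Sum>l=1..Suc k. real (k choose (l - 1)) * s ^ l * (- s) ^ (Suc k - l) * (G ^^ l) f x)"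
    by (rule sum.reindex_bij_witness[of _ "\<lambda>l. l - 1" Suc]) auto
  also have "\<dots> = (\<Sum>l\<le>Suc k. (if l = 0 then 0 else real (k choose (l - 1))) * s ^ l * (- s) ^ (Suc k - l) * (G ^^ l) f x)"
    by (rule sum.mono_neutral_cong_left) auto
  also have "s * u x = - (\<Sum>l\<le>k. real (k choose l) * s ^ l * (- s) ^ (Suc k - l) * (G ^^ l) f x)"
    unfolding u_def sum_distrib_left sum_negf[symmetric]
    by (intro sum.cong refl) (simp add: Suc_diff_le)
  also have "(\<Sum>l\<le>k. real (k choose l) * s ^ l * (- s) ^ (Suc k - l) * (G ^^ l) f x) =
      (\<Sum>l\<le>Suc k. real (k choose l) * s ^ l * (- s) ^ (Suc k - l) * (G ^^ l) f x)"
    by simp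
  finally have "((\<lambda>f x. s * G f x - s * f x) ^^ Suc k) f x =
      (\<Sum>l\<le>Suc k. ((if l = 0 then 0 else real (k choose (l - 1))) + real (k choose l)) * s ^ l * (- s) ^ (Suc k - l) * (G ^^ l) f x)"
    by (simp only: diff_minus_eq_add sum.distrib[symmetric] distrib_right)
  also have "\<dots> = (\<Sum>l\<le>Suc k. real (Suc k choose l) * s ^ l * (- s) ^ (Suc k - l) * (G ^^ l) f x)"
  proof (intro sum.cong refl)
    fix l
    have "(if l = 0 then 0 else real (k choose (l - 1))) + real (k choose l) = real (Suc k choose l)"
      by (cases l) auto
    then show "((if l = 0 then 0 else real (k choose (l - 1))) + real (k choose l)) * s ^ l * (- s) ^ (Suc k - l) * (G ^^ l) f x =
        real (Suc k choose l) * s ^ l * (- s) ^ (Suc k - l) * (G ^^ l) f x" by simp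
  qed
  finally show ?case .
qed

text \<open>
  Since \<open>- t (I - K) = 2 t G - 2 t I\<close> with \<open>G = (I + K) / 2\<close>, the exponential series is the Cauchy product of the series
  for \<open>2 t G\<close> and for \<open>- 2 t\<close>.
\<close>
lemma semigroup_entry:
  assumes K: "bd_matrix n K p q" and B: "bd_rates n p q \<pi>" and t: "0 \<le> t" and x: "x \<le> n" and y: "y \<le> n"
  shows "semigroup_at n K t $$ (x, y) =
     poisson_mix (\<lambda>i. p i / 2) (\<lambda>i. q i / 2) (2 * t) (\<lambda>z. of_bool (z = y)) x"
proof -
  define G where "G = bdop (\<lambda>i. p i / 2) (\<lambda>i. q i / 2)"
  define f where "f = (\<lambda>z. of_bool (z = y) :: real)"
  define A where "A = (- t) \<cdot>\<^sub>m (1\<^sub>m (n + 1) - K)"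
  define s where "s = 2 * t"
  interpret H: bd_rates n "\<lambda>i. p i / 2" "\<lambda>i. q i / 2" \<pi> by (rule bd_half(1)[OF B])
  have Kc: "K \<in> carrier_mat (n + 1) (n + 1)" using K by (simp add: bd_matrix_def)
  have Ac: "A \<in> carrier_mat (n + 1) (n + 1)" using Kc by (auto simp: A_def)
  have row: "(\<Sum>y\<le>n. A $$ (x, y) * g y) = s * G g x - s * g x" if x: "x \<le> n" for g x
  proof -
    have "(\<Sum>y\<le>n. A $$ (x, y) * g y) = (\<Sum>y\<le>n. t * (K $$ (x, y) * g y) - (if y = x then t * g x else 0))"
      using Kc x by (intro sum.cong) (auto simp: A_def algebra_simps)
    also have "\<dots> = t * bdop p q g x - t * g x"
      using x by (simp add: sum_subtractf sum_distrib_left[symmetric] bd_matrix_row[OF K])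
    also have "\<dots> = s * G g x - s * g x"
      by (simp add: s_def G_def bdop_def algebra_simps)
    finally show ?thesis .
  qed
  have pow: "(A ^\<^sub>m k) $$ (x, y) = (\<Sum>l\<le>k. real (k choose l) * s ^ l * (- s) ^ (k - l) * (G ^^ l) f x)" for k
  proof -
    have "(\<Sum>z\<le>n. (A ^\<^sub>m k) $$ (x, z) * f z) = ((\<lambda>g x. s * G g x - s * g x) ^^ k) f x"
      by (rule mat_pow_row[OF Ac row]) (use x in \<open>auto simp: G_def intro!: H.bdop_cong\<close>)
    moreover have "(\<Sum>z\<le>n. (A ^\<^sub>m k) $$ (x, z) * f z) = (\<Sum>z\<le>n. if z = y then (A ^\<^sub>m k) $$ (x, y) else 0)"
      by (intro sum.cong) (auto simp: f_def)
    ultimately show ?thesis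
      using y by (simp add: scaled_generator_pow G_def bdop_add bdop_cmult)
  qed
  define a where "a = (\<lambda>l. s ^ l / fact l * (G ^^ l) f x)"
  define b where "b = (\<lambda>m. (- s) ^ m / fact m)"
  have ab: "(A ^\<^sub>m k) $$ (x, y) / fact k = (\<Sum>l\<le>k. a l * b (k - l))" for k
    unfolding pow sum_divide_distrib
    by (intro sum.cong refl) (simp add: a_def b_def binomial_fact)
  have exps: "(\<lambda>m. z ^ m / fact m) sums exp z" for z :: real
    using exp_converges[of z] by (simp add: divide_inverse mult.commute scaleR_conv_of_real)
  have "summable (\<lambda>k. norm (a k))"
  proof (rule summable_comparison_test')
    show "summable (\<lambda>l. s ^ l / fact l)" using exps[of s] by (simp add: sums_iff)
    show "norm (norm (a l)) \<le> s ^ l / fact l" if "0 \<le> l" for l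
    proof -
      have "\<bar>(G ^^ l) f x\<bar> \<le> 1" unfolding G_def by (rule H.funpow_bound) (use x in \<open>auto simp: f_def\<close>)
      then have "s ^ l / fact l * \<bar>(G ^^ l) f x\<bar> \<le> s ^ l / fact l * 1"
        using t by (intro mult_left_mono) (auto simp: s_def)
      then show ?thesis using t by (simp add: a_def abs_mult s_def)
    qed
  qed
  moreover have "summable (\<lambda>k. norm (b k))"
  proof -
    have "(\<lambda>k. norm (b k)) = (\<lambda>k. \<bar>s\<bar> ^ k / fact k)" by (auto simp: b_def power_abs)
    then show ?thesis using exps[of "\<bar>s\<bar>"] by (simp add: sums_iff)
  qed
  ultimately have "(\<lambda>k. \<Sum>l\<le>k. a l * b (k - l)) sums ((\<Sum>k. a k) * (\<Sum>k. b k))"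
    by (rule Cauchy_product_sums)
  moreover have "(\<Sum>k. b k) = exp (- s)" using exps[of "- s"] by (simp add: b_def sums_iff)
  ultimately have "(\<Sum>k. (A ^\<^sub>m k) $$ (x, y) / fact k) = (\<Sum>k. a k) * exp (- s)"
    by (simp add: ab sums_iff)
  also have "\<dots> = (\<Sum>k. a k * exp (- s))"
    by (rule suminf_mult2) (use \<open>summable (\<lambda>k. norm (a k))\<close> in \<open>rule summable_norm_cancel\<close>)
  also have "\<dots> = poisson_mix (\<lambda>i. p i / 2) (\<lambda>i. q i / 2) (2 * t) (\<lambda>z. of_bool (z = y)) x"
    by (simp add: poisson_mix_def pois_def a_def G_def f_def s_def mult_ac)
  finally show ?thesis
    using x y Ac Kc by (simp add: semigroup_at_def mat_exp_def A_def)
qed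

lemma semigroup_row:
  assumes K: "bd_matrix n K p q" and B: "bd_rates n p q \<pi>" and t: "0 \<le> t" and x: "x \<le> n"
  shows "(\<Sum>y\<le>n. semigroup_at n K t $$ (x, y) * f y) =
     poisson_mix (\<lambda>i. p i / 2) (\<lambda>i. q i / 2) (2 * t) f x"
proof -
  define G where "G = bdop (\<lambda>i. p i / 2) (\<lambda>i. q i / 2)"
  interpret H: bd_rates n "\<lambda>i. p i / 2" "\<lambda>i. q i / 2" \<pi> by (rule bd_half(1)[OF B])
  have lin: "(G ^^ k) f x = (\<Sum>y\<le>n. (G ^^ k) (\<lambda>z. of_bool (z = y)) x * f y)" for k
  proof -
    have sum_lin: "(G ^^ k) (\<lambda>z. \<Sum>y\<in>A. g y z * f y) x = (\<Sum>y\<in>A. (G ^^ k) (g y) x * f y)" if "finite A" for A g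
      using that
    proof (induction A)
      case empty
      then show ?case by (simp add: G_def)
    next
      case (insert a A)
      then show ?case
        using bdop_funpow_add[of k "\<lambda>i. p i / 2" "\<lambda>i. q i / 2" "\<lambda>z. g a z * f a" "\<lambda>z. \<Sum>y\<in>A. g y z * f y" x]
          bdop_funpow_cmult[of k "\<lambda>i. p i / 2" "\<lambda>i. q i / 2" "f a" "g a" x]
        by (simp add: G_def mult.commute)
    qed
    have "(G ^^ k) f x = (G ^^ k) (\<lambda>z. \<Sum>y\<le>n. of_bool (z = y) * f y) x"
      unfolding G_def by (rule H.funpow_cong) (use x in auto)
    then show ?thesis using sum_lin[of "{..n}" "\<lambda>y z. of_bool (z = y)"] by simp
  qed
  have "(\<lambda>k. \<Sum>y\<le>n. pois (2 * t) k * (G ^^ k) (\<lambda>z. of_bool (z = y)) x * f y) sums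
      (\<Sum>y\<le>n. semigroup_at n K t $$ (x, y) * f y)"
  proof (intro sums_sum sums_mult2)
    fix y assume "y \<in> {..n}"
    then show "(\<lambda>k. pois (2 * t) k * (G ^^ k) (\<lambda>z. of_bool (z = y)) x) sums semigroup_at n K t $$ (x, y)"
      using H.mix_summable[of "2 * t" x "\<lambda>z. of_bool (z = y)"] t x
      by (simp add: semigroup_entry[OF K B] poisson_mix_def G_def summable_sums)
  qed
  moreover have "(\<Sum>y\<le>n. pois (2 * t) k * (G ^^ k) (\<lambda>z. of_bool (z = y)) x * f y) = pois (2 * t) k * (G ^^ k) f x" for k
    by (subst lin) (simp add: sum_distrib_left mult.assoc)
  ultimately show ?thesis by (simp add: poisson_mix_def G_def sums_iff)
qed

lemma max_tv_dist_le_iff: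
  "max_tv_dist n P \<pi> \<le> \<epsilon> \<longleftrightarrow>
     (\<forall>x\<le>n. \<forall>S\<subseteq>{..n}. (\<Sum>y\<in>S. P $$ (x, y)) - sum \<pi> S \<le> \<epsilon>)"
proof -
  have "(MAX S\<in>Pow {..n}. g S) \<le> \<epsilon> \<longleftrightarrow> (\<forall>S\<subseteq>{..n}. g S \<le> \<epsilon>)" for g :: "nat set \<Rightarrow> real"
    by (subst Max_le_iff) auto
  then show ?thesis by (auto simp: max_tv_dist_def tv_dist_def atLeast0AtMost)
qed

text \<open>
  For \<open>f\<close> of mean zero, \<open>P f\<close> is the integral of \<open>f\<close> against \<open>P (x, _) - \<pi>\<close>, whose total mass in absolute value is
  twice the total variation distance.
\<close>
lemma tv_contraction:
  assumes P: "\<And>x. x \<le> n \<Longrightarrow> (\<Sum>y\<le>n. P $$ (x, y)) = 1" and pi: "(\<Sum>y\<le>n. \<pi> y) = 1"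
    and tv: "max_tv_dist n P \<pi> \<le> \<epsilon>"
    and f: "\<And>y. y \<le> n \<Longrightarrow> \<bar>f y\<bar> \<le> b" "(\<Sum>y\<le>n. \<pi> y * f y) = 0" and x: "x \<le> n"
  shows "\<bar>\<Sum>y\<le>n. P $$ (x, y) * f y\<bar> \<le> 2 * \<epsilon> * b"
proof -
  define d where "d = (\<lambda>y. P $$ (x, y) - \<pi> y)"
  define S where "S = {y. y \<le> n \<and> 0 \<le> d y}"
  have b: "0 \<le> b" using f(1)[of 0] by auto
  have split: "{..n} = S \<union> ({..n} - S)" by (auto simp: S_def)
  have total: "sum d S + sum d ({..n} - S) = 0"
  proof -
    have "sum d S + sum d ({..n} - S) = sum d {..n}"
      by (subst split) (intro sum.union_disjoint[symmetric], auto simp: S_def)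
    then show ?thesis by (simp add: d_def sum_subtractf P[OF x] pi)
  qed
  have "S \<subseteq> {..n}" by (auto simp: S_def)
  then have "sum d S \<le> \<epsilon>"
    using tv x unfolding max_tv_dist_le_iff d_def sum_subtractf by blast
  have "(\<Sum>y\<le>n. \<bar>d y\<bar>) = (\<Sum>y\<in>S. \<bar>d y\<bar>) + (\<Sum>y\<in>{..n} - S. \<bar>d y\<bar>)"
    by (subst split) (intro sum.union_disjoint, auto simp: S_def)
  also have "\<dots> = sum d S - sum d ({..n} - S)"
    unfolding sum_negf[symmetric] diff_conv_add_uminus by (intro arg_cong2[where f = "(+)"] sum.cong) (auto simp: S_def)
  finally have ad: "(\<Sum>y\<le>n. \<bar>d y\<bar>) \<le> 2 * \<epsilon>" using total \<open>sum d S \<le> \<epsilon>\<close> by linarith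
  have "(\<Sum>y\<le>n. P $$ (x, y) * f y) = (\<Sum>y\<le>n. d y * f y)"
    using f(2) by (simp add: d_def left_diff_distrib sum_subtractf)
  also have "\<bar>\<dots>\<bar> \<le> (\<Sum>y\<le>n. \<bar>d y * f y\<bar>)" by (rule sum_abs)
  also have "\<dots> \<le> (\<Sum>y\<le>n. \<bar>d y\<bar> * b)"
    using f(1) by (intro sum_mono) (auto simp: abs_mult intro!: mult_left_mono)
  also have "\<dots> = (\<Sum>y\<le>n. \<bar>d y\<bar>) * b" by (simp add: sum_distrib_right)
  also have "\<dots> \<le> 2 * \<epsilon> * b" using ad b by (intro mult_right_mono)
  finally show ?thesis .
qed

section \<open>Total variation bounds for a single chain\<close>

lemma centered_indicator:
  assumes B: "bd_rates n p q \<pi>" and S: "S \<subseteq> {..n}"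
  shows "\<bar>of_bool (y \<in> S) - sum \<pi> S\<bar> \<le> 1"
    and "(\<Sum>y\<le>n. \<pi> y * (of_bool (y \<in> S) - sum \<pi> S)) = 0"
proof -
  interpret bd_rates n p q \<pi> by fact
  have nn: "0 \<le> \<pi> i" if "i \<le> n" for i using pi_pos[OF that] by simp
  have "0 \<le> sum \<pi> S" using S nn by (intro sum_nonneg) auto
  moreover have "sum \<pi> S \<le> 1"
    using S nn sum_mono2[of "{..n}" S \<pi>] pi_sum by auto
  ultimately show "\<bar>of_bool (y \<in> S) - sum \<pi> S\<bar> \<le> 1" by (auto simp: of_bool_def)
  have "(\<Sum>y\<le>n. \<pi> y * of_bool (y \<in> S)) = sum \<pi> S"
    using S by (intro sum.mono_neutral_cong_right) auto
  then show "(\<Sum>y\<le>n. \<pi> y * (of_bool (y \<in> S) - sum \<pi> S)) = 0"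
    by (simp add: right_diff_distrib sum_subtractf sum_distrib_right[symmetric] pi_sum)
qed

text \<open>
  The constant \<open>c0\<close> bounds the mass on either side of \<open>M\<close> from below.
\<close>
definition cutoff_regular where
  "cutoff_regular n p q \<pi> M c0 \<longleftrightarrow> bd_rates n p q \<pi> \<and> M \<le> n \<and> c0 \<le> cum \<pi> M \<and> c0 \<le> (\<Sum>k=M..n. \<pi> k)"

lemma tv_disc_upper:
  assumes "0 < \<epsilon>" "0 < \<delta>"
  obtains A where "0 < A"
    and "\<And>n p q \<pi> M K m. bd_rates n p q \<pi> \<Longrightarrow> (\<And>i. i \<le> n \<Longrightarrow> p i + q i \<le> 1 - \<delta>) \<Longrightarrow> M \<le> n \<Longrightarrow>
      bd_matrix n K p q \<Longrightarrow> bd_theta n p q \<pi> M + A * bd_alpha n p q \<pi> M \<le> real m \<Longrightarrow>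
      max_tv_dist n (K ^\<^sub>m m) \<pi> \<le> \<epsilon>"
proof -
  obtain A where A: "0 < A"
    and mix: "\<And>n p q \<pi> M f x m. bd_rates n p q \<pi> \<Longrightarrow> (\<And>i. i \<le> n \<Longrightarrow> p i + q i \<le> 1 - \<delta>) \<Longrightarrow> M \<le> n \<Longrightarrow>
      (\<And>y. y \<le> n \<Longrightarrow> \<bar>f y\<bar> \<le> 1) \<Longrightarrow> (\<Sum>y\<le>n. \<pi> y * f y) = 0 \<Longrightarrow> x \<le> n \<Longrightarrow>
      bd_theta n p q \<pi> M + A * bd_alpha n p q \<pi> M \<le> real m \<Longrightarrow> \<bar>(bdop p q ^^ m) f x\<bar> \<le> \<epsilon>"
    using mixing_upper[OF assms] by blast
  show ?thesis
  proof (rule that[OF A])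
    fix n p q \<pi> M K m
    assume a: "bd_rates n p q \<pi>" "\<And>i. i \<le> n \<Longrightarrow> p i + q i \<le> 1 - \<delta>" "M \<le> n"
      "bd_matrix n K p q" "bd_theta n p q \<pi> M + A * bd_alpha n p q \<pi> M \<le> real m"
    interpret bd_rates n p q \<pi> by fact
    show "max_tv_dist n (K ^\<^sub>m m) \<pi> \<le> \<epsilon>"
      unfolding max_tv_dist_le_iff
    proof (intro allI impI)
      fix x S assume x: "x \<le> n" and S: "S \<subseteq> {..n}"
      have "\<bar>(T ^^ m) (\<lambda>y. of_bool (y \<in> S) - sum \<pi> S) x\<bar> \<le> \<epsilon>"
        by (rule mix[OF a(1-3)]) (use centered_indicator[OF a(1) S] x a(5) in auto)
      then show "(\<Sum>y\<in>S. (K ^\<^sub>m m) $$ (x, y)) - sum \<pi> S \<le> \<epsilon>"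
        using bd_matrix_pow_set[OF a(4) x S, of m] by (simp add: bdop_funpow_diff)
    qed
  qed
qed

lemma tv_disc_lower:
  assumes e: "0 < \<epsilon>" and c: "0 < c0"
  obtains A where "0 < A"
    and "\<And>n p q \<pi> M K m. cutoff_regular n p q \<pi> M c0 \<Longrightarrow> bd_matrix n K p q \<Longrightarrow>
      real m \<le> bd_theta n p q \<pi> M - A * bd_alpha n p q \<pi> M \<Longrightarrow> \<not> max_tv_dist n (K ^\<^sub>m m) \<pi> < 1 - \<epsilon>"
proof -
  define \<eta> where "\<eta> = min (\<epsilon> / 2) c0"
  have eta: "0 < \<eta>" "\<eta> \<le> \<epsilon> / 2" "\<eta> \<le> c0" using e c by (auto simp: \<eta>_def)
  show ?thesis
  proof (rule that[of "1 / sqrt \<eta> + sqrt (2 / \<epsilon>)"])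
    show "0 < 1 / sqrt \<eta> + sqrt (2 / \<epsilon>)" using eta e by (intro add_pos_pos) auto
    fix n p q \<pi> M K m
    assume a: "cutoff_regular n p q \<pi> M c0" "bd_matrix n K p q"
      "real m \<le> bd_theta n p q \<pi> M - (1 / sqrt \<eta> + sqrt (2 / \<epsilon>)) * bd_alpha n p q \<pi> M"
    interpret bd_rates n p q \<pi> using a(1) by (simp add: cutoff_regular_def)
    obtain x S where xS: "x \<le> n" "S \<subseteq> {..n}" "1 - \<epsilon> \<le> (T ^^ m) (\<lambda>y. of_bool (y \<in> S)) x - sum \<pi> S"
      using mixing_lower[of M \<epsilon> \<eta>] eta e a by (force simp: cutoff_regular_def)
    then have "1 - \<epsilon> \<le> (\<Sum>y\<in>S. (K ^\<^sub>m m) $$ (x, y)) - sum \<pi> S"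
      using bd_matrix_pow_set[OF a(2) xS(1,2)] by simp
    also have "\<dots> \<le> max_tv_dist n (K ^\<^sub>m m) \<pi>"
      using max_tv_dist_le_iff[of n "K ^\<^sub>m m" \<pi> "max_tv_dist n (K ^\<^sub>m m) \<pi>"] xS by auto
    finally show "\<not> max_tv_dist n (K ^\<^sub>m m) \<pi> < 1 - \<epsilon>" by simp
  qed
qed

lemma variance_le_of_tv_disc:
  assumes R: "cutoff_regular n p q \<pi> M c0" and c0: "0 < c0" and K: "bd_matrix n K p q"
    and tv: "max_tv_dist n (K ^\<^sub>m m) \<pi> \<le> \<epsilon>" and e: "0 < \<epsilon>" "\<epsilon> < 1 / 2"
  shows "(bd_alpha n p q \<pi> M)\<^sup>2 \<le>
     2 * (2 / c0 + 2 * real m / (c0 * ln (1 / (2 * \<epsilon>)))) * bd_theta n p q \<pi> M"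
proof -
  interpret bd_rates n p q \<pi> using R by (simp add: cutoff_regular_def)
  show ?thesis
  proof (rule variance_bound_disc)
    fix f b x assume f: "avg f = 0" "\<And>y. y \<le> n \<Longrightarrow> \<bar>f y\<bar> \<le> b" "x \<le> n"
    have "\<bar>\<Sum>y\<le>n. (K ^\<^sub>m m) $$ (x, y) * f y\<bar> \<le> 2 * \<epsilon> * b"
    proof (rule tv_contraction[OF _ pi_sum tv f(2) _ f(3)])
      show "(\<Sum>y\<le>n. (K ^\<^sub>m m) $$ (x, y)) = 1" if "x \<le> n" for x
        using bd_matrix_pow[OF K that, of m "\<lambda>_. 1"] by simp
    qed (use f(1) in \<open>auto simp: avg_def\<close>)
    then show "\<bar>(T ^^ m) f x\<bar> \<le> 2 * \<epsilon> * b" by (simp add: bd_matrix_pow[OF K f(3)])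
  qed (use R c0 e in \<open>auto simp: cutoff_regular_def\<close>)
qed

lemma semigroup_set:
  assumes K: "bd_matrix n K p q" and B: "bd_rates n p q \<pi>" and t: "0 \<le> t" and x: "x \<le> n" and S: "S \<subseteq> {..n}"
  shows "(\<Sum>y\<in>S. semigroup_at n K t $$ (x, y)) - sum \<pi> S =
    (\<Sum>k. pois (2 * t) k * ((bdop (\<lambda>i. p i / 2) (\<lambda>i. q i / 2) ^^ k) (\<lambda>y. of_bool (y \<in> S)) x - sum \<pi> S))"
proof -
  interpret H: bd_rates n "\<lambda>i. p i / 2" "\<lambda>i. q i / 2" \<pi> by (rule bd_half(1)[OF B])
  have "(\<Sum>y\<in>S. semigroup_at n K t $$ (x, y)) = (\<Sum>y\<le>n. semigroup_at n K t $$ (x, y) * of_bool (y \<in> S))"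
    using S by (intro sum.mono_neutral_cong_left) auto
  also have "\<dots> = H.mix (2 * t) (\<lambda>y. of_bool (y \<in> S)) x"
    by (rule semigroup_row[OF K B t x])
  finally have 1: "(\<lambda>k. pois (2 * t) k * (H.T ^^ k) (\<lambda>y. of_bool (y \<in> S)) x) sums (\<Sum>y\<in>S. semigroup_at n K t $$ (x, y))"
    using H.mix_summable[of "2 * t" x] t x by (simp add: poisson_mix_def summable_sums)
  have "(\<lambda>k. pois (2 * t) k * (H.T ^^ k) (\<lambda>y. of_bool (y \<in> S)) x - pois (2 * t) k * sum \<pi> S) sums
      ((\<Sum>y\<in>S. semigroup_at n K t $$ (x, y)) - 1 * sum \<pi> S)"
    by (intro sums_diff 1 sums_mult2 pois_sums_1)
  then show ?thesis by (simp add: sums_iff right_diff_distrib)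
qed

lemma tv_cont_upper:
  assumes "0 < \<epsilon>"
  obtains A where "0 < A"
    and "\<And>n p q \<pi> M K t. bd_rates n p q \<pi> \<Longrightarrow> M \<le> n \<Longrightarrow> bd_matrix n K p q \<Longrightarrow>
      bd_theta n p q \<pi> M + A * bd_alpha n p q \<pi> M < t \<Longrightarrow>
      max_tv_dist n (semigroup_at n K t) \<pi> \<le>
        \<epsilon> + t / (2 * (t - bd_theta n p q \<pi> M - A * bd_alpha n p q \<pi> M)\<^sup>2)"
proof -
  obtain A where A: "0 < A"
    and mix: "\<And>n p q \<pi> M f x m. bd_rates n p q \<pi> \<Longrightarrow> (\<And>i. i \<le> n \<Longrightarrow> p i + q i \<le> 1 - 1 / 2) \<Longrightarrow> M \<le> n \<Longrightarrow>
      (\<And>y. y \<le> n \<Longrightarrow> \<bar>f y\<bar> \<le> 1) \<Longrightarrow> (\<Sum>y\<le>n. \<pi> y * f y) = 0 \<Longrightarrow> x \<le> n \<Longrightarrow>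
      bd_theta n p q \<pi> M + A * bd_alpha n p q \<pi> M \<le> real m \<Longrightarrow> \<bar>(bdop p q ^^ m) f x\<bar> \<le> \<epsilon>"
    using mixing_upper[OF assms, of "1 / 2"] by auto
  show ?thesis
  proof (rule that[OF A])
    fix n p q \<pi> M K t
    assume a: "bd_rates n p q \<pi>" "M \<le> n" "bd_matrix n K p q"
      and t: "bd_theta n p q \<pi> M + A * bd_alpha n p q \<pi> M < t"
    interpret bd_rates n p q \<pi> by fact
    interpret H: bd_rates n "\<lambda>i. p i / 2" "\<lambda>i. q i / 2" \<pi> by (rule bd_half(1)[OF a(1)])
    define K0 where "K0 = 2 * (\<theta> M + A * \<alpha> M)"
    have K0: "H.\<theta> M + A * H.\<alpha> M = K0" using bd_half(3,4)[OF a(1)] by (simp add: K0_def algebra_simps)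
    have pos: "0 \<le> \<theta> M" "1 \<le> \<alpha> M" using theta_ge[OF a(2)] alpha_ge_1[OF a(2)] by auto
    then have "0 \<le> \<theta> M + A * \<alpha> M" using A by auto
    then have t0: "0 \<le> t" using t by linarith
    show "max_tv_dist n (semigroup_at n K t) \<pi> \<le> \<epsilon> + t / (2 * (t - \<theta> M - A * \<alpha> M)\<^sup>2)"
      unfolding max_tv_dist_le_iff
    proof (intro allI impI)
      fix x S assume x: "x \<le> n" and S: "S \<subseteq> {..n}"
      define g where "g = (\<lambda>k. (H.T ^^ k) (\<lambda>y. of_bool (y \<in> S)) x - sum \<pi> S)"
      have g: "g k = (H.T ^^ k) (\<lambda>y. of_bool (y \<in> S) - sum \<pi> S) x" for k
        by (simp add: g_def bdop_funpow_diff)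
      have "\<bar>\<Sum>k. pois (2 * t) k * g k\<bar> \<le> \<epsilon> + (2 * t) / (2 * t - K0)\<^sup>2"
      proof (rule pois_tail_upper)
        show "\<bar>g k\<bar> \<le> 1" for k unfolding g
          by (rule H.funpow_bound) (use centered_indicator(1)[OF a(1) S] x in auto)
        show "\<bar>g k\<bar> \<le> \<epsilon>" if "K0 \<le> real k" for k unfolding g
          by (rule mix[OF H.bd_rates_axioms _ a(2)]) (use bd_half(2)[OF a(1)] centered_indicator[OF a(1) S] x that K0 in auto)
      qed (use t t0 assms in \<open>auto simp: K0_def\<close>)
      also have "(2 * t) / (2 * t - K0)\<^sup>2 = t / (2 * (t - \<theta> M - A * \<alpha> M)\<^sup>2)"
      proof -
        have "2 * t - K0 = 2 * (t - \<theta> M - A * \<alpha> M)" by (simp add: K0_def)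
        then show ?thesis by (simp only: power_mult_distrib) simp
      qed
      finally show "(\<Sum>y\<in>S. semigroup_at n K t $$ (x, y)) - sum \<pi> S \<le> \<epsilon> + t / (2 * (t - \<theta> M - A * \<alpha> M)\<^sup>2)"
        unfolding semigroup_set[OF a(3,1) t0 x S] g_def by linarith
    qed
  qed
qed

lemma tv_cont_lower:
  assumes e: "0 < \<epsilon>" and c: "0 < c0"
  obtains A where "0 < A"
    and "\<And>n p q \<pi> M K t. cutoff_regular n p q \<pi> M c0 \<Longrightarrow> bd_matrix n K p q \<Longrightarrow> 0 \<le> t \<Longrightarrow>
      t < bd_theta n p q \<pi> M - A * bd_alpha n p q \<pi> M \<Longrightarrow>
      1 - \<epsilon> - t / (bd_theta n p q \<pi> M - A * bd_alpha n p q \<pi> M - t)\<^sup>2 \<le> max_tv_dist n (semigroup_at n K t) \<pi>"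
proof -
  define \<eta> where "\<eta> = min (\<epsilon> / 2) c0"
  have eta: "0 < \<eta>" "\<eta> \<le> \<epsilon> / 2" "\<eta> \<le> c0" using e c by (auto simp: \<eta>_def)
  define A where "A = 1 / sqrt \<eta> + sqrt (2 / \<epsilon>)"
  show ?thesis
  proof (rule that[of A])
    show "0 < A" using eta e unfolding A_def by (intro add_pos_pos) auto
    fix n p q \<pi> M K t
    assume a: "cutoff_regular n p q \<pi> M c0" "bd_matrix n K p q" "0 \<le> t"
      "t < bd_theta n p q \<pi> M - A * bd_alpha n p q \<pi> M"
    then have B: "bd_rates n p q \<pi>" "M \<le> n" by (auto simp: cutoff_regular_def)
    interpret bd_rates n p q \<pi> by fact
    interpret H: bd_rates n "\<lambda>i. p i / 2" "\<lambda>i. q i / 2" \<pi> by (rule bd_half(1)[OF B(1)])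
    define K0 where "K0 = 2 * (\<theta> M - A * \<alpha> M)"
    have K0: "H.\<theta> M - A * H.\<alpha> M = K0" using bd_half(3,4)[OF B(1)] by (simp add: K0_def algebra_simps)
    obtain x S where xS: "x \<le> n" "S \<subseteq> {..n}"
      "\<And>k. real k \<le> K0 \<Longrightarrow> 1 - \<epsilon> \<le> (H.T ^^ k) (\<lambda>y. of_bool (y \<in> S)) x - sum \<pi> S"
      using H.mixing_lower[of M \<epsilon> \<eta>] eta e a K0 unfolding A_def by (force simp: cutoff_regular_def)
    define g where "g = (\<lambda>k. (H.T ^^ k) (\<lambda>y. of_bool (y \<in> S)) x - sum \<pi> S)"
    have g: "g k = (H.T ^^ k) (\<lambda>y. of_bool (y \<in> S) - sum \<pi> S) x" for k
      by (simp add: g_def bdop_funpow_diff)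
    have "1 - \<epsilon> - 2 * (2 * t) / (K0 - 2 * t)\<^sup>2 \<le> (\<Sum>k. pois (2 * t) k * g k)"
    proof (rule pois_tail_lower)
      show "\<bar>g k\<bar> \<le> 1" for k unfolding g
        by (rule H.funpow_bound) (use centered_indicator(1)[OF B(1) xS(2)] xS(1) in auto)
      show "1 - \<epsilon> \<le> g k" if "real k \<le> K0" for k unfolding g_def by (rule xS(3)[OF that])
    qed (use a e in \<open>auto simp: K0_def\<close>)
    also have "\<dots> = (\<Sum>y\<in>S. semigroup_at n K t $$ (x, y)) - sum \<pi> S"
      unfolding semigroup_set[OF a(2) B(1) a(3) xS(1,2)] g_def ..
    also have "\<dots> \<le> max_tv_dist n (semigroup_at n K t) \<pi>"
      using max_tv_dist_le_iff[of n "semigroup_at n K t" \<pi> "max_tv_dist n (semigroup_at n K t) \<pi>"] xS(1,2)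
      by blast
    also have "2 * (2 * t) / (K0 - 2 * t)\<^sup>2 = t / (\<theta> M - A * \<alpha> M - t)\<^sup>2"
    proof -
      have "K0 - 2 * t = 2 * (\<theta> M - A * \<alpha> M - t)" by (simp add: K0_def)
      then show ?thesis by (simp only: power_mult_distrib) simp
    qed
    finally show "1 - \<epsilon> - t / (\<theta> M - A * \<alpha> M - t)\<^sup>2 \<le> max_tv_dist n (semigroup_at n K t) \<pi>" .
  qed
qed

text \<open>
  All parameters are those of the original chain; the doubling for the half-lazy chain and the Poisson mean \<open>2 t\<close>
  cancel.
\<close>
lemma variance_le_of_tv_cont:
  assumes R: "cutoff_regular n p q \<pi> M c0" and c0: "0 < c0" and K: "bd_matrix n K p q" and t: "0 \<le> t"
    and tv: "max_tv_dist n (semigroup_at n K t) \<pi> \<le> \<epsilon>" and e: "0 < \<epsilon>" "\<epsilon> < 1 / 2"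
  shows "(bd_alpha n p q \<pi> M)\<^sup>2 \<le> 2 * (t / (c0 * ln (1 / (2 * \<epsilon>)))) * bd_theta n p q \<pi> M"
proof -
  have B: "bd_rates n p q \<pi>" using R by (simp add: cutoff_regular_def)
  interpret bd_rates n p q \<pi> by fact
  interpret H: bd_rates n "\<lambda>i. p i / 2" "\<lambda>i. q i / 2" \<pi> by (rule bd_half(1)[OF B])
  have "(H.\<alpha> M)\<^sup>2 \<le> 2 * ((2 * t) / (c0 * ln (1 / (2 * \<epsilon>)))) * H.\<theta> M"
  proof (rule H.variance_bound_mix)
    fix f b x assume f: "H.avg f = 0" "\<And>y. y \<le> n \<Longrightarrow> \<bar>f y\<bar> \<le> b" "x \<le> n"
    have "\<bar>\<Sum>y\<le>n. semigroup_at n K t $$ (x, y) * f y\<bar> \<le> 2 * \<epsilon> * b"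
    proof (rule tv_contraction[OF _ pi_sum tv f(2) _ f(3)])
      show "(\<Sum>y\<le>n. semigroup_at n K t $$ (x, y)) = 1" if "x \<le> n" for x
        using semigroup_row[OF K B t that, of "\<lambda>_. 1"] pois_sums_1[of "2 * t"]
        by (simp add: poisson_mix_def sums_iff)
    qed (use f(1) in \<open>auto simp: H.avg_def\<close>)
    then show "\<bar>H.mix (2 * t) f x\<bar> \<le> 2 * \<epsilon> * b" by (simp add: semigroup_row[OF K B t f(3)])
  qed (use R c0 e t bd_half(2)[OF B] in \<open>auto simp: cutoff_regular_def\<close>)
  then show ?thesis using bd_half(3,4)[OF B, of M] by (simp add: power_mult_distrib)
qed

section \<open>Cutoff of families\<close>

lemma has_cutoff_timeI:
  assumes pos: "\<And>n. 1 \<le> n \<Longrightarrow> 0 < t n"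
    and up: "\<And>\<epsilon> \<kappa>. 0 < \<epsilon> \<Longrightarrow> \<epsilon> < 1 \<Longrightarrow> 0 < \<kappa> \<Longrightarrow> \<kappa> < 1 \<Longrightarrow>
      eventually (\<lambda>n. T n \<epsilon> \<le> ereal ((1 + \<kappa>) * t n)) sequentially"
    and low: "\<And>\<epsilon> \<kappa>. 0 < \<epsilon> \<Longrightarrow> \<epsilon> < 1 \<Longrightarrow> 0 < \<kappa> \<Longrightarrow> \<kappa> < 1 \<Longrightarrow>
      eventually (\<lambda>n. ereal ((1 - \<kappa>) * t n) \<le> T n \<epsilon>) sequentially"
  shows "has_cutoff_time T t"
  unfolding has_cutoff_time_def
proof (intro conjI allI impI)
  fix \<epsilon> :: real assume e: "0 < \<epsilon> \<and> \<epsilon> < 1"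
  show "(\<lambda>n. T n \<epsilon> / ereal (t n)) \<longlonglongrightarrow> 1"
  proof (rule order_tendstoI)
    fix a :: ereal assume a: "a < 1"
    obtain z where z: "a < ereal z" "ereal z < 1" using ereal_dense2[OF a] by blast
    define \<kappa> where "\<kappa> = min (1 - z) (1 / 2)"
    have k: "0 < \<kappa>" "\<kappa> < 1" "a < ereal (1 - \<kappa>)"
      using z by (auto simp: \<kappa>_def one_ereal_def intro: less_le_trans)
    have "eventually (\<lambda>n. ereal ((1 - \<kappa>) * t n) \<le> T n \<epsilon>) sequentially"
      using low e k by blast
    then show "eventually (\<lambda>n. a < T n \<epsilon> / ereal (t n)) sequentially"
      using eventually_ge_at_top[of 1]
    proof eventually_elim
      case (elim n)
      have "ereal (1 - \<kappa>) \<le> T n \<epsilon> / ereal (t n)"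
        using elim pos[of n] by (simp add: ereal_le_divide_pos mult.commute)
      then show ?case using k(3) by (rule less_le_trans[rotated])
    qed
  next
    fix a :: ereal assume a: "1 < a"
    obtain z where z: "1 < ereal z" "ereal z < a" using ereal_dense2[OF a] by blast
    define \<kappa> where "\<kappa> = min (z - 1) (1 / 2)"
    have "ereal (1 + \<kappa>) \<le> ereal z" by (simp add: \<kappa>_def)
    then have "ereal (1 + \<kappa>) < a" using z(2) by (rule le_less_trans)
    then have k: "0 < \<kappa>" "\<kappa> < 1" "ereal (1 + \<kappa>) < a"
      using z(1) by (auto simp: \<kappa>_def one_ereal_def)
    have "eventually (\<lambda>n. T n \<epsilon> \<le> ereal ((1 + \<kappa>) * t n)) sequentially"
      using up e k by blast
    then show "eventually (\<lambda>n. T n \<epsilon> / ereal (t n) < a) sequentially"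
      using eventually_ge_at_top[of 1]
    proof eventually_elim
      case (elim n)
      have "T n \<epsilon> / ereal (t n) \<le> ereal (1 + \<kappa>)"
        using elim pos[of n] by (simp add: ereal_divide_le_pos mult.commute)
      then show ?case using k(3) by (rule le_less_trans)
    qed
  qed
qed (use pos in auto)

text \<open>
  Under a cutoff the mixing times at two levels differ by a factor tending to one, hence eventually by less than
  the factor \<open>4\<close>.
\<close>
lemma has_cutoff_compare:
  assumes cut: "has_cutoff T" and e: "0 < \<epsilon>" "\<epsilon> < 1" "0 < \<epsilon>0" "\<epsilon>0 < 1"
    and up: "eventually (\<lambda>n. T n \<epsilon>0 \<le> ereal (b n)) sequentially"
  shows "eventually (\<lambda>n. T n \<epsilon> < ereal (4 * b n)) sequentially"
proof -
  obtain t where t: "\<And>n. 1 \<le> n \<Longrightarrow> 0 < t n" "\<And>\<epsilon>. 0 < \<epsilon> \<Longrightarrow> \<epsilon> < 1 \<Longrightarrow> (\<lambda>n. T n \<epsilon> / ereal (t n)) \<longlonglongrightarrow> 1"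
    using cut unfolding has_cutoff_def has_cutoff_time_def by blast
  have "eventually (\<lambda>n. T n \<epsilon> / ereal (t n) < ereal 2) sequentially"
    using t(2)[OF e(1,2)] by (rule order_tendstoD) (simp add: one_ereal_def)
  moreover have "eventually (\<lambda>n. ereal (1 / 2) < T n \<epsilon>0 / ereal (t n)) sequentially"
    using t(2)[OF e(3,4)] by (rule order_tendstoD) (simp add: one_ereal_def)
  ultimately show ?thesis
    using eventually_ge_at_top[of 1] up
  proof eventually_elim
    case (elim n)
    have tn: "0 < t n" using t(1) elim by simp
    have 1: "T n \<epsilon> < ereal (2 * t n)"
      using elim(1) tn by (simp add: ereal_divide_less_pos mult.commute)
    have "ereal (1 / 2 * t n) < T n \<epsilon>0"
      using elim(2) tn by (simp add: ereal_less_divide_pos mult.commute)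
    then have "1 / 2 * t n < b n" using elim(4) by (metis ereal_less_eq(3) leD le_less_linear less_le_trans ereal_less(2) less_ereal.simps(1))
    then have "ereal (2 * t n) \<le> ereal (4 * b n)" by simp
    then show ?case using 1 by (rule less_le_trans[rotated])
  qed
qed

lemma regular_theta:
  assumes "cutoff_regular n p q \<pi> M c0" "1 \<le> n"
  shows "real n / 2 \<le> bd_theta n p q \<pi> M" "1 / 2 \<le> bd_theta n p q \<pi> M"
    "1 \<le> bd_alpha n p q \<pi> M" "bd_alpha n p q \<pi> M \<le> bd_theta n p q \<pi> M"
proof -
  interpret bd_rates n p q \<pi> using assms by (simp add: cutoff_regular_def)
  have M: "M \<le> n" using assms by (simp add: cutoff_regular_def)
  show "real n / 2 \<le> \<theta> M" by (rule theta_ge[OF M])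
  then show "1 / 2 \<le> \<theta> M" using assms(2) by simp
  show "1 \<le> \<alpha> M" by (rule alpha_ge_1[OF M])
  show "\<alpha> M \<le> \<theta> M" by (rule alpha_le_theta[OF M])
qed

locale cutoff_family =
  fixes K :: "nat \<Rightarrow> real mat" and p q \<pi> :: "nat \<Rightarrow> nat \<Rightarrow> real" and M :: "nat \<Rightarrow> nat" and c0 :: real
  assumes c0: "0 < c0"
    and reg: "\<And>n. 1 \<le> n \<Longrightarrow> cutoff_regular n (p n) (q n) (\<pi> n) (M n) c0"
    and mat: "\<And>n. 1 \<le> n \<Longrightarrow> bd_matrix n (K n) (p n) (q n)"
begin

definition "th n = bd_theta n (p n) (q n) (\<pi> n) (M n)"
definition "al n = bd_alpha n (p n) (q n) (\<pi> n) (M n)"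

lemma th_al:
  assumes "1 \<le> n"
  shows "real n / 2 \<le> th n" "1 / 2 \<le> th n" "1 \<le> al n" "al n \<le> th n"
  using regular_theta[OF reg[OF assms] assms] by (auto simp: th_def al_def)

lemma th_large: "eventually (\<lambda>n. x \<le> th n) sequentially"
  using eventually_ge_at_top[of "nat \<lceil>2 * x\<rceil>"] eventually_ge_at_top[of 1]
proof eventually_elim
  case (elim n)
  then have "x \<le> real n / 2" by linarith
  then show ?case using th_al(1)[OF elim(2)] by linarith
qed

text \<open>
  The mixing time at level \<open>1/2\<close> is at most \<open>C * th n\<close>, so under a cutoff the mixing time at every small level \<open>\<epsilon>\<close> is
  eventually at most \<open>4 * C * th n\<close>.  Mixing to level \<open>\<epsilon>\<close> by then forces \<open>(al n / th n)\<^sup>2\<close> to be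
  \<open>O(1 / ln (1 / \<epsilon>))\<close>, up to a term \<open>O(1 / th n)\<close>.
\<close>
lemma alpha_small_from_disc_cutoff:
  assumes d: "0 < \<delta>" and holding: "\<And>n i. 1 \<le> n \<Longrightarrow> i \<le> n \<Longrightarrow> p n i + q n i \<le> 1 - \<delta>"
    and cut: "has_cutoff (\<lambda>n. mixing_time_disc n (K n) (\<pi> n))"
  shows "(\<lambda>n. al n / th n) \<longlonglongrightarrow> 0"
proof -
  obtain A where A: "0 < A"
    and up: "\<And>n p q \<pi> M K m. bd_rates n p q \<pi> \<Longrightarrow> (\<And>i. i \<le> n \<Longrightarrow> p i + q i \<le> 1 - \<delta>) \<Longrightarrow> M \<le> n \<Longrightarrow>
      bd_matrix n K p q \<Longrightarrow> bd_theta n p q \<pi> M + A * bd_alpha n p q \<pi> M \<le> real m \<Longrightarrow>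
      max_tv_dist n (K ^\<^sub>m m) \<pi> \<le> 1 / 2"
    using tv_disc_upper[of "1 / 2" \<delta>] d by auto
  (* Rounding up costs one step, and 1 \<le> 2 * th n. *)
  define C where "C = A + 3"
  have C: "0 < C" using A by (simp add: C_def)
  have half: "mixing_time_disc n (K n) (\<pi> n) (1 / 2) \<le> ereal (C * th n)" if n: "1 \<le> n" for n
  proof -
    define m where "m = nat \<lceil>th n + A * al n\<rceil>"
    have nn: "0 \<le> th n + A * al n" using th_al[OF n] A by simp
    have "A * al n \<le> A * th n" using th_al[OF n] A by simp
    then have m: "th n + A * al n \<le> real m" "real m \<le> C * th n"
      using nn th_al[OF n] by (auto simp: m_def C_def algebra_simps) linarith+
    have "max_tv_dist n (K n ^\<^sub>m m) (\<pi> n) \<le> 1 / 2"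
      using reg[OF n] mat[OF n] holding[OF n] m(1)
      by (intro up) (auto simp: cutoff_regular_def th_def al_def)
    then have "mixing_time_disc n (K n) (\<pi> n) (1 / 2) \<le> ereal (real m)"
      unfolding mixing_time_disc_def by (intro INF_lower) auto
    also have "\<dots> \<le> ereal (C * th n)" using m by simp
    finally show ?thesis .
  qed
  show ?thesis
  proof (rule tendstoI)
    fix \<eta>' :: real assume "0 < \<eta>'"
    define \<eta> where "\<eta> = \<eta>' / 2"
    have eta: "0 < \<eta>" "\<eta> < \<eta>'" using \<open>0 < \<eta>'\<close> by (auto simp: \<eta>_def)
    (* The level \<epsilon> is such that the main term 16 C / (c0 L) of the variance bound is half of \<eta>^2. *)
    define L where "L = 32 * C / (c0 * \<eta>\<^sup>2)"
    define \<epsilon> where "\<epsilon> = exp (- L) / 2"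
    have L: "0 < L" using C c0 eta by (simp add: L_def)
    have e: "0 < \<epsilon>" "\<epsilon> < 1 / 2" "ln (1 / (2 * \<epsilon>)) = L"
      using L by (auto simp: \<epsilon>_def ln_div)
    have "eventually (\<lambda>n. mixing_time_disc n (K n) (\<pi> n) \<epsilon> < ereal (4 * (C * th n))) sequentially"
    proof -
      have "eventually (\<lambda>n. mixing_time_disc n (K n) (\<pi> n) (1 / 2) \<le> ereal (C * th n)) sequentially"
        using eventually_ge_at_top[of 1] by eventually_elim (rule half)
      then show ?thesis
        using has_cutoff_compare[OF cut, of \<epsilon> "1 / 2" "\<lambda>n. C * th n"] e by simp
    qed
    then show "eventually (\<lambda>n. dist (al n / th n) 0 < \<eta>') sequentially"
      using eventually_ge_at_top[of 1] th_large[of "8 / (c0 * \<eta>\<^sup>2)"]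
    proof eventually_elim
      case (elim n)
      obtain m where m: "max_tv_dist n (K n ^\<^sub>m m) (\<pi> n) \<le> \<epsilon>" "real m < 4 * (C * th n)"
        using elim(1) unfolding mixing_time_disc_def by (auto simp: INF_less_iff)
      note t = th_al[OF elim(2)]
      have "(al n)\<^sup>2 \<le> 2 * (2 / c0 + 2 * real m / (c0 * L)) * th n"
        using variance_le_of_tv_disc[OF reg[OF elim(2)] c0 mat[OF elim(2)] m(1) e(1,2)]
        by (simp add: e(3) th_def al_def)
      also have "\<dots> \<le> 2 * (2 / c0 + 2 * (4 * (C * th n)) / (c0 * L)) * th n"
        using m(2) c0 L t by (intro mult_right_mono mult_left_mono add_left_mono divide_right_mono) auto
      also have "\<dots> = 4 / c0 * th n + 16 * C / (c0 * L) * (th n)\<^sup>2"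
        by (simp add: power2_eq_square field_simps)
      also have "16 * C / (c0 * L) = \<eta>\<^sup>2 / 2"
        using C c0 eta by (simp add: L_def field_simps)
      also have "4 / c0 * th n \<le> \<eta>\<^sup>2 / 2 * (th n)\<^sup>2"
      proof -
        have "8 \<le> th n * (c0 * \<eta>\<^sup>2)" using elim(3) c0 eta by (simp add: pos_divide_le_eq)
        then have "8 * th n \<le> th n * (c0 * \<eta>\<^sup>2) * th n" using t by (intro mult_right_mono) auto
        then show ?thesis using c0 by (simp add: field_simps power2_eq_square)
      qed
      finally have "(al n)\<^sup>2 \<le> (\<eta> * th n)\<^sup>2" by (simp add: power_mult_distrib)
      then have "al n \<le> \<eta> * th n" by (rule power2_le_imp_le) (use eta t in simp)
      then have "al n / th n \<le> \<eta>" using t by (subst pos_divide_le_eq) auto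
      moreover have "0 \<le> al n / th n" using t by simp
      ultimately show ?case using eta(2) unfolding dist_real_def by linarith
    qed
  qed
qed

lemma alpha_small_from_cont_cutoff:
  assumes cut: "has_cutoff (\<lambda>n. mixing_time_cont n (K n) (\<pi> n))"
  shows "(\<lambda>n. al n / th n) \<longlonglongrightarrow> 0"
proof -
  obtain A where A: "0 < A"
    and up: "\<And>n p q \<pi> M K t. bd_rates n p q \<pi> \<Longrightarrow> M \<le> n \<Longrightarrow> bd_matrix n K p q \<Longrightarrow>
      bd_theta n p q \<pi> M + A * bd_alpha n p q \<pi> M < t \<Longrightarrow>
      max_tv_dist n (semigroup_at n K t) \<pi> \<le>
        1 / 4 + t / (2 * (t - bd_theta n p q \<pi> M - A * bd_alpha n p q \<pi> M)\<^sup>2)"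
    using tv_cont_upper[of "1 / 4"] by auto
  define C where "C = 2 * A + 10"
  have C: "0 < C" using A by (simp add: C_def)
  have half: "mixing_time_cont n (K n) (\<pi> n) (1 / 2) \<le> ereal (C * th n)" if n: "1 \<le> n" for n
  proof -
    define u where "u = th n + A * al n"
    (* At this time the Poisson error t / (2 * (u + 4)^2) is at most 1/4. *)
    define t where "t = 2 * u + 4"
    have u: "0 \<le> u" using th_al[OF n] A by (simp add: u_def)
    have "A * al n \<le> A * th n" using th_al[OF n] A by simp
    then have t: "t \<le> C * th n"
      using th_al[OF n] by (simp add: t_def u_def C_def algebra_simps)
    have "max_tv_dist n (semigroup_at n (K n) t) (\<pi> n) \<le> 1 / 4 + t / (2 * (t - th n - A * al n)\<^sup>2)"
      unfolding th_def al_def using reg[OF n] mat[OF n] u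
      by (intro up) (auto simp: cutoff_regular_def t_def u_def th_def al_def)
    also have "t - th n - A * al n = u + 4" by (simp add: t_def u_def)
    also have "t / (2 * (u + 4)\<^sup>2) \<le> 1 / 4"
    proof -
      have "t * 4 \<le> 2 * (u + 4)\<^sup>2" using u by (simp add: t_def power2_eq_square algebra_simps)
      moreover have "0 < 2 * (u + 4)\<^sup>2" using u by simp
      ultimately show ?thesis by (simp add: pos_divide_le_eq del: zero_less_mult_iff zero_less_power2)
    qed
    finally have "max_tv_dist n (semigroup_at n (K n) t) (\<pi> n) \<le> 1 / 2" by simp
    then have "mixing_time_cont n (K n) (\<pi> n) (1 / 2) \<le> ereal t"
      unfolding mixing_time_cont_def using u by (intro INF_lower) (auto simp: t_def)
    also have "\<dots> \<le> ereal (C * th n)" using t by simp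
    finally show ?thesis .
  qed
  show ?thesis
  proof (rule tendstoI)
    fix \<eta>' :: real assume "0 < \<eta>'"
    define \<eta> where "\<eta> = \<eta>' / 2"
    have eta: "0 < \<eta>" "\<eta> < \<eta>'" using \<open>0 < \<eta>'\<close> by (auto simp: \<eta>_def)
    define L where "L = 8 * C / (c0 * \<eta>\<^sup>2)"
    define \<epsilon> where "\<epsilon> = exp (- L) / 2"
    have L: "0 < L" using C c0 eta by (simp add: L_def)
    have e: "0 < \<epsilon>" "\<epsilon> < 1 / 2" "ln (1 / (2 * \<epsilon>)) = L"
      using L by (auto simp: \<epsilon>_def ln_div)
    have "eventually (\<lambda>n. mixing_time_cont n (K n) (\<pi> n) \<epsilon> < ereal (4 * (C * th n))) sequentially"
    proof -
      have "eventually (\<lambda>n. mixing_time_cont n (K n) (\<pi> n) (1 / 2) \<le> ereal (C * th n)) sequentially"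
        using eventually_ge_at_top[of 1] by eventually_elim (rule half)
      then show ?thesis
        using has_cutoff_compare[OF cut, of \<epsilon> "1 / 2" "\<lambda>n. C * th n"] e by simp
    qed
    then show "eventually (\<lambda>n. dist (al n / th n) 0 < \<eta>') sequentially"
      using eventually_ge_at_top[of 1]
    proof eventually_elim
      case (elim n)
      obtain s where s: "0 \<le> s" "max_tv_dist n (semigroup_at n (K n) s) (\<pi> n) \<le> \<epsilon>" "s < 4 * (C * th n)"
        using elim(1) unfolding mixing_time_cont_def by (auto simp: INF_less_iff)
      note t = th_al[OF elim(2)]
      have "(al n)\<^sup>2 \<le> 2 * (s / (c0 * L)) * th n"
        using variance_le_of_tv_cont[OF reg[OF elim(2)] c0 mat[OF elim(2)] s(1,2) e(1,2)]
        by (simp add: e(3) th_def al_def)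
      also have "\<dots> \<le> 2 * (4 * (C * th n) / (c0 * L)) * th n"
        using s(3) c0 L t by (intro mult_right_mono mult_left_mono divide_right_mono) auto
      also have "\<dots> = 8 * C / (c0 * L) * (th n)\<^sup>2"
        by (simp add: power2_eq_square)
      also have "8 * C / (c0 * L) = \<eta>\<^sup>2"
        using C c0 eta by (simp add: L_def field_simps)
      finally have "(al n)\<^sup>2 \<le> (\<eta> * th n)\<^sup>2" by (simp add: power_mult_distrib)
      then have "al n \<le> \<eta> * th n" by (rule power2_le_imp_le) (use eta t in simp)
      then have "al n / th n \<le> \<eta>" using t by (subst pos_divide_le_eq) auto
      moreover have "0 \<le> al n / th n" using t by simp
      ultimately show ?case using eta(2) unfolding dist_real_def by linarith
    qed
  qed
qed

context
  fixes t e :: "nat \<Rightarrow> real"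
  assumes t_pos: "\<And>n. 1 \<le> n \<Longrightarrow> 0 < t n"
    and e_lim: "e \<longlonglongrightarrow> 0"
    and th_t: "eventually (\<lambda>n. \<bar>th n - t n\<bar> \<le> e n * t n) sequentially"
    and al_t: "eventually (\<lambda>n. al n \<le> e n * t n) sequentially"
begin

lemma e_small: "0 < x \<Longrightarrow> eventually (\<lambda>n. e n < x) sequentially"
  using order_tendstoD(2)[OF e_lim] .

lemma t_large: "eventually (\<lambda>n. x \<le> t n) sequentially"
  using th_large[of "2 * \<bar>x\<bar>"] th_t e_small[of 1, simplified] eventually_ge_at_top[of 1]
proof eventually_elim
  case (elim n)
  have "e n * t n \<le> 1 * t n" using elim t_pos[of n] by (intro mult_right_mono) auto
  then show ?case using elim by linarith
qed

lemma window:
  assumes "0 < \<kappa>" "0 < A"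
  shows "eventually (\<lambda>n. th n + A * al n \<le> (1 + \<kappa> / 2) * t n \<and> (1 - \<kappa> / 2) * t n \<le> th n - A * al n) sequentially"
proof -
  have "0 < \<kappa> / 2 / (1 + A)" using assms by simp
  from th_t al_t e_small[OF this] eventually_ge_at_top[of 1] show ?thesis
  proof eventually_elim
    case (elim n)
    have tn: "0 < t n" using t_pos elim by simp
    have "e n \<le> \<kappa> / 2 / (1 + A)" using elim(3) assms by simp
    then have "e n * (1 + A) \<le> \<kappa> / 2" using assms by (subst (asm) pos_le_divide_eq) auto
    then have "(1 + A) * e n \<le> \<kappa> / 2" by (simp only: mult.commute)
    then have "(1 + A) * e n * t n \<le> \<kappa> / 2 * t n" using tn by (intro mult_right_mono) auto
    moreover have "A * al n \<le> A * (e n * t n)" using elim assms by (intro mult_left_mono) auto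
    ultimately show ?case using elim(1) by (simp add: algebra_simps abs_le_iff)
  qed
qed

lemma disc_cutoff:
  assumes d: "0 < \<delta>" and holding: "\<And>n i. 1 \<le> n \<Longrightarrow> i \<le> n \<Longrightarrow> p n i + q n i \<le> 1 - \<delta>"
  shows "has_cutoff_time (\<lambda>n. mixing_time_disc n (K n) (\<pi> n)) t"
proof (rule has_cutoff_timeI)
  fix \<epsilon> \<kappa> :: real assume e: "0 < \<epsilon>" "\<epsilon> < 1" "0 < \<kappa>" "\<kappa> < 1"
  obtain A where A: "0 < A"
    and up: "\<And>n p q \<pi> M K m. bd_rates n p q \<pi> \<Longrightarrow> (\<And>i. i \<le> n \<Longrightarrow> p i + q i \<le> 1 - \<delta>) \<Longrightarrow> M \<le> n \<Longrightarrow>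
      bd_matrix n K p q \<Longrightarrow> bd_theta n p q \<pi> M + A * bd_alpha n p q \<pi> M \<le> real m \<Longrightarrow>
      max_tv_dist n (K ^\<^sub>m m) \<pi> \<le> \<epsilon>"
    using tv_disc_upper[OF e(1) d] by blast
  show "eventually (\<lambda>n. mixing_time_disc n (K n) (\<pi> n) \<epsilon> \<le> ereal ((1 + \<kappa>) * t n)) sequentially"
    using window[OF e(3) A] t_large[of "2 / \<kappa>"] eventually_ge_at_top[of 1]
  proof eventually_elim
    case (elim n)
    define m where "m = nat \<lceil>(1 + \<kappa> / 2) * t n\<rceil>"
    have "0 \<le> (1 + \<kappa> / 2) * t n" using e t_pos[of n] elim by simp
    then have m: "(1 + \<kappa> / 2) * t n \<le> real m" "real m \<le> (1 + \<kappa> / 2) * t n + 1"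
      by (auto simp: m_def)
    have "max_tv_dist n (K n ^\<^sub>m m) (\<pi> n) \<le> \<epsilon>"
      using reg[OF elim(3)] mat[OF elim(3)] holding[OF elim(3)] m(1) elim(1)
      by (intro up) (auto simp: cutoff_regular_def th_def al_def)
    then have "mixing_time_disc n (K n) (\<pi> n) \<epsilon> \<le> ereal (real m)"
      unfolding mixing_time_disc_def by (intro INF_lower) auto
    also have "\<dots> \<le> ereal ((1 + \<kappa>) * t n)"
    proof -
      have "1 \<le> \<kappa> / 2 * t n" using elim(2) e by (simp add: pos_divide_le_eq mult.commute)
      then show ?thesis using m(2) by (simp add: algebra_simps)
    qed
    finally show ?case .
  qed
  define \<epsilon>' where "\<epsilon>' = (1 - \<epsilon>) / 2"
  have e': "0 < \<epsilon>'" "\<epsilon> < 1 - \<epsilon>'" using e by (auto simp: \<epsilon>'_def field_simps)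
  obtain A' where A': "0 < A'"
    and lo: "\<And>n p q \<pi> M K m. cutoff_regular n p q \<pi> M c0 \<Longrightarrow> bd_matrix n K p q \<Longrightarrow>
      real m \<le> bd_theta n p q \<pi> M - A' * bd_alpha n p q \<pi> M \<Longrightarrow> \<not> max_tv_dist n (K ^\<^sub>m m) \<pi> < 1 - \<epsilon>'"
    using tv_disc_lower[OF e'(1) c0] by blast
  show "eventually (\<lambda>n. ereal ((1 - \<kappa>) * t n) \<le> mixing_time_disc n (K n) (\<pi> n) \<epsilon>) sequentially"
    using window[OF e(3) A'] eventually_ge_at_top[of 1]
  proof eventually_elim
    case (elim n)
    show ?case unfolding mixing_time_disc_def
    proof (rule INF_greatest, clarify)
      fix m assume m: "max_tv_dist n (K n ^\<^sub>m m) (\<pi> n) \<le> \<epsilon>"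
      have "\<not> real m \<le> th n - A' * al n"
        using lo[OF reg mat, OF elim(2) elim(2), of m] m e'(2) unfolding th_def al_def by linarith
      moreover have "(1 - \<kappa>) * t n \<le> (1 - \<kappa> / 2) * t n"
        using t_pos[OF elim(2)] e by (intro mult_right_mono) auto
      ultimately show "ereal ((1 - \<kappa>) * t n) \<le> ereal (real m)" using elim(1) by simp
    qed
  qed
qed (rule t_pos)

lemma cont_cutoff: "has_cutoff_time (\<lambda>n. mixing_time_cont n (K n) (\<pi> n)) t"
proof (rule has_cutoff_timeI)
  fix \<epsilon> \<kappa> :: real assume e: "0 < \<epsilon>" "\<epsilon> < 1" "0 < \<kappa>" "\<kappa> < 1"
  have e2: "0 < \<epsilon> / 2" using e by simp
  obtain A where A: "0 < A"
    and up: "\<And>n p q \<pi> M K t. bd_rates n p q \<pi> \<Longrightarrow> M \<le> n \<Longrightarrow> bd_matrix n K p q \<Longrightarrow>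
      bd_theta n p q \<pi> M + A * bd_alpha n p q \<pi> M < t \<Longrightarrow>
      max_tv_dist n (semigroup_at n K t) \<pi> \<le>
        \<epsilon> / 2 + t / (2 * (t - bd_theta n p q \<pi> M - A * bd_alpha n p q \<pi> M)\<^sup>2)"
    using tv_cont_upper[OF e2] by blast
  show "eventually (\<lambda>n. mixing_time_cont n (K n) (\<pi> n) \<epsilon> \<le> ereal ((1 + \<kappa>) * t n)) sequentially"
    using window[OF e(3) A] t_large[of "8 / (\<kappa>\<^sup>2 * \<epsilon>)"] eventually_ge_at_top[of 1]
  proof eventually_elim
    case (elim n)
    define s where "s = (1 + \<kappa>) * t n"
    have tn: "0 < t n" using t_pos elim by simp
    have gap: "\<kappa> / 2 * t n \<le> s - th n - A * al n" using elim(1) by (simp add: s_def algebra_simps)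
    have gap0: "0 < \<kappa> / 2 * t n" using e tn by simp
    have "max_tv_dist n (semigroup_at n (K n) s) (\<pi> n) \<le> \<epsilon> / 2 + s / (2 * (s - th n - A * al n)\<^sup>2)"
      unfolding th_def al_def using reg[OF elim(3)] mat[OF elim(3)] gap gap0
      by (intro up) (auto simp: cutoff_regular_def th_def al_def)
    also have "s / (2 * (s - th n - A * al n)\<^sup>2) \<le> (2 * t n) / (2 * (\<kappa> / 2 * t n)\<^sup>2)"
      using gap gap0 e tn by (intro frac_le mult_left_mono power_mono) (auto simp: s_def)
    also have "\<dots> = 4 / (\<kappa>\<^sup>2 * t n)" using tn e by (simp add: power2_eq_square field_simps)
    also have "\<dots> \<le> \<epsilon> / 2"
    proof -
      have "8 \<le> t n * (\<kappa>\<^sup>2 * \<epsilon>)" using elim(2) e by (simp add: pos_divide_le_eq)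
      then show ?thesis using tn e by (simp add: pos_divide_le_eq mult_ac)
    qed
    finally have "max_tv_dist n (semigroup_at n (K n) s) (\<pi> n) \<le> \<epsilon>" by simp
    then have "mixing_time_cont n (K n) (\<pi> n) \<epsilon> \<le> ereal s"
      unfolding mixing_time_cont_def using e tn by (intro INF_lower) (auto simp: s_def)
    then show ?case by (simp add: s_def)
  qed
  define \<epsilon>' where "\<epsilon>' = (1 - \<epsilon>) / 4"
  have e': "0 < \<epsilon>'" "\<epsilon> = 1 - 4 * \<epsilon>'" using e by (auto simp: \<epsilon>'_def field_simps)
  obtain A' where A': "0 < A'"
    and lo: "\<And>n p q \<pi> M K t. cutoff_regular n p q \<pi> M c0 \<Longrightarrow> bd_matrix n K p q \<Longrightarrow> 0 \<le> t \<Longrightarrow>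
      t < bd_theta n p q \<pi> M - A' * bd_alpha n p q \<pi> M \<Longrightarrow>
      1 - \<epsilon>' - t / (bd_theta n p q \<pi> M - A' * bd_alpha n p q \<pi> M - t)\<^sup>2 \<le> max_tv_dist n (semigroup_at n K t) \<pi>"
    using tv_cont_lower[OF e'(1) c0] by blast
  show "eventually (\<lambda>n. ereal ((1 - \<kappa>) * t n) \<le> mixing_time_cont n (K n) (\<pi> n) \<epsilon>) sequentially"
    using window[OF e(3) A'] eventually_ge_at_top[of 1] t_large[of "4 / (\<kappa>\<^sup>2 * \<epsilon>')"]
  proof eventually_elim
    case (elim n)
    have tn: "0 < t n" using t_pos elim by simp
    show ?case unfolding mixing_time_cont_def
    proof (rule INF_greatest, clarify)
      fix s :: real assume s: "0 \<le> s" "max_tv_dist n (semigroup_at n (K n) s) (\<pi> n) \<le> \<epsilon>"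
      have "(1 - \<kappa>) * t n \<le> s"
      proof (rule ccontr)
        assume "\<not> (1 - \<kappa>) * t n \<le> s"
        then have lt: "s < t n - \<kappa> * t n" by (simp add: algebra_simps)
        then have gap: "\<kappa> / 2 * t n \<le> th n - A' * al n - s"
          using elim(1) by (simp add: algebra_simps)
        have st: "s \<le> t n" using lt mult_pos_pos[OF e(3) tn] by linarith
        have gap0: "0 < \<kappa> / 2 * t n" using e tn by simp
        have "1 - \<epsilon>' - s / (th n - A' * al n - s)\<^sup>2 \<le> \<epsilon>"
          using lo[OF reg mat s(1), OF elim(2) elim(2)] gap gap0 s(2) unfolding th_def al_def by linarith
        moreover have "s / (th n - A' * al n - s)\<^sup>2 \<le> t n / (\<kappa> / 2 * t n)\<^sup>2"
          using gap gap0 e tn st s by (intro frac_le power_mono) auto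
        moreover have "t n / (\<kappa> / 2 * t n)\<^sup>2 = 4 / (\<kappa>\<^sup>2 * t n)"
          using tn e by (simp add: power2_eq_square field_simps)
        moreover have "4 / (\<kappa>\<^sup>2 * t n) \<le> \<epsilon>'"
        proof -
          have "4 \<le> t n * (\<kappa>\<^sup>2 * \<epsilon>')" using elim(3) e e'(1) by (simp add: pos_divide_le_eq)
          then show ?thesis using tn e by (simp add: pos_divide_le_eq mult_ac)
        qed
        ultimately show False using e' by linarith
      qed
      then show "ereal ((1 - \<kappa>) * t n) \<le> ereal s" by simp
    qed
  qed
qed (rule t_pos)

end
end

section \<open>Hitting times of the process\<close>

context bd_rates begin

lemma W_ge_h: "M \<le> n \<Longrightarrow> h x M \<le> W x M"
  unfolding mean_hit_def hit_var_def
proof (intro sum_mono)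
  fix i assume "M \<le> n" "i \<in> {x..<M}"
  then have i: "i < n" by auto
  have "a i * 1 \<le> a i * a i" using a_ge_1[OF i] by (intro mult_left_mono) auto
  then show "a i \<le> step_var p \<pi> i" using step_var_ge[OF i] by (simp add: power2_eq_square)
qed

text \<open>
  \<open>R1\<close> and \<open>R2\<close> are the remainders of the series for the first two moments of the discrete hitting time.
  Below \<open>u\<close> they satisfy \<open>R1 (k + 1) = T (R1 k)\<close> and \<open>R2 (k + 1) = T (R2 k + 2 * R1 k)\<close>, which propagates bounds by
  multiples of \<open>survival\<close>.
\<close>
lemma survival_partial_sums:
  assumes u: "u \<le> n"
  defines "H \<equiv> h 0 u" and "S0 \<equiv> W 0 u + (h 0 u)\<^sup>2"
  defines "R1 \<equiv> \<lambda>k x. h x u - (\<Sum>m<k. survival p q u m x)"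
    and "R2 \<equiv> \<lambda>k x. W x u + (h x u)\<^sup>2 - h x u - (\<Sum>m<k. real (2 * m + 1) * survival p q u m x)"
  assumes x: "x \<le> u"
  shows "0 \<le> R1 k x" "R1 k x \<le> H * survival p q u k x"
    "0 \<le> R2 k x" "R2 k x \<le> (S0 + 2 * real k * H) * survival p q u k x"
proof -
  have "(0 \<le> R1 k x \<and> R1 k x \<le> H * survival p q u k x) \<and>
     (0 \<le> R2 k x \<and> R2 k x \<le> (S0 + 2 * real k * H) * survival p q u k x)"
    using x
  proof (induction k arbitrary: x)
    case 0
    have 1: "0 \<le> h x u" "h x u \<le> H" "h x u \<le> W x u" "W x u \<le> W 0 u"
      using h_nonneg[OF u] h_antimono[OF u] W_ge_h[OF u] W_antimono[OF u] by (auto simp: H_def)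
    have "(h x u)\<^sup>2 \<le> H\<^sup>2" using 1 by (intro power_mono)
    then have "W x u + (h x u)\<^sup>2 - h x u \<le> S0" using 1 unfolding S0_def H_def by linarith
    moreover have "0 \<le> W x u + (h x u)\<^sup>2 - h x u" using 1 zero_le_power2[of "h x u"] by linarith
    ultimately show ?case using 1 by (auto simp: R1_def R2_def)
  next
    case (Suc k)
    show ?case
    proof (cases "x = u")
      case True
      then show ?thesis by (simp add: R1_def R2_def)
    next
      case False
      then have xu: "x < u" using Suc.prems by simp
      have xn: "x < n" using xu u by simp
      have T_sum: "T (\<lambda>y. \<Sum>m<k. w m * survival p q u m y) x = (\<Sum>m<k. w m * T (survival p q u m) x)" for w
        by (induction k) (simp_all add: bdop_add bdop_cmult)
      have s0: "survival p q u 0 x = 1" using False by simp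
      have sS: "survival p q u (Suc m) x = T (survival p q u m) x" for m using False by simp
      have TR1: "R1 (Suc k) x = T (R1 k) x"
        unfolding R1_def bdop_diff poisson_mean[OF xu u]
        using T_sum[of "\<lambda>_. 1"] by (simp add: sum.lessThan_Suc_shift s0 sS del: survival.simps sum.lessThan_Suc)
      have TR2: "R2 (Suc k) x = T (\<lambda>y. R2 k y + 2 * R1 k y) x"
      proof -
        have "T (\<lambda>y. \<Sum>m<k. survival p q u m y) x = (\<Sum>m<k. survival p q u (Suc m) x)"
          using T_sum[of "\<lambda>_. 1"] by (simp add: sS del: survival.simps)
        then have "T (R1 k) x = h x u - 1 - (\<Sum>m<k. survival p q u (Suc m) x)"
          unfolding R1_def bdop_diff poisson_mean[OF xu u] by simp
        moreover have "T (R2 k) x = (W x u + (h x u)\<^sup>2 - 2 * h x u) - (h x u - 1) - (\<Sum>m<k. real (2 * m + 1) * survival p q u (Suc m) x)"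
          unfolding R2_def bdop_diff poisson_mean[OF xu u] poisson_second_moment[OF xu u] T_sum sS ..
        moreover have "(\<Sum>m<Suc k. real (2 * m + 1) * survival p q u m x) =
            1 + (\<Sum>m<k. real (2 * m + 1) * survival p q u (Suc m) x) + 2 * (\<Sum>m<k. survival p q u (Suc m) x)"
          unfolding sum.lessThan_Suc_shift s0
          by (simp add: sum.distrib[symmetric] sum_distrib_left algebra_simps del: survival.simps sum.lessThan_Suc)
        ultimately show ?thesis
          unfolding bdop_add bdop_cmult by (simp add: R2_def del: sum.lessThan_Suc survival.simps)
      qed
      have IH: "0 \<le> R1 k y" "R1 k y \<le> H * survival p q u k y"
        "0 \<le> R2 k y" "R2 k y \<le> (S0 + 2 * real k * H) * survival p q u k y" if "y \<le> u" for y
        using Suc.IH[OF that] by auto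
      have "T (\<lambda>_. 0) x \<le> T (R1 k) x" "T (R1 k) x \<le> T (\<lambda>y. H * survival p q u k y) x"
        using xu by (auto intro!: bdop_mono_nbr IH xn simp del: bdop_const)
      then have a1: "0 \<le> R1 (Suc k) x" "R1 (Suc k) x \<le> H * survival p q u (Suc k) x"
        unfolding TR1 sS by (simp_all add: bdop_cmult)
      have "T (\<lambda>_. 0) x \<le> T (\<lambda>y. R2 k y + 2 * R1 k y) x"
        using xu by (intro bdop_mono_nbr xn) (auto intro!: add_nonneg_nonneg IH)
      then have a2: "0 \<le> R2 (Suc k) x" unfolding TR2 by simp
      have le: "R2 k y + 2 * R1 k y \<le> (S0 + 2 * real (Suc k) * H) * survival p q u k y" if "y \<le> u" for y
        using IH(2,4)[OF that] by (simp add: algebra_simps)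
      have "T (\<lambda>y. R2 k y + 2 * R1 k y) x \<le> T (\<lambda>y. (S0 + 2 * real (Suc k) * H) * survival p q u k y) x"
        using xu by (intro bdop_mono_nbr xn le) auto
      then have a3: "R2 (Suc k) x \<le> (S0 + 2 * real (Suc k) * H) * survival p q u (Suc k) x"
        unfolding TR2 sS by (simp only: bdop_cmult)
      show ?thesis using a1 a2 a3 by blast
    qed
  qed
  then show "0 \<le> R1 k x" "R1 k x \<le> H * survival p q u k x"
    "0 \<le> R2 k x" "R2 k x \<le> (S0 + 2 * real k * H) * survival p q u k x" by auto
qed

lemma survival_decay:
  assumes "x \<le> u" "u \<le> n" "0 < k"
  shows "survival p q u k x \<le> (W 0 u + (h 0 u)\<^sup>2) / (real k)\<^sup>2"
proof -
  have "survival p q u k x * (real k - 0)\<^sup>2 \<le> W x u + (h x u - 0)\<^sup>2"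
    by (rule survival_chebyshev_upper) (use assms in auto)
  also have "\<dots> \<le> W 0 u + (h 0 u)\<^sup>2"
    using W_antimono[of u x] h_antimono[of u x] h_nonneg[of u x] assms by (auto intro!: add_mono power_mono)
  finally show ?thesis using assms(3) by (simp add: pos_le_divide_eq)
qed

lemma survival_tendsto_0:
  assumes "x \<le> u" "u \<le> n"
  shows "(\<lambda>k. (b + d * real k) * survival p q u k x) \<longlonglongrightarrow> 0"
proof (rule Lim_null_comparison)
  define D where "D = W 0 u + (h 0 u)\<^sup>2"
  have D: "0 \<le> D" using W_nonneg[OF assms(2), of 0] by (simp add: D_def)
  show "eventually (\<lambda>k. norm ((b + d * real k) * survival p q u k x) \<le> (\<bar>b\<bar> + \<bar>d\<bar>) * D * inverse (real k)) sequentially"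
    using eventually_gt_at_top[of 0]
  proof eventually_elim
    case (elim k)
    have s: "0 \<le> survival p q u k x" "survival p q u k x \<le> D / (real k)\<^sup>2"
      using survival_bounds[of x u k] survival_decay[OF assms elim] assms by (auto simp: D_def)
    have "\<bar>b\<bar> * 1 \<le> \<bar>b\<bar> * real k" using elim by (intro mult_left_mono) auto
    then have "\<bar>b + d * real k\<bar> \<le> (\<bar>b\<bar> + \<bar>d\<bar>) * real k"
      using abs_triangle_ineq[of b "d * real k"] by (simp add: abs_mult algebra_simps)
    then have "\<bar>b + d * real k\<bar> * survival p q u k x \<le> ((\<bar>b\<bar> + \<bar>d\<bar>) * real k) * (D / (real k)\<^sup>2)"
      using s by (intro mult_mono) auto
    also have "\<dots> = (\<bar>b\<bar> + \<bar>d\<bar>) * D * inverse (real k)"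
      using elim by (simp add: power2_eq_square field_simps)
    finally show ?case using s by (simp add: abs_mult)
  qed
  show "(\<lambda>k. (\<bar>b\<bar> + \<bar>d\<bar>) * D * inverse (real k)) \<longlonglongrightarrow> 0"
    using tendsto_mult[OF tendsto_const lim_inverse_n, of "(\<bar>b\<bar> + \<bar>d\<bar>) * D"] by simp
qed

lemma survival_sums_mean:
  assumes "x \<le> u" "u \<le> n"
  shows "(\<lambda>m. survival p q u m x) sums h x u"
proof -
  have "(\<lambda>k. h x u - (\<Sum>m<k. survival p q u m x)) \<longlonglongrightarrow> 0"
  proof (rule tendsto_sandwich[OF _ _ tendsto_const])
    show "(\<lambda>k. (h 0 u + 0 * real k) * survival p q u k x) \<longlonglongrightarrow> 0" by (rule survival_tendsto_0[OF assms])
  qed (use survival_partial_sums[OF assms(2,1)] in auto)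
  then have "(\<lambda>k. h x u - (h x u - (\<Sum>m<k. survival p q u m x))) \<longlonglongrightarrow> h x u - 0"
    by (intro tendsto_diff tendsto_const)
  then show ?thesis by (simp add: sums_def)
qed

lemma survival_sums_second_moment:
  assumes "x \<le> u" "u \<le> n"
  shows "(\<lambda>m. real (2 * m + 1) * survival p q u m x) sums (W x u + (h x u)\<^sup>2 - h x u)"
proof -
  define S where "S = W x u + (h x u)\<^sup>2 - h x u"
  have "(\<lambda>k. S - (\<Sum>m<k. real (2 * m + 1) * survival p q u m x)) \<longlonglongrightarrow> 0"
  proof (rule tendsto_sandwich[OF _ _ tendsto_const])
    show "(\<lambda>k. (W 0 u + (h 0 u)\<^sup>2 + (2 * h 0 u) * real k) * survival p q u k x) \<longlonglongrightarrow> 0" by (rule survival_tendsto_0[OF assms])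
    show "eventually (\<lambda>k. S - (\<Sum>m<k. real (2 * m + 1) * survival p q u m x) \<le> (W 0 u + (h 0 u)\<^sup>2 + (2 * h 0 u) * real k) * survival p q u k x) sequentially"
    proof (rule always_eventually, rule allI)
      fix k
      show "S - (\<Sum>m<k. real (2 * m + 1) * survival p q u m x) \<le> (W 0 u + (h 0 u)\<^sup>2 + (2 * h 0 u) * real k) * survival p q u k x"
        using survival_partial_sums(4)[OF assms(2,1), of k] unfolding S_def by (simp add: mult_ac)
    qed
    show "eventually (\<lambda>k. 0 \<le> S - (\<Sum>m<k. real (2 * m + 1) * survival p q u m x)) sequentially"
      using survival_partial_sums(3)[OF assms(2,1)] unfolding S_def by (intro always_eventually) auto
  qed
  then have "(\<lambda>k. S - (S - (\<Sum>m<k. real (2 * m + 1) * survival p q u m x))) \<longlonglongrightarrow> S - 0"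
    by (intro tendsto_diff tendsto_const)
  then show ?thesis by (simp add: sums_def S_def)
qed

end

lemma sum_PiE_insert:
  fixes g :: "('a \<Rightarrow> 'b) \<Rightarrow> real"
  assumes "i \<notin> I"
  shows "(\<Sum>x\<in>PiE (insert i I) (\<lambda>_. A). g x) = (\<Sum>x\<in>PiE I (\<lambda>_. A). \<Sum>y\<in>A. g (x(i := y)))"
proof -
  have inj: "inj_on (\<lambda>(y, x). x(i := y)) (A \<times> PiE I (\<lambda>_. A))"
    using inj_combinator[OF assms, of "\<lambda>_. A"] by simp
  have "(\<Sum>x\<in>PiE (insert i I) (\<lambda>_. A). g x) =
      (\<Sum>z\<in>A \<times> PiE I (\<lambda>_. A). g ((\<lambda>(y, x). x(i := y)) z))"
    unfolding PiE_insert_eq by (subst sum.reindex[OF inj]) simp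
  also have "\<dots> = (\<Sum>y\<in>A. \<Sum>x\<in>PiE I (\<lambda>_. A). g (x(i := y)))"
    by (simp add: sum.cartesian_product case_prod_beta)
  also have "\<dots> = (\<Sum>x\<in>PiE I (\<lambda>_. A). \<Sum>y\<in>A. g (x(i := y)))" by (rule sum.swap)
  finally show ?thesis .
qed

text \<open>
  Summing the weights of all paths that avoid \<open>u\<close> amounts to iterating the operator killed at \<open>u\<close>.  The test function
  \<open>f\<close> of the last state makes the induction possible: summing out the last step replaces \<open>f\<close> by its killed image.
\<close>
lemma path_sum:
  assumes K: "bd_matrix n K p q" and j: "j \<le> n"
  shows "(\<Sum>x\<in>PiE {..m} (\<lambda>_. {..n}). (if x 0 = j then \<Prod>k<m. K $$ (x k, x (Suc k)) else 0) *
            of_bool (\<forall>k\<le>m. x k \<noteq> u) * f (x m)) =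
     ((\<lambda>g x. if x = u then 0 else bdop p q g x) ^^ m) (\<lambda>y. if y = u then 0 else f y) j"
proof (induction m arbitrary: f)
  case 0
  define g where "g = (\<lambda>x :: nat \<Rightarrow> nat. (if x 0 = j then \<Prod>k<0. K $$ (x k, x (Suc k)) else 0) *
            of_bool (\<forall>k\<le>0. x k \<noteq> u) * f (x 0))"
  have "(\<Sum>x\<in>PiE {..0} (\<lambda>_. {..n}). g x) = (\<Sum>x\<in>PiE {} (\<lambda>_. {..n}). \<Sum>y\<le>n. g (x(0 := y)))"
    using sum_PiE_insert[where i = 0 and I = "{}" and g = g and A = "{..n}"] by simp
  also have "\<dots> = (\<Sum>y\<le>n. g ((\<lambda>_. undefined)(0 := y)))" by (simp add: PiE_empty_domain fun_upd_def)
  also have "\<dots> = (\<Sum>y\<le>n. (if y = j then 1 else 0) * of_bool (y \<noteq> u) * f y)" by (simp add: g_def cong: if_cong)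
  also have "\<dots> = (\<Sum>y\<le>n. if y = j then of_bool (j \<noteq> u) * f j else 0)" by (intro sum.cong) auto
  also have "\<dots> = (if j = u then 0 else f j)" using j by simp
  finally show ?case by (simp add: g_def)
next
  case (Suc m)
  define G where "G = (\<lambda>g x. if x = u then 0 else bdop p q g x)"
  define f' where "f' = (\<lambda>y. if y = u then 0 else f y)"
  define w where "w = (\<lambda>m x. if x 0 = j then \<Prod>k<m. K $$ (x k, x (Suc k)) else 0)"
  have "(\<Sum>x\<in>PiE {..Suc m} (\<lambda>_. {..n}). w (Suc m) x * of_bool (\<forall>k\<le>Suc m. x k \<noteq> u) * f (x (Suc m))) =
      (\<Sum>x\<in>PiE {..m} (\<lambda>_. {..n}). \<Sum>y\<le>n. w (Suc m) (x(Suc m := y)) * of_bool (\<forall>k\<le>Suc m. (x(Suc m := y)) k \<noteq> u) * f y)"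
    unfolding atMost_Suc by (subst sum_PiE_insert) simp_all
  also have "\<dots> = (\<Sum>x\<in>PiE {..m} (\<lambda>_. {..n}). w m x * of_bool (\<forall>k\<le>m. x k \<noteq> u) * bdop p q f' (x m))"
  proof (intro sum.cong refl)
    fix x assume "x \<in> PiE {..m} (\<lambda>_. {..n})"
    then have xm: "x m \<le> n" by auto
    have "(\<Sum>y\<le>n. w (Suc m) (x(Suc m := y)) * of_bool (\<forall>k\<le>Suc m. (x(Suc m := y)) k \<noteq> u) * f y) =
        (\<Sum>y\<le>n. w m x * of_bool (\<forall>k\<le>m. x k \<noteq> u) * (K $$ (x m, y) * f' y))"
    proof (intro sum.cong refl)
      fix y
      have "(\<Prod>k<m. K $$ ((x(Suc m := y)) k, (x(Suc m := y)) (Suc k))) = (\<Prod>k<m. K $$ (x k, x (Suc k)))"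
        by (intro prod.cong) auto
      then have "w (Suc m) (x(Suc m := y)) = w m x * K $$ (x m, y)" by (simp add: w_def)
      moreover have "(\<forall>k\<le>Suc m. (x(Suc m := y)) k \<noteq> u) \<longleftrightarrow> (\<forall>k\<le>m. x k \<noteq> u) \<and> y \<noteq> u"
        by (auto simp: le_Suc_eq)
      ultimately show "w (Suc m) (x(Suc m := y)) * of_bool (\<forall>k\<le>Suc m. (x(Suc m := y)) k \<noteq> u) * f y =
          w m x * of_bool (\<forall>k\<le>m. x k \<noteq> u) * (K $$ (x m, y) * f' y)" by (simp add: f'_def)
    qed
    also have "\<dots> = w m x * of_bool (\<forall>k\<le>m. x k \<noteq> u) * bdop p q f' (x m)"
      by (simp only: sum_distrib_left[symmetric] bd_matrix_row[OF K xm])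
    finally show "(\<Sum>y\<le>n. w (Suc m) (x(Suc m := y)) * of_bool (\<forall>k\<le>Suc m. (x(Suc m := y)) k \<noteq> u) * f y) =
        w m x * of_bool (\<forall>k\<le>m. x k \<noteq> u) * bdop p q f' (x m)" .
  qed
  also have "\<dots> = (G ^^ m) (\<lambda>y. if y = u then 0 else bdop p q f' y) j"
    unfolding w_def G_def by (rule Suc.IH)
  also have "\<dots> = (G ^^ Suc m) f' j" by (simp add: funpow_swap1) (simp add: G_def)
  finally show ?case by (simp only: w_def G_def f'_def)
qed

lemma survival_funpow: "survival p q u m = ((\<lambda>g x. if x = u then 0 else bdop p q g x) ^^ m) (\<lambda>y. if y = u then 0 else 1)"
proof (induction m)
  case 0
  show ?case by (auto simp: fun_eq_iff)
next
  case (Suc m)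
  show ?case unfolding survival.simps Suc.IH by simp
qed

lemma markov_chain_avoid:
  assumes K: "bd_matrix n K p q" and j: "j \<le> n" and X: "markov_chain Q n K j X"
  shows "measure Q {\<omega>\<in>space Q. \<forall>k\<le>m. X k \<omega> \<noteq> u} = survival p q u m j"
proof -
  interpret prob_space Q using X by (simp add: markov_chain_def)
  have Xm[measurable]: "\<And>m. X m \<in> measurable Q (count_space UNIV)" and Xn: "\<And>m \<omega>. \<omega> \<in> space Q \<Longrightarrow> X m \<omega> \<le> n"
    and fdd: "\<And>m x. \<forall>k\<le>m. x k \<le> n \<Longrightarrow> prob {\<omega> \<in> space Q. \<forall>k\<le>m. X k \<omega> = x k} =
        (if x 0 = j then \<Prod>k<m. K $$ (x k, x (Suc k)) else 0)"
    using X by (auto simp: markov_chain_def)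
  define Pth where "Pth = {x \<in> PiE {..m} (\<lambda>_. {..n}). \<forall>k\<le>m. x k \<noteq> u}"
  define Ev where "Ev = (\<lambda>x. {\<omega> \<in> space Q. \<forall>k\<le>m. X k \<omega> = x k})"
  have fin: "finite (PiE {..m} (\<lambda>_. {..n}))" by (intro finite_PiE) auto
  have "{\<omega>\<in>space Q. \<forall>k\<le>m. X k \<omega> \<noteq> u} = (\<Union>x\<in>Pth. Ev x)"
  proof (intro equalityI subsetI)
    fix \<omega> assume "\<omega> \<in> {\<omega>\<in>space Q. \<forall>k\<le>m. X k \<omega> \<noteq> u}"
    then have "(\<lambda>k\<in>{..m}. X k \<omega>) \<in> Pth" "\<omega> \<in> Ev (\<lambda>k\<in>{..m}. X k \<omega>)"
      using Xn by (auto simp: Pth_def Ev_def)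
    then show "\<omega> \<in> (\<Union>x\<in>Pth. Ev x)" by blast
  qed (auto simp: Pth_def Ev_def)
  also have "prob \<dots> = (\<Sum>x\<in>Pth. prob (Ev x))"
  proof (rule finite_measure_finite_Union)
    show "finite Pth" using fin by (simp add: Pth_def)
    have "Ev x \<in> events" for x unfolding Ev_def by measurable
    then show "Ev ` Pth \<subseteq> events" by blast
    show "disjoint_family_on Ev Pth"
      unfolding disjoint_family_on_def
    proof (intro ballI impI)
      fix x y assume xy: "x \<in> Pth" "y \<in> Pth" "x \<noteq> y"
      then obtain k where "x k \<noteq> y k" by blast
      moreover have "k \<le> m" using xy calculation by (auto simp: Pth_def PiE_def extensional_def)
      ultimately show "Ev x \<inter> Ev y = {}" by (auto simp: Ev_def)
    qed
  qed
  also have "\<dots> = (\<Sum>x\<in>Pth. (if x 0 = j then \<Prod>k<m. K $$ (x k, x (Suc k)) else 0))"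
    unfolding Ev_def by (intro sum.cong refl fdd) (auto simp: Pth_def)
  also have "\<dots> = (\<Sum>x\<in>PiE {..m} (\<lambda>_. {..n}). (if x 0 = j then \<Prod>k<m. K $$ (x k, x (Suc k)) else 0) *
            of_bool (\<forall>k\<le>m. x k \<noteq> u) * 1)"
    using fin by (intro sum.mono_neutral_cong_left) (auto simp: Pth_def)
  also have "\<dots> = survival p q u m j"
    unfolding survival_funpow using path_sum[OF K j, of m u "\<lambda>_. 1"] by simp
  finally show ?thesis .
qed

lemma hit_disc_eq:
  "real_of_ereal (hit_disc X u \<omega>) = real (if \<exists>m. X m \<omega> = u then LEAST m. X m \<omega> = u else 0)"
proof (cases "\<exists>m. X m \<omega> = u")
  case True
  define N where "N = (LEAST m. X m \<omega> = u)"
  have N: "X N \<omega> = u" "\<And>m. X m \<omega> = u \<Longrightarrow> N \<le> m"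
    unfolding N_def using True by (auto intro: LeastI_ex Least_le)
  have "hit_disc X u \<omega> = ereal (real N)"
    unfolding hit_disc_def
  proof (rule antisym)
    show "(INF m\<in>{m. X m \<omega> = u}. ereal (real m)) \<le> ereal (real N)"
      using N by (intro INF_lower) auto
    show "ereal (real N) \<le> (INF m\<in>{m. X m \<omega> = u}. ereal (real m))"
      using N by (intro INF_greatest) auto
  qed
  then show ?thesis using True by (simp add: N_def)
qed (auto simp: hit_disc_def top_ereal_def)

lemma poisson_count_eq:
  assumes S: "\<And>k. 0 < S k \<omega>" and m: "(\<Sum>k<m. S k \<omega>) \<le> t" "t < (\<Sum>k<Suc m. S k \<omega>)"
  shows "poisson_count S t \<omega> = m"
proof -
  have mono: "i \<le> j \<Longrightarrow> (\<Sum>k<i. S k \<omega>) \<le> (\<Sum>k<j. S k \<omega>)" for i j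
    using S by (intro sum_mono2) (auto intro: less_imp_le)
  have "{i. 1 \<le> i \<and> (\<Sum>k<i. S k \<omega>) \<le> t} = {1..m}"
  proof (intro equalityI subsetI)
    fix i assume i: "i \<in> {i. 1 \<le> i \<and> (\<Sum>k<i. S k \<omega>) \<le> t}"
    then have "\<not> Suc m \<le> i" using mono[of "Suc m" i] m by auto
    then show "i \<in> {1..m}" using i by auto
  next
    fix i assume "i \<in> {1..m}"
    then show "i \<in> {i. 1 \<le> i \<and> (\<Sum>k<i. S k \<omega>) \<le> t}" using mono[of i m] m by auto
  qed
  then show ?thesis by (simp add: poisson_count_def)
qed

text \<open>
  The clock \<open>N\<^sub>t\<close> equals \<open>m\<close> exactly between the \<open>m\<close>-th and the \<open>(m + 1)\<close>-st arrival, so \<open>u\<close> is first hit at the \<open>N\<close>-th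
  arrival if the discrete chain first hits it at step \<open>N\<close>.  On paths that never hit \<open>u\<close> both sides are \<open>0\<close>: the
  hitting time is \<open>\<infinity>\<close>, which \<open>real_of_ereal\<close> sends to \<open>0\<close>.
\<close>
lemma hit_cont_eq:
  assumes S: "\<And>k. 0 < S k \<omega>" and lim: "filterlim (\<lambda>m. \<Sum>k<m. S k \<omega>) at_top sequentially"
  shows "real_of_ereal (hit_cont X S u \<omega>) =
     (\<Sum>k<(if \<exists>m. X m \<omega> = u then LEAST m. X m \<omega> = u else 0). S k \<omega>)"
proof -
  have mono: "i \<le> j \<Longrightarrow> (\<Sum>k<i. S k \<omega>) \<le> (\<Sum>k<j. S k \<omega>)" for i j
    using S by (intro sum_mono2) (auto intro: less_imp_le)
  have ex: "\<exists>m. (\<Sum>k<m. S k \<omega>) \<le> t \<and> t < (\<Sum>k<Suc m. S k \<omega>)" if "0 \<le> t" for t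
  proof -
    have "eventually (\<lambda>m. t < (\<Sum>k<m. S k \<omega>)) sequentially"
      using lim by (simp add: filterlim_at_top_dense)
    then have e: "\<exists>m. t < (\<Sum>k<m. S k \<omega>)" by (auto simp: eventually_sequentially)
    define l where "l = (LEAST m. t < (\<Sum>k<m. S k \<omega>))"
    have l: "t < (\<Sum>k<l. S k \<omega>)" unfolding l_def by (rule LeastI_ex[OF e])
    then have "l \<noteq> 0" using that by (intro notI) simp
    then obtain m where m: "l = Suc m" by (cases l) auto
    then have "\<not> t < (\<Sum>k<m. S k \<omega>)" using not_less_Least[of m "\<lambda>m. t < (\<Sum>k<m. S k \<omega>)"] by (simp add: l_def)
    then show ?thesis using l m by (intro exI[of _ m]) auto
  qed
  show ?thesis
  proof (cases "\<exists>m. X m \<omega> = u")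
    case True
    define N where "N = (LEAST m. X m \<omega> = u)"
    have N: "X N \<omega> = u" "\<And>m. X m \<omega> = u \<Longrightarrow> N \<le> m"
      unfolding N_def using True by (auto intro: LeastI_ex Least_le)
    have "hit_cont X S u \<omega> = ereal (\<Sum>k<N. S k \<omega>)"
      unfolding hit_cont_def
    proof (rule antisym)
      have "poisson_count S (\<Sum>k<N. S k \<omega>) \<omega> = N" using S by (intro poisson_count_eq) auto
      then show "(INF t\<in>{t. 0 \<le> t \<and> X (poisson_count S t \<omega>) \<omega> = u}. ereal t) \<le> ereal (\<Sum>k<N. S k \<omega>)"
        using N by (intro INF_lower) (auto intro!: sum_nonneg order.strict_implies_order[OF S])
      show "ereal (\<Sum>k<N. S k \<omega>) \<le> (INF t\<in>{t. 0 \<le> t \<and> X (poisson_count S t \<omega>) \<omega> = u}. ereal t)"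
      proof (rule INF_greatest, clarify)
        fix t assume t: "0 \<le> t" "u = X (poisson_count S t \<omega>) \<omega>"
        obtain m where m: "(\<Sum>k<m. S k \<omega>) \<le> t" "t < (\<Sum>k<Suc m. S k \<omega>)" using ex[OF t(1)] by blast
        then have "poisson_count S t \<omega> = m" using S by (intro poisson_count_eq)
        then have "N \<le> m" using N t by auto
        then show "ereal (\<Sum>k<N. S k \<omega>) \<le> ereal t"
          using mono[of N m] m by auto
      qed
    qed
    then show ?thesis using True by (simp add: N_def)
  next
    case False
    then have "hit_cont X S u \<omega> = \<infinity>" by (auto simp: hit_cont_def top_ereal_def)
    then show ?thesis using False by auto
  qed
qed

lemma (in prob_space) pair_moment:
  fixes Z :: "'i \<Rightarrow> 'a \<Rightarrow> real"
  assumes ind: "indep_vars (\<lambda>_. borel) Z I" and il: "i \<in> I" "l \<in> I"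
    and int: "\<And>i. i \<in> I \<Longrightarrow> integrable M (Z i)" "\<And>i. i \<in> I \<Longrightarrow> integrable M (\<lambda>\<omega>. (Z i \<omega>)\<^sup>2)"
    and m: "\<And>i. i \<in> I \<Longrightarrow> expectation (Z i) = \<mu>" "\<And>i. i \<in> I \<Longrightarrow> expectation (\<lambda>\<omega>. (Z i \<omega>)\<^sup>2) = s"
  shows "integrable M (\<lambda>\<omega>. Z i \<omega> * Z l \<omega>)"
    and "expectation (\<lambda>\<omega>. Z i \<omega> * Z l \<omega>) = (if i = l then s else \<mu>\<^sup>2)"
proof -
  have "integrable M (\<lambda>\<omega>. Z i \<omega> * Z l \<omega>) \<and> expectation (\<lambda>\<omega>. Z i \<omega> * Z l \<omega>) = (if i = l then s else \<mu>\<^sup>2)"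
  proof (cases "i = l")
    case True
    then show ?thesis using int(2)[OF il(1)] m(2)[OF il(1)] by (simp add: power2_eq_square)
  next
    case False
    have iv: "indep_vars (\<lambda>_. borel) Z {i, l}"
      by (rule indep_vars_subset[OF ind]) (use il in auto)
    have int_il: "\<And>k. k \<in> {i, l} \<Longrightarrow> integrable M (Z k)" using int(1) il by auto
    show ?thesis
      using indep_vars_integrable[OF _ iv int_il] indep_vars_lebesgue_integral[OF _ iv int_il] m(1) il False
      by (simp add: power2_eq_square)
  qed
  then show "integrable M (\<lambda>\<omega>. Z i \<omega> * Z l \<omega>)"
    "expectation (\<lambda>\<omega>. Z i \<omega> * Z l \<omega>) = (if i = l then s else \<mu>\<^sup>2)" by auto
qed

lemma (in prob_space) nat_moments:
  fixes N :: "'a \<Rightarrow> nat"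
  assumes N: "N \<in> measurable M (count_space UNIV)"
    and s1: "(\<lambda>m. prob {\<omega>\<in>space M. m < N \<omega>}) sums e1"
    and s2: "(\<lambda>m. real (2 * m + 1) * prob {\<omega>\<in>space M. m < N \<omega>}) sums e2"
  shows "has_bochner_integral M (\<lambda>\<omega>. real (N \<omega>)) e1"
    and "has_bochner_integral M (\<lambda>\<omega>. (real (N \<omega>))\<^sup>2) e2"
proof -
  note N[measurable]
  have meas[measurable]: "{\<omega>\<in>space M. m < N \<omega>} \<in> events" for m by measurable
  have N': "(\<lambda>\<omega>. real (N \<omega>)) \<in> borel_measurable M" using N by measurable
  have main: "has_bochner_integral M (\<lambda>\<omega>. \<Sum>m<N \<omega>. w m) e"
    if w: "\<And>m. 0 \<le> (w m :: real)" and s: "(\<lambda>m. w m * prob {\<omega>\<in>space M. m < N \<omega>}) sums e" for w e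
  proof (rule has_bochner_integral_nn_integral)
    show "(\<lambda>\<omega>. \<Sum>m<N \<omega>. w m) \<in> borel_measurable M"
      using measurable_compose[OF N, of "\<lambda>k. \<Sum>m<k. w m" borel] by simp
    show "AE \<omega> in M. 0 \<le> (\<Sum>m<N \<omega>. w m)" using w by (auto intro: sum_nonneg)
    show "0 \<le> e" using s w sums_le[OF _ sums_zero s] by simp
    have "(\<integral>\<^sup>+ \<omega>. ennreal (\<Sum>m<N \<omega>. w m) \<partial>M) = (\<integral>\<^sup>+ \<omega>. (\<Sum>m. ennreal (w m) * indicator {\<omega>\<in>space M. m < N \<omega>} \<omega>) \<partial>M)"
    proof (rule nn_integral_cong)
      fix \<omega> assume "\<omega> \<in> space M"
      then have "(\<Sum>m. ennreal (w m) * indicator {\<omega>\<in>space M. m < N \<omega>} \<omega>) = (\<Sum>m<N \<omega>. ennreal (w m) * indicator {\<omega>\<in>space M. m < N \<omega>} \<omega>)"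
        by (intro suminf_finite) auto
      also have "\<dots> = (\<Sum>m<N \<omega>. ennreal (w m))" using \<open>\<omega> \<in> space M\<close> by (intro sum.cong) auto
      finally show "ennreal (\<Sum>m<N \<omega>. w m) = (\<Sum>m. ennreal (w m) * indicator {\<omega>\<in>space M. m < N \<omega>} \<omega>)"
        using w by (simp add: sum_ennreal)
    qed
    also have "\<dots> = (\<Sum>m. \<integral>\<^sup>+ \<omega>. ennreal (w m) * indicator {\<omega>\<in>space M. m < N \<omega>} \<omega> \<partial>M)"
      by (intro nn_integral_suminf) simp
    also have "\<dots> = (\<Sum>m. ennreal (w m * prob {\<omega>\<in>space M. m < N \<omega>}))"
      using meas w by (intro suminf_cong) (simp add: nn_integral_cmult_indicator emeasure_eq_measure ennreal_mult)
    also have "\<dots> = ennreal e"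
      using s w by (intro suminf_ennreal_eq) auto
    finally show "(\<integral>\<^sup>+ \<omega>. ennreal (\<Sum>m<N \<omega>. w m) \<partial>M) = ennreal e" .
  qed
  show "has_bochner_integral M (\<lambda>\<omega>. real (N \<omega>)) e1"
    using main[of "\<lambda>_. 1" e1] s1 by simp
  have sq: "(\<Sum>m<k. real (2 * m + 1)) = (real k)\<^sup>2" for k
    by (induction k) (auto simp: power2_eq_square algebra_simps)
  show "has_bochner_integral M (\<lambda>\<omega>. (real (N \<omega>))\<^sup>2) e2"
    using main[of "\<lambda>m. real (2 * m + 1)" e2] s2 by (simp only: sq)
qed

text \<open>
  Wald's identity: an independent random index may be conditioned upon.
\<close>
lemma (in prob_space) random_sum_moments:
  fixes N :: "'a \<Rightarrow> nat" and S :: "nat \<Rightarrow> 'a \<Rightarrow> real"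
  assumes N: "N \<in> measurable M (count_space UNIV)"
    and Y: "\<And>m. indep_var borel (\<lambda>\<omega>. of_bool (N \<omega> = m) :: real) borel (Y m)"
    and Y0: "\<And>m \<omega>. \<omega> \<in> space M \<Longrightarrow> 0 \<le> Y m \<omega>"
    and Yint: "\<And>m. integrable M (Y m)" and Yexp: "\<And>m. expectation (Y m) = y m"
    and int: "has_bochner_integral M (\<lambda>\<omega>. y (N \<omega>)) e"
  shows "has_bochner_integral M (\<lambda>\<omega>. Y (N \<omega>) \<omega>) e"
proof -
  have meas: "{\<omega>\<in>space M. N \<omega> = m} \<in> events" for m using N by measurable
  have Ym[measurable]: "Y m \<in> borel_measurable M" for m using Yint by auto
  have y0: "0 \<le> y m" for m unfolding Yexp[symmetric] by (intro Bochner_Integration.integral_nonneg Y0)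
  have split: "(\<integral>\<^sup>+ \<omega>. ennreal (G (N \<omega>) \<omega>) \<partial>M) = (\<Sum>m. \<integral>\<^sup>+ \<omega>. ennreal (of_bool (N \<omega> = m) * G m \<omega>) \<partial>M)"
    if G: "\<And>m. G m \<in> borel_measurable M" for G :: "nat \<Rightarrow> 'a \<Rightarrow> real"
  proof -
    have "(\<integral>\<^sup>+ \<omega>. ennreal (G (N \<omega>) \<omega>) \<partial>M) = (\<integral>\<^sup>+ \<omega>. (\<Sum>m. ennreal (of_bool (N \<omega> = m) * G m \<omega>)) \<partial>M)"
    proof (rule nn_integral_cong)
      fix \<omega>
      have "(\<Sum>m. ennreal (of_bool (N \<omega> = m) * G m \<omega>)) = (\<Sum>m\<in>{N \<omega>}. ennreal (of_bool (N \<omega> = m) * G m \<omega>))"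
        by (rule suminf_finite) auto
      then show "ennreal (G (N \<omega>) \<omega>) = (\<Sum>m. ennreal (of_bool (N \<omega> = m) * G m \<omega>))" by simp
    qed
    also have "\<dots> = (\<Sum>m. \<integral>\<^sup>+ \<omega>. ennreal (of_bool (N \<omega> = m) * G m \<omega>) \<partial>M)"
      using N G by (intro nn_integral_suminf) measurable
    finally show ?thesis .
  qed
  have ib: "integrable M (\<lambda>\<omega>. of_bool (N \<omega> = m) :: real)" for m
    using N by (intro integrable_const_bound[where B = 1]) (auto simp: of_bool_def)
  have summand: "(\<integral>\<^sup>+ \<omega>. ennreal (of_bool (N \<omega> = m) * Y m \<omega>) \<partial>M) = (\<integral>\<^sup>+ \<omega>. ennreal (of_bool (N \<omega> = m) * y m) \<partial>M)" for m
  proof -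
    have "(\<integral>\<^sup>+ \<omega>. ennreal (of_bool (N \<omega> = m) * Y m \<omega>) \<partial>M) = ennreal (expectation (\<lambda>\<omega>. of_bool (N \<omega> = m) * Y m \<omega>))"
      using indep_var_integrable[OF Y ib Yint] Y0 by (intro nn_integral_eq_integral) auto
    also have "expectation (\<lambda>\<omega>. of_bool (N \<omega> = m) * Y m \<omega>) = expectation (\<lambda>\<omega>. of_bool (N \<omega> = m)) * y m"
      using indep_var_lebesgue_integral[OF Y ib Yint] by (simp add: Yexp)
    also have "\<dots> = expectation (\<lambda>\<omega>. of_bool (N \<omega> = m) * y m)" using ib by simp
    also have "ennreal \<dots> = (\<integral>\<^sup>+ \<omega>. ennreal (of_bool (N \<omega> = m) * y m) \<partial>M)"
      using ib y0 by (intro nn_integral_eq_integral[symmetric]) auto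
    finally show ?thesis .
  qed
  have e0: "0 \<le> e" and inte: "integrable M (\<lambda>\<omega>. y (N \<omega>))"
    using int y0 by (auto simp: has_bochner_integral_iff)
  show ?thesis
  proof (rule has_bochner_integral_nn_integral)
    show "(\<lambda>\<omega>. Y (N \<omega>) \<omega>) \<in> borel_measurable M" using N by measurable
    show "AE \<omega> in M. 0 \<le> Y (N \<omega>) \<omega>" using Y0 by auto
    show "0 \<le> e" by (rule e0)
    have "(\<integral>\<^sup>+ \<omega>. ennreal (Y (N \<omega>) \<omega>) \<partial>M) = (\<integral>\<^sup>+ \<omega>. ennreal (y (N \<omega>)) \<partial>M)"
      using split[of Y] split[of "\<lambda>m _. y m"] by (simp add: summand)
    also have "\<dots> = ennreal e"
      using int y0 inte by (subst nn_integral_eq_integral) (auto simp: has_bochner_integral_iff)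
    finally show "(\<integral>\<^sup>+ \<omega>. ennreal (Y (N \<omega>) \<omega>) \<partial>M) = ennreal e" .
  qed
qed

lemma interarrival_moments:
  assumes Q: "prob_space Q" and S: "interarrival_times Q S"
  shows "integrable Q (\<lambda>\<omega>. \<Sum>k<m. S k \<omega>)" "prob_space.expectation Q (\<lambda>\<omega>. \<Sum>k<m. S k \<omega>) = real m"
    "integrable Q (\<lambda>\<omega>. (\<Sum>k<m. S k \<omega>)\<^sup>2)"
    "prob_space.expectation Q (\<lambda>\<omega>. (\<Sum>k<m. S k \<omega>)\<^sup>2) = (real m)\<^sup>2 + real m"
proof -
  interpret prob_space Q by fact
  have ind: "indep_vars (\<lambda>_. borel) S UNIV" and D: "\<And>k. distributed Q lborel (S k) (erlang_density 0 1)"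
    using S by (auto simp: interarrival_times_def)
  have i1: "integrable Q (S k)" "integrable Q (\<lambda>\<omega>. (S k \<omega>)\<^sup>2)" for k
    using erlang_ith_moment_integrable[of 1 "S k" 0 1] erlang_ith_moment_integrable[of 1 "S k" 0 2] D[of k] by auto
  have e1: "expectation (S k) = 1" "expectation (\<lambda>\<omega>. (S k \<omega>)\<^sup>2) = 2" for k
    using erlang_ith_moment[of 1 "S k" 0 1] erlang_ith_moment[of 1 "S k" 0 2] D[of k] by (auto simp: fact_numeral)
  have pm: "integrable Q (\<lambda>\<omega>. S i \<omega> * S l \<omega>)" "expectation (\<lambda>\<omega>. S i \<omega> * S l \<omega>) = (if i = l then 2 else 1\<^sup>2)" for i l
    by (rule pair_moment[OF ind]; use i1 e1 in simp)+
  show "integrable Q (\<lambda>\<omega>. \<Sum>k<m. S k \<omega>)" "expectation (\<lambda>\<omega>. \<Sum>k<m. S k \<omega>) = real m"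
    using i1 e1 by auto
  have sq: "(\<Sum>k<m. S k \<omega>)\<^sup>2 = (\<Sum>i<m. \<Sum>l<m. S i \<omega> * S l \<omega>)" for \<omega>
    by (simp add: power2_eq_square sum_product)
  show "integrable Q (\<lambda>\<omega>. (\<Sum>k<m. S k \<omega>)\<^sup>2)" unfolding sq using pm by auto
  have "expectation (\<lambda>\<omega>. (\<Sum>k<m. S k \<omega>)\<^sup>2) = (\<Sum>i<m. \<Sum>l<m. 1 + of_bool (l = i))"
    unfolding sq using pm by (simp add: of_bool_def) (intro sum.cong, auto)
  also have "\<dots> = (real m)\<^sup>2 + real m"
    by (simp add: sum.distrib power2_eq_square algebra_simps)
  finally show "expectation (\<lambda>\<omega>. (\<Sum>k<m. S k \<omega>)\<^sup>2) = (real m)\<^sup>2 + real m" .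
qed

text \<open>
  The process enters only through its survival probabilities; running it with the independent exponential clock adds
  the mean \<open>e1\<close> to the variance.
\<close>
lemma hitting_moments:
  assumes K: "bd_matrix n K p q" and j: "j \<le> n" and C: "chain_with_clock Q n K j X S"
    and s1: "(\<lambda>m. survival p q u m j) sums e1"
    and s2: "(\<lambda>m. real (2 * m + 1) * survival p q u m j) sums e2"
  shows "mean Q (hit_disc X u) = e1" "var Q (hit_disc X u) = e2 - e1\<^sup>2" "var Q (hit_cont X S u) = e2 + e1 - e1\<^sup>2"
proof -
  have mc: "markov_chain Q n K j X" and ia: "interarrival_times Q S"
    and indep: "prob_space.indep_var Q (PiM UNIV (\<lambda>_. count_space UNIV)) (\<lambda>\<omega> m. X m \<omega>)
       (PiM UNIV (\<lambda>_. borel)) (\<lambda>\<omega> k. S k \<omega>)"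
    using C by (auto simp: chain_with_clock_def)
  interpret prob_space Q using mc by (simp add: markov_chain_def)
  have Xm[measurable]: "X m \<in> measurable Q (count_space UNIV)" for m using mc by (simp add: markov_chain_def)
  have Spos: "0 < S k \<omega>" and Slim: "filterlim (\<lambda>m. \<Sum>k<m. S k \<omega>) at_top sequentially" if "\<omega> \<in> space Q" for k \<omega>
    using ia that by (auto simp: interarrival_times_def)
  (* Independence is stated for the path regarded as a sequence of real numbers. *)
  define hit where "hit = (\<lambda>x :: nat \<Rightarrow> real. if \<exists>m. x m = real u then LEAST m. x m = real u else 0)"
  define N where "N = (\<lambda>\<omega>. hit (\<lambda>m. real (X m \<omega>)))"
  have hit_m: "hit \<in> measurable (PiM UNIV (\<lambda>_. count_space UNIV)) (count_space UNIV)"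
    unfolding hit_def by measurable
  have Xproc: "(\<lambda>\<omega> m. real (X m \<omega>)) \<in> measurable Q (PiM UNIV (\<lambda>_. count_space UNIV))"
    by (rule measurable_PiM_single') auto
  have N_m[measurable]: "N \<in> measurable Q (count_space UNIV)"
    unfolding N_def using measurable_comp[OF Xproc hit_m] by (simp add: comp_def)
  define avoid where "avoid = (\<lambda>m. {\<omega>\<in>space Q. \<forall>k\<le>m. X k \<omega> \<noteq> u})"
  have av: "prob (avoid m) = survival p q u m j" for m
    unfolding avoid_def by (rule markov_chain_avoid[OF K j mc])
  have av_ev: "avoid m \<in> events" for m unfolding avoid_def by measurable
  define never where "never = {\<omega>\<in>space Q. \<forall>k. X k \<omega> \<noteq> u}"
  have nev_ev: "never \<in> events" unfolding never_def by measurable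
  have "prob never = 0"
  proof -
    have "(\<lambda>m. survival p q u m j) \<longlonglongrightarrow> 0" using s1 by (intro summable_LIMSEQ_zero) (simp add: sums_iff)
    moreover have "prob never \<le> survival p q u m j" for m
      unfolding av[symmetric] by (intro finite_measure_mono av_ev) (auto simp: never_def avoid_def)
    ultimately have "prob never \<le> 0" by (intro LIMSEQ_le_const) auto
    then show ?thesis using measure_nonneg[of Q never] by simp
  qed
  have N_less: "{\<omega>\<in>space Q. m < N \<omega>} = avoid m - never" for m
  proof (intro equalityI subsetI)
    fix \<omega> assume w: "\<omega> \<in> {\<omega>\<in>space Q. m < N \<omega>}"
    then have ex: "\<exists>m. X m \<omega> = u" by (auto simp: N_def hit_def split: if_splits)
    then have "N \<omega> = (LEAST m. X m \<omega> = u)" by (simp add: N_def hit_def)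
    then have "X k \<omega> \<noteq> u" if "k \<le> m" for k using w that not_less_Least[of k "\<lambda>m. X m \<omega> = u"] by auto
    then show "\<omega> \<in> avoid m - never" using w ex by (auto simp: avoid_def never_def)
  next
    fix \<omega> assume w: "\<omega> \<in> avoid m - never"
    then have ex: "\<exists>m. X m \<omega> = u" by (auto simp: avoid_def never_def)
    then have N: "N \<omega> = (LEAST m. X m \<omega> = u)" by (simp add: N_def hit_def)
    have "X (N \<omega>) \<omega> = u" unfolding N by (rule LeastI_ex[OF ex])
    then have "\<not> N \<omega> \<le> m" using w by (auto simp: avoid_def)
    then show "\<omega> \<in> {\<omega>\<in>space Q. m < N \<omega>}" using w by (auto simp: avoid_def)
  qed
  have PN: "prob {\<omega>\<in>space Q. m < N \<omega>} = survival p q u m j" for m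
  proof -
    have "prob (avoid m - never) = prob (avoid m) - prob (avoid m \<inter> never)"
      by (rule finite_measure_Diff') (use av_ev nev_ev in auto)
    moreover have "prob (avoid m \<inter> never) \<le> prob never" by (intro finite_measure_mono nev_ev) auto
    ultimately show ?thesis using \<open>prob never = 0\<close> measure_nonneg[of Q "avoid m \<inter> never"] by (simp add: N_less av)
  qed
  have m1: "has_bochner_integral Q (\<lambda>\<omega>. real (N \<omega>)) e1"
    and m2: "has_bochner_integral Q (\<lambda>\<omega>. (real (N \<omega>))\<^sup>2) e2"
    using nat_moments[OF N_m, of e1 e2] s1 s2 by (simp_all add: PN)
  have hd: "real_of_ereal (hit_disc X u \<omega>) = real (N \<omega>)" for \<omega>
    by (simp add: hit_disc_eq N_def hit_def)
  show "mean Q (hit_disc X u) = e1"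
    using m1 by (simp add: mean_def hd has_bochner_integral_iff)
  show "var Q (hit_disc X u) = e2 - e1\<^sup>2"
    unfolding var_def hd using m1 m2 by (subst variance_eq) (auto simp: has_bochner_integral_iff)
  define Y where "Y = (\<lambda>m \<omega>. \<Sum>k<m. S k \<omega>)"
  have hc: "real_of_ereal (hit_cont X S u \<omega>) = Y (N \<omega>) \<omega>" if "\<omega> \<in> space Q" for \<omega>
    using hit_cont_eq[where S = S and \<omega> = \<omega>, OF Spos[OF that] Slim[OF that]] by (simp add: Y_def N_def hit_def)
  have indY: "indep_var borel (\<lambda>\<omega>. of_bool (N \<omega> = m) :: real) borel (\<lambda>\<omega>. g (Y m \<omega>))"
    if g: "g \<in> borel_measurable borel" for m and g :: "real \<Rightarrow> real"
  proof -
    have a: "(\<lambda>x. of_bool (hit x = m) :: real) \<in> measurable (PiM UNIV (\<lambda>_. count_space UNIV)) borel"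
      using hit_m by measurable
    have b: "(\<lambda>s. g (\<Sum>k<m. s k)) \<in> measurable (PiM UNIV (\<lambda>_. borel)) borel"
      using g by measurable
    show ?thesis
      using indep_var_compose[OF indep a b] by (simp add: comp_def N_def Y_def)
  qed
  note mom = interarrival_moments[OF prob_space_axioms ia]
  have Y_nonneg: "0 \<le> Y m \<omega>" if "\<omega> \<in> space Q" for m \<omega>
    unfolding Y_def by (intro sum_nonneg order.strict_implies_order[OF Spos[OF that]])
  have c1: "has_bochner_integral Q (\<lambda>\<omega>. Y (N \<omega>) \<omega>) e1"
  proof (rule random_sum_moments[where y = real])
    show "indep_var borel (\<lambda>\<omega>. of_bool (N \<omega> = m) :: real) borel (Y m)" for m
      using indY[of "\<lambda>x. x"] by simp
    show "0 \<le> Y m \<omega>" if "\<omega> \<in> space Q" for m \<omega> by (rule Y_nonneg[OF that])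
  qed (use N_m m1 mom in \<open>auto simp: Y_def\<close>)
  have "has_bochner_integral Q (\<lambda>\<omega>. (real (N \<omega>))\<^sup>2 + real (N \<omega>)) (e2 + e1)"
    by (intro has_bochner_integral_add m1 m2)
  then have c2: "has_bochner_integral Q (\<lambda>\<omega>. (Y (N \<omega>) \<omega>)\<^sup>2) (e2 + e1)"
  proof (intro random_sum_moments[where y = "\<lambda>m. (real m)\<^sup>2 + real m" and Y = "\<lambda>m \<omega>. (Y m \<omega>)\<^sup>2"])
    show "indep_var borel (\<lambda>\<omega>. of_bool (N \<omega> = m) :: real) borel (\<lambda>\<omega>. (Y m \<omega>)\<^sup>2)" for m
      using indY[of "\<lambda>x. x\<^sup>2"] by simp
  qed (use N_m mom in \<open>auto simp: Y_def\<close>)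
  have "var Q (hit_cont X S u) = variance (\<lambda>\<omega>. Y (N \<omega>) \<omega>)"
    unfolding var_def using hc by (simp cong: Bochner_Integration.integral_cong)
  also have "\<dots> = e2 + e1 - e1\<^sup>2"
    using c1 c2 by (subst variance_eq) (auto simp: has_bochner_integral_iff)
  finally show "var Q (hit_cont X S u) = e2 + e1 - e1\<^sup>2" .
qed

section \<open>Randomly slowed chains\<close>

lemma passage_mean_slowed: "passage_mean (\<lambda>i. p i * d i) \<pi> i = passage_mean p \<pi> i * (1 / d i)"
  by (simp add: passage_mean_def)

lemma mean_hit_slowed:
  "mean_hit (\<lambda>i. p i * d i) \<pi> 0 M = (\<Sum>i<M. passage_mean p \<pi> i * (1 / d i))"
  by (simp add: mean_hit_def passage_mean_slowed atLeast0LessThan)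

lemma (in bd_rates) hit_var_slowed:
  assumes "M \<le> n" "bd_rates n (\<lambda>i. p i * d i) q' \<pi>"
  shows "hit_var (\<lambda>i. p i * d i) \<pi> 0 M = (\<Sum>i<M. \<Sum>l<M. a i * a l * corr i l * (1 / d i * (1 / d l)))"
proof -
  interpret L: bd_rates n "\<lambda>i. p i * d i" q' \<pi> by fact
  show ?thesis
    unfolding L.W_double_sum[OF assms(1)] passage_mean_slowed by (simp add: mult_ac)
qed

text \<open>
  Distinct variables are uncorrelated, so a quadratic form differs in mean from its value at the constant \<open>\<mu>\<close> only by
  its diagonal.
\<close>
lemma (in prob_space) quadratic_moments:
  fixes Z :: "'i \<Rightarrow> 'a \<Rightarrow> real" and g :: "nat \<Rightarrow> 'i"
  assumes ind: "indep_vars (\<lambda>_. borel) Z I" and g: "inj_on g {..<k}" "g ` {..<k} \<subseteq> I"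
    and int: "\<And>i. i \<in> I \<Longrightarrow> integrable M (Z i)" "\<And>i. i \<in> I \<Longrightarrow> integrable M (\<lambda>\<omega>. (Z i \<omega>)\<^sup>2)"
    and m: "\<And>i. i \<in> I \<Longrightarrow> expectation (Z i) = \<mu>" "\<And>i. i \<in> I \<Longrightarrow> expectation (\<lambda>\<omega>. (Z i \<omega>)\<^sup>2) = \<mu>\<^sup>2 + \<nu>2"
  shows "integrable M (\<lambda>\<omega>. \<Sum>i<k. \<Sum>l<k. w i l * (Z (g i) \<omega> * Z (g l) \<omega>))"
    and "expectation (\<lambda>\<omega>. \<Sum>i<k. \<Sum>l<k. w i l * (Z (g i) \<omega> * Z (g l) \<omega>)) =
      \<mu>\<^sup>2 * (\<Sum>i<k. \<Sum>l<k. w i l) + \<nu>2 * (\<Sum>i<k. w i i)"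
proof -
  have gI: "g i \<in> I" if "i < k" for i using g(2) that by auto
  note pm = pair_moment[OF ind gI gI int m]
  show "integrable M (\<lambda>\<omega>. \<Sum>i<k. \<Sum>l<k. w i l * (Z (g i) \<omega> * Z (g l) \<omega>))"
    using pm(1) by (intro Bochner_Integration.integrable_sum integrable_mult_right) auto
  have "expectation (\<lambda>\<omega>. \<Sum>i<k. \<Sum>l<k. w i l * (Z (g i) \<omega> * Z (g l) \<omega>)) =
      (\<Sum>i<k. \<Sum>l<k. w i l * expectation (\<lambda>\<omega>. Z (g i) \<omega> * Z (g l) \<omega>))"
    using pm(1)
    by (subst Bochner_Integration.integral_sum, force intro!: Bochner_Integration.integrable_sum)
       (intro sum.cong refl, subst Bochner_Integration.integral_sum, auto)
  also have "\<dots> = (\<Sum>i<k. \<Sum>l<k. \<mu>\<^sup>2 * w i l + (if l = i then \<nu>2 * w i i else 0))"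
  proof (intro sum.cong refl)
    fix i l assume il: "i \<in> {..<k}" "l \<in> {..<k}"
    then have "g i = g l \<longleftrightarrow> l = i" using g(1) by (auto simp: inj_on_def)
    then show "w i l * expectation (\<lambda>\<omega>. Z (g i) \<omega> * Z (g l) \<omega>) = \<mu>\<^sup>2 * w i l + (if l = i then \<nu>2 * w i i else 0)"
      using pm(2)[of i l] il by (auto simp: algebra_simps)
  qed
  also have "\<dots> = \<mu>\<^sup>2 * (\<Sum>i<k. \<Sum>l<k. w i l) + \<nu>2 * (\<Sum>i<k. w i i)"
    by (simp add: sum.distrib sum_distrib_left)
  finally show "expectation (\<lambda>\<omega>. \<Sum>i<k. \<Sum>l<k. w i l * (Z (g i) \<omega> * Z (g l) \<omega>)) =
      \<mu>\<^sup>2 * (\<Sum>i<k. \<Sum>l<k. w i l) + \<nu>2 * (\<Sum>i<k. w i i)" .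
qed

lemma (in prob_space) weighted_sum_deviation:
  fixes Z :: "'i \<Rightarrow> 'a \<Rightarrow> real" and g :: "nat \<Rightarrow> 'i"
  assumes ind: "indep_vars (\<lambda>_. borel) Z I" and g: "inj_on g {..<k}" "g ` {..<k} \<subseteq> I"
    and int: "\<And>i. i \<in> I \<Longrightarrow> integrable M (Z i)" "\<And>i. i \<in> I \<Longrightarrow> integrable M (\<lambda>\<omega>. (Z i \<omega>)\<^sup>2)"
    and m: "\<And>i. i \<in> I \<Longrightarrow> expectation (Z i) = \<mu>" "\<And>i. i \<in> I \<Longrightarrow> expectation (\<lambda>\<omega>. (Z i \<omega>)\<^sup>2) = \<mu>\<^sup>2 + \<nu>2"
    and nu: "0 \<le> \<nu>2" and V: "(\<Sum>i<k. (a i)\<^sup>2) \<le> V" and kap: "0 < \<kappa>"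
  shows "{\<omega> \<in> space M. \<kappa> \<le> \<bar>(\<Sum>i<k. a i * Z (g i) \<omega>) - \<mu> * (\<Sum>i<k. a i)\<bar>} \<in> events"
    and "prob {\<omega> \<in> space M. \<kappa> \<le> \<bar>(\<Sum>i<k. a i * Z (g i) \<omega>) - \<mu> * (\<Sum>i<k. a i)\<bar>} \<le> \<nu>2 * V / \<kappa>\<^sup>2"
proof -
  define f where "f = (\<lambda>\<omega>. \<Sum>i<k. a i * Z (g i) \<omega>)"
  have gI: "g i \<in> I" if "i < k" for i using g(2) that by auto
  have fi: "integrable M f" unfolding f_def using int(1)[OF gI] by auto
  have [measurable]: "f \<in> borel_measurable M" using fi by auto
  have fe: "expectation f = \<mu> * (\<Sum>i<k. a i)"
    unfolding f_def using int(1)[OF gI] m(1)[OF gI] by (simp add: sum_distrib_left mult.commute)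
  have sq: "(f \<omega>)\<^sup>2 = (\<Sum>i<k. \<Sum>l<k. (a i * a l) * (Z (g i) \<omega> * Z (g l) \<omega>))" for \<omega>
    by (simp add: f_def power2_eq_square sum_product mult_ac)
  have f2i: "integrable M (\<lambda>\<omega>. (f \<omega>)\<^sup>2)"
    unfolding sq by (rule quadratic_moments(1)[OF ind g int m])
  have "expectation (\<lambda>\<omega>. (f \<omega>)\<^sup>2) = \<mu>\<^sup>2 * (\<Sum>i<k. \<Sum>l<k. a i * a l) + \<nu>2 * (\<Sum>i<k. a i * a i)"
    unfolding sq by (rule quadratic_moments(2)[OF ind g int m])
  also have "(\<Sum>i<k. \<Sum>l<k. a i * a l) = (\<Sum>i<k. a i)\<^sup>2" by (simp add: power2_eq_square sum_product)
  finally have vf: "variance f = \<nu>2 * (\<Sum>i<k. (a i)\<^sup>2)"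
    using fi f2i by (subst variance_eq) (auto simp: fe power_mult_distrib power2_eq_square)
  have "{\<omega> \<in> space M. \<kappa> \<le> \<bar>f \<omega> - \<mu> * (\<Sum>i<k. a i)\<bar>} \<in> events" by measurable
  then show "{\<omega> \<in> space M. \<kappa> \<le> \<bar>(\<Sum>i<k. a i * Z (g i) \<omega>) - \<mu> * (\<Sum>i<k. a i)\<bar>} \<in> events"
    by (simp add: f_def)
  have "prob {\<omega> \<in> space M. \<kappa> \<le> \<bar>f \<omega> - expectation f\<bar>} \<le> variance f / \<kappa>\<^sup>2"
    using f2i kap by (intro Chebyshev_inequality) auto
  also have "\<dots> \<le> \<nu>2 * V / \<kappa>\<^sup>2"
    unfolding vf using V nu by (intro divide_right_mono mult_left_mono) auto
  finally show "prob {\<omega> \<in> space M. \<kappa> \<le> \<bar>(\<Sum>i<k. a i * Z (g i) \<omega>) - \<mu> * (\<Sum>i<k. a i)\<bar>} \<le> \<nu>2 * V / \<kappa>\<^sup>2"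
    by (simp add: f_def fe[unfolded f_def])
qed

lemma (in prob_space) quadratic_markov:
  fixes Z :: "'i \<Rightarrow> 'a \<Rightarrow> real" and g :: "nat \<Rightarrow> 'i"
  assumes ind: "indep_vars (\<lambda>_. borel) Z I" and g: "inj_on g {..<k}" "g ` {..<k} \<subseteq> I"
    and int: "\<And>i. i \<in> I \<Longrightarrow> integrable M (Z i)" "\<And>i. i \<in> I \<Longrightarrow> integrable M (\<lambda>\<omega>. (Z i \<omega>)\<^sup>2)"
    and m: "\<And>i. i \<in> I \<Longrightarrow> expectation (Z i) = \<mu>" "\<And>i. i \<in> I \<Longrightarrow> expectation (\<lambda>\<omega>. (Z i \<omega>)\<^sup>2) = \<mu>\<^sup>2 + \<nu>2"
    and Z0: "\<And>i \<omega>. i \<in> I \<Longrightarrow> \<omega> \<in> space M \<Longrightarrow> 0 \<le> Z i \<omega>"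
    and w: "\<And>i l. i < k \<Longrightarrow> l < k \<Longrightarrow> 0 \<le> w i l"
    and nu: "0 \<le> \<nu>2" and V: "(\<Sum>i<k. \<Sum>l<k. w i l) = V" "(\<Sum>i<k. w i i) \<le> V" and kap: "0 < \<kappa>"
  shows "{\<omega> \<in> space M. \<kappa>\<^sup>2 \<le> (\<Sum>i<k. \<Sum>l<k. w i l * (Z (g i) \<omega> * Z (g l) \<omega>))} \<in> events"
    and "prob {\<omega> \<in> space M. \<kappa>\<^sup>2 \<le> (\<Sum>i<k. \<Sum>l<k. w i l * (Z (g i) \<omega> * Z (g l) \<omega>))} \<le> (\<mu>\<^sup>2 + \<nu>2) * V / \<kappa>\<^sup>2"
proof -
  define f where "f = (\<lambda>\<omega>. \<Sum>i<k. \<Sum>l<k. w i l * (Z (g i) \<omega> * Z (g l) \<omega>))"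
  have gI: "g i \<in> I" if "i < k" for i using g(2) that by auto
  have fi: "integrable M f" unfolding f_def by (rule quadratic_moments(1)[OF ind g int m])
  have [measurable]: "f \<in> borel_measurable M" using fi by auto
  have "expectation f = \<mu>\<^sup>2 * V + \<nu>2 * (\<Sum>i<k. w i i)"
    unfolding f_def V(1)[symmetric] by (rule quadratic_moments(2)[OF ind g int m])
  also have "\<dots> \<le> \<mu>\<^sup>2 * V + \<nu>2 * V" using V(2) nu by (intro add_left_mono mult_left_mono)
  finally have fe: "expectation f \<le> (\<mu>\<^sup>2 + \<nu>2) * V" by (simp add: algebra_simps)
  have f0: "0 \<le> f \<omega>" if "\<omega> \<in> space M" for \<omega>
    unfolding f_def using Z0[OF gI that] w by (intro sum_nonneg mult_nonneg_nonneg) auto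
  have "{\<omega> \<in> space M. \<kappa>\<^sup>2 \<le> f \<omega>} \<in> events" by measurable
  then show "{\<omega> \<in> space M. \<kappa>\<^sup>2 \<le> (\<Sum>i<k. \<Sum>l<k. w i l * (Z (g i) \<omega> * Z (g l) \<omega>))} \<in> events"
    by (simp add: f_def)
  have "prob {\<omega> \<in> space M. \<kappa>\<^sup>2 \<le> f \<omega>} \<le> expectation f / \<kappa>\<^sup>2"
    using integral_Markov_inequality_measure[OF fi, of "{}" "\<kappa>\<^sup>2"] f0 kap by auto
  also have "\<dots> \<le> (\<mu>\<^sup>2 + \<nu>2) * V / \<kappa>\<^sup>2" using fe by (intro divide_right_mono) auto
  finally show "prob {\<omega> \<in> space M. \<kappa>\<^sup>2 \<le> (\<Sum>i<k. \<Sum>l<k. w i l * (Z (g i) \<omega> * Z (g l) \<omega>))} \<le> (\<mu>\<^sup>2 + \<nu>2) * V / \<kappa>\<^sup>2"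
    by (simp add: f_def)
qed

text \<open>
  Both the diagonal \<open>\<Sum>i. (a i)\<^sup>2\<close>, which is the variance of the slowed mean, and the full form are at most the
  original variance.
\<close>
lemma (in prob_space) slowed_one_side:
  fixes Cf :: "nat \<Rightarrow> 'a \<Rightarrow> real"
  assumes B: "bd_rates n p q \<pi>" and k: "k \<le> n" and L: "\<And>\<omega>. \<omega> \<in> space M \<Longrightarrow> bd_rates n (\<lambda>i. p i * Cf (g i) \<omega>) (q' \<omega>) \<pi>"
    and Cpos: "\<And>i \<omega>. i \<in> I \<Longrightarrow> \<omega> \<in> space M \<Longrightarrow> 0 < Cf i \<omega>"
    and ind: "indep_vars (\<lambda>_. borel) (\<lambda>i \<omega>. 1 / Cf i \<omega>) I" and g: "inj_on g {..<k}" "g ` {..<k} \<subseteq> I"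
    and int: "\<And>i. i \<in> I \<Longrightarrow> integrable M (\<lambda>\<omega>. 1 / Cf i \<omega>)" "\<And>i. i \<in> I \<Longrightarrow> integrable M (\<lambda>\<omega>. (1 / Cf i \<omega>)\<^sup>2)"
    and m: "\<And>i. i \<in> I \<Longrightarrow> expectation (\<lambda>\<omega>. 1 / Cf i \<omega>) = \<mu>" "\<And>i. i \<in> I \<Longrightarrow> expectation (\<lambda>\<omega>. (1 / Cf i \<omega>)\<^sup>2) = \<mu>\<^sup>2 + \<nu>2"
    and nu: "0 \<le> \<nu>2" and kap: "0 < \<kappa>" and V: "hit_var p \<pi> 0 k \<le> V"
  shows "\<exists>bad\<in>events. prob bad \<le> (\<mu>\<^sup>2 + 2 * \<nu>2) * V / \<kappa>\<^sup>2 \<and>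
    (\<forall>\<omega>\<in>space M - bad. \<bar>mean_hit (\<lambda>i. p i * Cf (g i) \<omega>) \<pi> 0 k - \<mu> * mean_hit p \<pi> 0 k\<bar> \<le> \<kappa> \<and>
       hit_var (\<lambda>i. p i * Cf (g i) \<omega>) \<pi> 0 k \<le> \<kappa>\<^sup>2)"
proof -
  interpret B: bd_rates n p q \<pi> by fact
  define w where "w = (\<lambda>i l. B.a i * B.a l * B.corr i l)"
  have w0: "0 \<le> w i l" if "i < k" "l < k" for i l
    unfolding w_def using that k B.a_pos[of i] B.a_pos[of l] by (intro mult_nonneg_nonneg B.corr_nonneg) auto
  have W: "(\<Sum>i<k. \<Sum>l<k. w i l) = B.W 0 k" unfolding w_def by (rule B.W_double_sum[OF k, symmetric])
  have diag: "(\<Sum>i<k. (B.a i)\<^sup>2) \<le> B.W 0 k" by (rule B.sum_a_square_le[OF k])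
  have "w i i = (B.a i)\<^sup>2" if "i < k" for i
    using that k B.F_pos[of i] by (simp add: w_def B.corr_def power2_eq_square)
  then have diag': "(\<Sum>i<k. w i i) \<le> B.W 0 k" using diag by simp
  define bad1 where "bad1 = {\<omega> \<in> space M. \<kappa> \<le> \<bar>(\<Sum>i<k. B.a i * (1 / Cf (g i) \<omega>)) - \<mu> * (\<Sum>i<k. B.a i)\<bar>}"
  define bad2 where "bad2 = {\<omega> \<in> space M. \<kappa>\<^sup>2 \<le> (\<Sum>i<k. \<Sum>l<k. w i l * (1 / Cf (g i) \<omega> * (1 / Cf (g l) \<omega>)))}"
  have b1: "bad1 \<in> events" "prob bad1 \<le> \<nu>2 * B.W 0 k / \<kappa>\<^sup>2"
    unfolding bad1_def
    by (rule weighted_sum_deviation(1)[OF ind g int m nu diag kap], assumption+)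
       (rule weighted_sum_deviation(2)[OF ind g int m nu diag kap], assumption+)
  have Z0: "0 \<le> 1 / Cf i \<omega>" if "i \<in> I" "\<omega> \<in> space M" for i \<omega> using Cpos[OF that] by simp
  have b2: "bad2 \<in> events" "prob bad2 \<le> (\<mu>\<^sup>2 + \<nu>2) * B.W 0 k / \<kappa>\<^sup>2"
    unfolding bad2_def
    by (rule quadratic_markov(1)[OF ind g int m Z0 w0 nu W diag' kap], assumption+)
       (rule quadratic_markov(2)[OF ind g int m Z0 w0 nu W diag' kap], assumption+)
  show ?thesis
  proof (intro bexI conjI ballI)
    show "bad1 \<union> bad2 \<in> events" using b1 b2 by auto
    have "prob (bad1 \<union> bad2) \<le> prob bad1 + prob bad2" by (rule measure_Un_le) (use b1 b2 in auto)
    also have "\<dots> \<le> \<nu>2 * B.W 0 k / \<kappa>\<^sup>2 + (\<mu>\<^sup>2 + \<nu>2) * B.W 0 k / \<kappa>\<^sup>2" using b1 b2 by linarith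
    also have "\<dots> = (\<mu>\<^sup>2 + 2 * \<nu>2) * B.W 0 k / \<kappa>\<^sup>2"
      by (simp add: add_divide_distrib[symmetric] algebra_simps)
    also have "\<dots> \<le> (\<mu>\<^sup>2 + 2 * \<nu>2) * V / \<kappa>\<^sup>2"
      using V nu by (intro divide_right_mono mult_left_mono) auto
    finally show "prob (bad1 \<union> bad2) \<le> (\<mu>\<^sup>2 + 2 * \<nu>2) * V / \<kappa>\<^sup>2" .
    fix \<omega> assume w: "\<omega> \<in> space M - (bad1 \<union> bad2)"
    show "\<bar>mean_hit (\<lambda>i. p i * Cf (g i) \<omega>) \<pi> 0 k - \<mu> * mean_hit p \<pi> 0 k\<bar> \<le> \<kappa>"
      using w unfolding mean_hit_slowed by (auto simp: bad1_def mean_hit_def atLeast0LessThan)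
    show "hit_var (\<lambda>i. p i * Cf (g i) \<omega>) \<pi> 0 k \<le> \<kappa>\<^sup>2"
      using w B.hit_var_slowed[OF k L[of \<omega>]] by (auto simp: bad2_def w_def)
  qed
qed

lemma (in prob_space) slowed_event:
  fixes Cf :: "nat \<Rightarrow> 'a \<Rightarrow> real"
  assumes B: "bd_rates n p q \<pi>" and k: "k \<le> n"
    and C: "\<And>i \<omega>. i \<in> {1..n} \<Longrightarrow> \<omega> \<in> space M \<Longrightarrow> 0 < Cf i \<omega> \<and> Cf i \<omega> < 1"
    and ind: "indep_vars (\<lambda>_. borel) (\<lambda>i \<omega>. 1 / Cf i \<omega>) {1..n}"
    and int: "\<And>i. i \<in> {1..n} \<Longrightarrow> integrable M (\<lambda>\<omega>. 1 / Cf i \<omega>)" "\<And>i. i \<in> {1..n} \<Longrightarrow> integrable M (\<lambda>\<omega>. (1 / Cf i \<omega>)\<^sup>2)"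
    and m: "\<And>i. i \<in> {1..n} \<Longrightarrow> expectation (\<lambda>\<omega>. 1 / Cf i \<omega>) = \<mu>" "\<And>i. i \<in> {1..n} \<Longrightarrow> expectation (\<lambda>\<omega>. (1 / Cf i \<omega>)\<^sup>2) = \<mu>\<^sup>2 + \<nu>2"
    and mu: "0 \<le> \<mu>" and nu: "0 \<le> \<nu>2" and kap: "0 < \<kappa>"
  shows "\<exists>E\<in>events. 1 - 2 * ((\<mu>\<^sup>2 + 2 * \<nu>2) * (bd_alpha n p q \<pi> k)\<^sup>2 / \<kappa>\<^sup>2) \<le> prob E \<and>
    (\<forall>\<omega>\<in>E. \<bar>bd_theta n (\<lambda>i. p i * Cf (i + 1) \<omega>) (\<lambda>i. q i * Cf i \<omega>) \<pi> k - \<mu> * bd_theta n p q \<pi> k\<bar> \<le> \<kappa> \<and>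
       bd_alpha n (\<lambda>i. p i * Cf (i + 1) \<omega>) (\<lambda>i. q i * Cf i \<omega>) \<pi> k \<le> \<kappa>)"
proof -
  interpret B: bd_rates n p q \<pi> by fact
  interpret R: bd_rates n B.rp B.rq B.r\<pi> by (rule B.reflect)
  define V where "V = (B.\<alpha> k)\<^sup>2"
  have V: "B.W 0 k \<le> V" "R.W 0 (n - k) \<le> V"
    using B.W_nonneg[OF k, of 0] by (auto simp: V_def bd_alpha_def)
  have L: "bd_rates n (\<lambda>i. p i * Cf (i + 1) \<omega>) (\<lambda>i. q i * Cf i \<omega>) \<pi>" if "\<omega> \<in> space M" for \<omega>
    by (rule bd_slowed(1)[OF B]) (use C that in auto)
  have L': "bd_rates n (\<lambda>i. q (n - i) * Cf (n - i) \<omega>) (\<lambda>i. p (n - i) * Cf (n - i + 1) \<omega>) B.r\<pi>" if "\<omega> \<in> space M" for \<omega>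
    using bd_rates.reflect[OF L[OF that]] by simp
  obtain bad1 where b1: "bad1 \<in> events" "prob bad1 \<le> (\<mu>\<^sup>2 + 2 * \<nu>2) * V / \<kappa>\<^sup>2"
    "\<And>\<omega>. \<omega> \<in> space M - bad1 \<Longrightarrow> \<bar>mean_hit (\<lambda>i. p i * Cf (i + 1) \<omega>) \<pi> 0 k - \<mu> * mean_hit p \<pi> 0 k\<bar> \<le> \<kappa> \<and>
       hit_var (\<lambda>i. p i * Cf (i + 1) \<omega>) \<pi> 0 k \<le> \<kappa>\<^sup>2"
  proof -
    have "\<exists>bad\<in>events. prob bad \<le> (\<mu>\<^sup>2 + 2 * \<nu>2) * V / \<kappa>\<^sup>2 \<and>
      (\<forall>\<omega>\<in>space M - bad. \<bar>mean_hit (\<lambda>i. p i * Cf (i + 1) \<omega>) \<pi> 0 k - \<mu> * mean_hit p \<pi> 0 k\<bar> \<le> \<kappa> \<and>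
         hit_var (\<lambda>i. p i * Cf (i + 1) \<omega>) \<pi> 0 k \<le> \<kappa>\<^sup>2)"
      by (rule slowed_one_side[OF B k L _ ind _ _ int m nu kap V(1)]) (use C k in \<open>auto simp: inj_on_def\<close>)
    then show ?thesis using that by blast
  qed
  obtain bad2 where b2: "bad2 \<in> events" "prob bad2 \<le> (\<mu>\<^sup>2 + 2 * \<nu>2) * V / \<kappa>\<^sup>2"
    "\<And>\<omega>. \<omega> \<in> space M - bad2 \<Longrightarrow> \<bar>mean_hit (\<lambda>i. q (n - i) * Cf (n - i) \<omega>) B.r\<pi> 0 (n - k) - \<mu> * R.h 0 (n - k)\<bar> \<le> \<kappa> \<and>
       hit_var (\<lambda>i. q (n - i) * Cf (n - i) \<omega>) B.r\<pi> 0 (n - k) \<le> \<kappa>\<^sup>2"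
  proof -
    have "\<exists>bad\<in>events. prob bad \<le> (\<mu>\<^sup>2 + 2 * \<nu>2) * V / \<kappa>\<^sup>2 \<and>
      (\<forall>\<omega>\<in>space M - bad. \<bar>mean_hit (\<lambda>i. q (n - i) * Cf (n - i) \<omega>) B.r\<pi> 0 (n - k) - \<mu> * R.h 0 (n - k)\<bar> \<le> \<kappa> \<and>
         hit_var (\<lambda>i. q (n - i) * Cf (n - i) \<omega>) B.r\<pi> 0 (n - k) \<le> \<kappa>\<^sup>2)"
      by (rule slowed_one_side[where g = "\<lambda>i. n - i" and Cf = Cf, OF R.bd_rates_axioms _ L' _ ind _ _ int m nu kap V(2)])
         (use C k in \<open>auto simp: inj_on_def\<close>)
    then show ?thesis using that by blast
  qed
  define E where "E = space M - (bad1 \<union> bad2)"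
  show ?thesis
  proof (intro bexI conjI ballI)
    show "E \<in> events" unfolding E_def using b1 b2 by auto
    have "prob (bad1 \<union> bad2) \<le> prob bad1 + prob bad2" by (rule measure_Un_le) (use b1 b2 in auto)
    moreover have "prob E = 1 - prob (bad1 \<union> bad2)" unfolding E_def by (rule prob_compl) (use b1 b2 in auto)
    ultimately show "1 - 2 * ((\<mu>\<^sup>2 + 2 * \<nu>2) * (B.\<alpha> k)\<^sup>2 / \<kappa>\<^sup>2) \<le> prob E"
      using b1(2) b2(2) unfolding V_def by linarith
    fix \<omega> assume w: "\<omega> \<in> E"
    have c1: "\<bar>mean_hit (\<lambda>i. p i * Cf (i + 1) \<omega>) \<pi> 0 k - \<mu> * B.h 0 k\<bar> \<le> \<kappa>" "hit_var (\<lambda>i. p i * Cf (i + 1) \<omega>) \<pi> 0 k \<le> \<kappa>\<^sup>2"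
      and c2: "\<bar>mean_hit (\<lambda>i. q (n - i) * Cf (n - i) \<omega>) B.r\<pi> 0 (n - k) - \<mu> * R.h 0 (n - k)\<bar> \<le> \<kappa>"
       "hit_var (\<lambda>i. q (n - i) * Cf (n - i) \<omega>) B.r\<pi> 0 (n - k) \<le> \<kappa>\<^sup>2"
      using b1(3)[of \<omega>] b2(3)[of \<omega>] w by (auto simp: E_def)
    have "\<mu> * max x y = max (\<mu> * x) (\<mu> * y)" for x y using mu by (simp add: max_mult_distrib_left)
    then show "\<bar>bd_theta n (\<lambda>i. p i * Cf (i + 1) \<omega>) (\<lambda>i. q i * Cf i \<omega>) \<pi> k - \<mu> * B.\<theta> k\<bar> \<le> \<kappa>"
      using c1(1) c2(1) unfolding bd_theta_def by (simp add: max_def abs_le_iff)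
    have "sqrt (max (hit_var (\<lambda>i. p i * Cf (i + 1) \<omega>) \<pi> 0 k) (hit_var (\<lambda>i. q (n - i) * Cf (n - i) \<omega>) B.r\<pi> 0 (n - k))) \<le> sqrt (\<kappa>\<^sup>2)"
      using c1(2) c2(2) by (intro real_sqrt_le_mono) simp
    then show "bd_alpha n (\<lambda>i. p i * Cf (i + 1) \<omega>) (\<lambda>i. q i * Cf i \<omega>) \<pi> k \<le> \<kappa>"
      using kap by (simp add: bd_alpha_def)
  qed
qed

lemma (in bd_rates) hitting_parameters:
  assumes K: "bd_matrix n K p q" and M: "M \<le> n"
    and C0: "chain_with_clock Q0 n K 0 X0 S0" and Cn: "chain_with_clock Qn n K n Xn Sn"
  shows "max (mean Q0 (hit_disc X0 M)) (mean Qn (hit_disc Xn M)) = \<theta> M"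
    and "max (var Q0 (hit_cont X0 S0 M)) (var Qn (hit_cont Xn Sn M)) = (\<alpha> M)\<^sup>2"
    and "var Q0 (hit_disc X0 M) = W 0 M - h 0 M"
    and "var Qn (hit_disc Xn M) = hit_var rp r\<pi> 0 (n - M) - mean_hit rp r\<pi> 0 (n - M)"
proof -
  interpret R: bd_rates n rp rq r\<pi> by (rule reflect)
  have s0: "(\<lambda>m. survival p q M m 0) sums h 0 M" "(\<lambda>m. real (2 * m + 1) * survival p q M m 0) sums (W 0 M + (h 0 M)\<^sup>2 - h 0 M)"
    using survival_sums_mean[of 0 M] survival_sums_second_moment[of 0 M] M by auto
  have "survival p q M m n = survival rp rq (n - M) m 0" for m
    using survival_reflect[of 0 "n - M" m] M by simp
  then have sn: "(\<lambda>m. survival p q M m n) sums R.h 0 (n - M)"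
    "(\<lambda>m. real (2 * m + 1) * survival p q M m n) sums (R.W 0 (n - M) + (R.h 0 (n - M))\<^sup>2 - R.h 0 (n - M))"
    using R.survival_sums_mean[of 0 "n - M"] R.survival_sums_second_moment[of 0 "n - M"] M by auto
  note m0 = hitting_moments[OF K _ C0 s0]
  note mn = hitting_moments[OF K _ Cn sn]
  show "max (mean Q0 (hit_disc X0 M)) (mean Qn (hit_disc Xn M)) = \<theta> M"
    using m0(1) mn(1) by (simp add: bd_theta_def)
  show "max (var Q0 (hit_cont X0 S0 M)) (var Qn (hit_cont Xn Sn M)) = (\<alpha> M)\<^sup>2"
    using m0(3) mn(3) W_nonneg[OF M, of 0] by (simp add: bd_alpha_def)
  show "var Q0 (hit_disc X0 M) = W 0 M - h 0 M" using m0(2) by simp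
  show "var Qn (hit_disc Xn M) = R.W 0 (n - M) - R.h 0 (n - M)" using mn(2) by simp
qed

text \<open>
  With holding probability at least \<open>\<delta>\<close> one has \<open>a i \<ge> 1 / p i \<ge> 1 / (1 - \<delta>)\<close>, hence
  \<open>a i \<le> (1 - \<delta>) * (a i)\<^sup>2\<close>: passing from the continuous to the discrete variance costs at most a factor \<open>\<delta>\<close>.
\<close>
lemma (in bd_rates) lazy_discrete_variance:
  assumes M: "M \<le> n" and d: "0 \<le> \<delta>" and holding: "\<And>i. i \<le> n \<Longrightarrow> p i + q i \<le> 1 - \<delta>"
  shows "\<delta> * W 0 M \<le> W 0 M - h 0 M"
proof -
  have "\<delta> * (\<Sum>i<M. step_var p \<pi> i) \<le> (\<Sum>i<M. step_var p \<pi> i - a i)"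
    unfolding sum_distrib_left
  proof (intro sum_mono)
    fix i assume "i \<in> {..<M}"
    then have i: "i < n" using M by simp
    have "p i \<le> 1 - \<delta>" using holding[of i] q_nonneg[of i] i by simp
    moreover have "1 \<le> p i * a i" using a_ge_inverse[OF i] p_pos[OF i] by (simp add: divide_le_eq mult.commute)
    ultimately have "1 \<le> (1 - \<delta>) * a i" using a_pos[OF i] by (smt (verit) mult_right_mono)
    then have "a i * 1 \<le> a i * ((1 - \<delta>) * a i)" using a_pos[OF i] by (intro mult_left_mono) auto
    also have "\<dots> = (1 - \<delta>) * (a i)\<^sup>2" by (simp add: power2_eq_square)
    also have "\<dots> \<le> (1 - \<delta>) * step_var p \<pi> i"
      using step_var_ge[OF i] \<open>p i \<le> 1 - \<delta>\<close> p_pos[OF i] by (intro mult_left_mono) auto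
    finally show "\<delta> * step_var p \<pi> i \<le> step_var p \<pi> i - a i" by (simp add: algebra_simps)
  qed
  then show ?thesis by (simp add: hit_var_def mean_hit_def atLeast0LessThan sum_subtractf)
qed

lemma INF_pos_imp_uniform_bound:
  fixes f :: "'i \<Rightarrow> real"
  assumes "0 < (INF i\<in>I. f i)" "\<And>i. i \<in> I \<Longrightarrow> 0 \<le> f i"
  shows "\<exists>c>0. \<forall>i\<in>I. c \<le> f i"
proof (intro exI conjI ballI)
  show "0 < (INF i\<in>I. f i)" by fact
  fix i assume "i \<in> I"
  then show "(INF i\<in>I. f i) \<le> f i" using assms(2) by (intro cINF_lower) (auto intro: bdd_belowI2[of I 0 f])
qed

section \<open>Cutoff of randomly slowed families\<close>

locale slowed_family = cutoff_family K p q \<pi> M c0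
  for K :: "nat \<Rightarrow> real mat" and p q \<pi> :: "nat \<Rightarrow> nat \<Rightarrow> real" and M :: "nat \<Rightarrow> nat" and c0 :: real +
  fixes P :: "nat \<Rightarrow> 'a measure" and C :: "nat \<Rightarrow> nat \<Rightarrow> 'a \<Rightarrow> real" and \<mu> \<nu> :: "nat \<Rightarrow> real"
  assumes prob: "\<And>n. n \<ge> 1 \<Longrightarrow> prob_space (P n)"
    and C_range: "\<And>n i \<omega>. n \<ge> 1 \<Longrightarrow> i \<in> {1..n} \<Longrightarrow> \<omega> \<in> space (P n) \<Longrightarrow> C n i \<omega> \<in> {0<..<1}"
    and C_indep: "\<And>n. n \<ge> 1 \<Longrightarrow> prob_space.indep_vars (P n) (\<lambda>_. borel) (C n) {1..n}"
    and C_ident: "\<And>n i. n \<ge> 1 \<Longrightarrow> i \<in> {1..n} \<Longrightarrow>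
                    distr (P n) borel (C n i) = distr (P n) borel (C n 1)"
    and C_int: "\<And>n. n \<ge> 1 \<Longrightarrow> integrable (P n) (\<lambda>\<omega>. 1 / C n 1 \<omega>)"
    and C_int2: "\<And>n. n \<ge> 1 \<Longrightarrow> integrable (P n) (\<lambda>\<omega>. (1 / C n 1 \<omega>)\<^sup>2)"
    and mu_def: "\<And>n. n \<ge> 1 \<Longrightarrow> \<mu> n = prob_space.expectation (P n) (\<lambda>\<omega>. 1 / C n 1 \<omega>)"
    and nu_def: "\<And>n. n \<ge> 1 \<Longrightarrow> \<nu> n = sqrt (prob_space.variance (P n) (\<lambda>\<omega>. 1 / C n 1 \<omega>))"
begin

lemma mu_ge_1:
  assumes n: "n \<ge> 1" shows "1 \<le> \<mu> n"
proof -
  interpret prob_space "P n" by (rule prob[OF n])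
  have "expectation (\<lambda>_. 1) \<le> expectation (\<lambda>\<omega>. 1 / C n 1 \<omega>)"
    using C_range[OF n, of 1] n by (intro integral_mono C_int) (auto simp: le_divide_eq less_imp_le)
  then show ?thesis by (simp add: mu_def[OF n] prob_space)
qed

lemma nu_nonneg: assumes n: "n \<ge> 1" shows "0 \<le> \<nu> n"
  by (simp add: nu_def[OF n] Bochner_Integration.integral_nonneg)

lemma inverse_C_moments:
  assumes n: "n \<ge> 1" and i: "i \<in> {1..n}"
  shows "integrable (P n) (\<lambda>\<omega>. 1 / C n i \<omega>)" "integrable (P n) (\<lambda>\<omega>. (1 / C n i \<omega>)\<^sup>2)"
    "prob_space.expectation (P n) (\<lambda>\<omega>. 1 / C n i \<omega>) = \<mu> n"
    "prob_space.expectation (P n) (\<lambda>\<omega>. (1 / C n i \<omega>)\<^sup>2) = (\<mu> n)\<^sup>2 + (\<nu> n)\<^sup>2"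
proof -
  interpret prob_space "P n" by (rule prob[OF n])
  have rv[measurable]: "C n i \<in> borel_measurable (P n)" if "i \<in> {1..n}" for i
    using C_indep[OF n] that by (auto simp: indep_vars_def)
  have n1: "1 \<in> {1..n}" using n by simp
  have tr_int: "integrable (P n) (\<lambda>\<omega>. f (C n i \<omega>)) \<longleftrightarrow> integrable (P n) (\<lambda>\<omega>. f (C n 1 \<omega>))"
    and tr_exp: "expectation (\<lambda>\<omega>. f (C n i \<omega>)) = expectation (\<lambda>\<omega>. f (C n 1 \<omega>))"
    if f: "f \<in> borel_measurable borel" for f :: "real \<Rightarrow> real"
    using integrable_distr_eq[OF rv[OF i] f] integrable_distr_eq[OF rv[OF n1] f]
      integral_distr[OF rv[OF i] f] integral_distr[OF rv[OF n1] f] C_ident[OF n i] by auto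
  have m1: "(\<lambda>x. 1 / x :: real) \<in> borel_measurable borel" "(\<lambda>x. (1 / x :: real)\<^sup>2) \<in> borel_measurable borel"
    by measurable
  show "integrable (P n) (\<lambda>\<omega>. 1 / C n i \<omega>)" "integrable (P n) (\<lambda>\<omega>. (1 / C n i \<omega>)\<^sup>2)"
    using tr_int[OF m1(1)] tr_int[OF m1(2)] C_int[OF n] C_int2[OF n] by auto
  show "expectation (\<lambda>\<omega>. 1 / C n i \<omega>) = \<mu> n"
    using tr_exp[OF m1(1)] by (simp add: mu_def[OF n])
  have "variance (\<lambda>\<omega>. 1 / C n 1 \<omega>) = (\<nu> n)\<^sup>2"
    using nu_def[OF n] by (simp add: Bochner_Integration.integral_nonneg)
  moreover have "variance (\<lambda>\<omega>. 1 / C n 1 \<omega>) = expectation (\<lambda>\<omega>. (1 / C n 1 \<omega>)\<^sup>2) - (\<mu> n)\<^sup>2"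
    unfolding mu_def[OF n] by (rule variance_eq[OF C_int[OF n] C_int2[OF n]])
  ultimately show "expectation (\<lambda>\<omega>. (1 / C n i \<omega>)\<^sup>2) = (\<mu> n)\<^sup>2 + (\<nu> n)\<^sup>2"
    using tr_exp[OF m1(2)] by simp
qed

lemma bd_n: "1 \<le> n \<Longrightarrow> bd_rates n (p n) (q n) (\<pi> n)" and M_n: "1 \<le> n \<Longrightarrow> M n \<le> n"
  using reg[of n] by (auto simp: cutoff_regular_def)

definition good_event :: "nat \<Rightarrow> real \<Rightarrow> 'a set \<Rightarrow> bool" where
  "good_event n \<kappa> E \<longleftrightarrow> E \<in> sets (P n) \<and>
     (\<forall>\<omega>\<in>E. \<bar>bd_theta n (\<lambda>i. p n i * C n (i + 1) \<omega>) (\<lambda>i. q n i * C n i \<omega>) (\<pi> n) (M n) - \<mu> n * th n\<bar> \<le> \<kappa> \<and>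
       bd_alpha n (\<lambda>i. p n i * C n (i + 1) \<omega>) (\<lambda>i. q n i * C n i \<omega>) (\<pi> n) (M n) \<le> \<kappa>)"

lemma good_event_exists:
  assumes n: "1 \<le> n" and kap: "0 < \<kappa>"
  shows "\<exists>E. good_event n \<kappa> E \<and> 1 - 2 * (((\<mu> n)\<^sup>2 + 2 * (\<nu> n)\<^sup>2) * (al n)\<^sup>2 / \<kappa>\<^sup>2) \<le> measure (P n) E"
proof -
  interpret prob_space "P n" by (rule prob[OF n])
  have ind: "indep_vars (\<lambda>_. borel) (\<lambda>i \<omega>. 1 / C n i \<omega>) {1..n}"
    by (rule indep_vars_compose2[OF C_indep[OF n]]) measurable
  have "\<exists>E\<in>events. 1 - 2 * (((\<mu> n)\<^sup>2 + 2 * (\<nu> n)\<^sup>2) * (bd_alpha n (p n) (q n) (\<pi> n) (M n))\<^sup>2 / \<kappa>\<^sup>2) \<le> prob E \<and>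
    (\<forall>\<omega>\<in>E. \<bar>bd_theta n (\<lambda>i. p n i * C n (i + 1) \<omega>) (\<lambda>i. q n i * C n i \<omega>) (\<pi> n) (M n) - \<mu> n * bd_theta n (p n) (q n) (\<pi> n) (M n)\<bar> \<le> \<kappa> \<and>
       bd_alpha n (\<lambda>i. p n i * C n (i + 1) \<omega>) (\<lambda>i. q n i * C n i \<omega>) (\<pi> n) (M n) \<le> \<kappa>)"
    by (rule slowed_event[OF bd_n[OF n] M_n[OF n] _ ind inverse_C_moments[OF n] _ _ kap])
       (use C_range[OF n] mu_ge_1[OF n] in auto)
  then show ?thesis unfolding good_event_def th_def al_def by blast
qed

lemma slowed_cutoff_family:
  assumes w: "\<And>n. 1 \<le> n \<Longrightarrow> \<omega> n \<in> space (P n)"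
  shows "cutoff_family (\<lambda>n. slowed_chain n (K n) (\<lambda>i. C n i (\<omega> n)))
     (\<lambda>n i. p n i * C n (i + 1) (\<omega> n)) (\<lambda>n i. q n i * C n i (\<omega> n)) \<pi> M c0"
proof
  show "0 < c0" by (rule c0)
  fix n :: nat assume n: "1 \<le> n"
  show "cutoff_regular n (\<lambda>i. p n i * C n (i + 1) (\<omega> n)) (\<lambda>i. q n i * C n i (\<omega> n)) (\<pi> n) (M n) c0"
    using reg[OF n] bd_slowed(1)[OF bd_n[OF n], of "\<lambda>i. C n i (\<omega> n)"] C_range[OF n _ w[OF n]]
    by (auto simp: cutoff_regular_def)
  show "bd_matrix n (slowed_chain n (K n) (\<lambda>i. C n i (\<omega> n))) (\<lambda>i. p n i * C n (i + 1) (\<omega> n)) (\<lambda>i. q n i * C n i (\<omega> n))"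
    by (rule slowed_chain_matrix[OF mat[OF n]])
qed

text \<open>
  The tolerance \<open>e = sqrt \<xi>\<close> is the square root of the small quantity
  \<open>\<xi> = al / th + \<nu> al / (\<mu> th)\<close>: it tends to zero, while the failure probability is at most
  \<open>6 * \<xi>\<^sup>2 / e\<^sup>2 = 6 * \<xi>\<close>.
\<close>
lemma good_events:
  assumes small1: "(\<lambda>n. al n / th n) \<longlonglongrightarrow> 0" and small2: "(\<lambda>n. \<nu> n * al n / (\<mu> n * th n)) \<longlonglongrightarrow> 0"
  obtains E e where "\<And>n. 1 \<le> n \<Longrightarrow> E n \<in> sets (P n) \<and> E n \<noteq> {}"
    "(\<lambda>n. measure (P n) (E n)) \<longlonglongrightarrow> 1" "e \<longlonglongrightarrow> 0"
    "eventually (\<lambda>n. good_event n (e n * (\<mu> n * th n)) (E n)) sequentially"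
proof -
  define \<xi> where "\<xi> = (\<lambda>n. al n / th n + \<nu> n * al n / (\<mu> n * th n))"
  define e where "e = (\<lambda>n. sqrt (\<xi> n))"
  have xi_lim: "\<xi> \<longlonglongrightarrow> 0" unfolding \<xi>_def using tendsto_add[OF small1 small2] by simp
  have e_lim: "e \<longlonglongrightarrow> 0" unfolding e_def using tendsto_real_sqrt[OF xi_lim] by simp
  define \<kappa> where "\<kappa> = (\<lambda>n. e n * (\<mu> n * th n))"
  have pos: "0 < th n" "0 < \<mu> n" "0 < al n" "0 < \<mu> n * th n" if "1 \<le> n" for n
    using th_al[OF that] mu_ge_1[OF that] by auto
  have parts: "0 < al n / th n" "0 \<le> \<nu> n * al n / (\<mu> n * th n)" if "1 \<le> n" for n
    using pos[OF that] nu_nonneg[OF that] by auto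
  have xi_pos: "0 < \<xi> n" if "1 \<le> n" for n using parts[OF that] by (simp add: \<xi>_def)
  have kap: "0 < \<kappa> n" if "1 \<le> n" for n using xi_pos[OF that] pos[OF that] by (simp add: \<kappa>_def e_def)
  have bound: "2 * (((\<mu> n)\<^sup>2 + 2 * (\<nu> n)\<^sup>2) * (al n)\<^sup>2 / (\<kappa> n)\<^sup>2) \<le> 6 * \<xi> n" if n: "1 \<le> n" for n
  proof -
    define x where "x = al n / th n"
    define y where "y = \<nu> n * al n / (\<mu> n * th n)"
    have xy: "0 \<le> x" "0 \<le> y" "\<xi> n = x + y" using parts[OF n] by (auto simp: x_def y_def \<xi>_def)
    have "(\<kappa> n)\<^sup>2 = \<xi> n * (\<mu> n * th n)\<^sup>2"
      using xi_pos[OF n] by (simp add: \<kappa>_def e_def power_mult_distrib)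
    moreover have "x = \<mu> n * al n / (\<mu> n * th n)" using pos[OF n] by (simp add: x_def)
    then have "x\<^sup>2 + 2 * y\<^sup>2 = ((\<mu> n)\<^sup>2 + 2 * (\<nu> n)\<^sup>2) * (al n)\<^sup>2 / (\<mu> n * th n)\<^sup>2"
      unfolding y_def power_divide
      by (simp only: power_mult_distrib[of "\<mu> n" "al n"] power_mult_distrib[of "\<nu> n" "al n"] power_divide
          distrib_right add_divide_distrib mult.assoc times_divide_eq_right)
    ultimately have "((\<mu> n)\<^sup>2 + 2 * (\<nu> n)\<^sup>2) * (al n)\<^sup>2 / (\<kappa> n)\<^sup>2 = (x\<^sup>2 + 2 * y\<^sup>2) / \<xi> n"
      by simp
    also have "\<dots> \<le> 3 * \<xi> n"
    proof -
      have "x\<^sup>2 \<le> (\<xi> n)\<^sup>2" "y\<^sup>2 \<le> (\<xi> n)\<^sup>2" using xy by (auto intro!: power_mono)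
      then have "x\<^sup>2 + 2 * y\<^sup>2 \<le> 3 * \<xi> n * \<xi> n" by (simp add: power2_eq_square)
      then show ?thesis using xi_pos[OF n] by (simp add: pos_divide_le_eq)
    qed
    finally show ?thesis by simp
  qed
  have "\<exists>E. 1 \<le> n \<longrightarrow> good_event n (\<kappa> n) E \<and> 1 - 6 * \<xi> n \<le> measure (P n) E" for n
  proof (cases "1 \<le> n")
    case True
    then show ?thesis using good_event_exists[OF True kap[OF True]] bound[OF True] by (meson diff_left_mono order.trans)
  qed simp
  then obtain E' where E': "\<And>n. 1 \<le> n \<Longrightarrow> good_event n (\<kappa> n) (E' n)" "\<And>n. 1 \<le> n \<Longrightarrow> 1 - 6 * \<xi> n \<le> measure (P n) (E' n)"
    by metis
  have "eventually (\<lambda>n. \<xi> n < 1 / 6) sequentially"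
    using xi_lim by (rule order_tendstoD) simp
  then have ne: "eventually (\<lambda>n. E' n \<noteq> {}) sequentially"
    using eventually_ge_at_top[of 1]
  proof eventually_elim
    case (elim n)
    then have "0 < measure (P n) (E' n)" using E'(2)[of n] by linarith
    then show ?case by auto
  qed
  (* For finitely many n the bound on the probability may be void; any nonempty event will do. *)
  define E where "E = (\<lambda>n. if E' n = {} then space (P n) else E' n)"
  have ev: "eventually (\<lambda>n. E n = E' n) sequentially" using ne by eventually_elim (simp add: E_def)
  show ?thesis
  proof (rule that[of E e])
    show "E n \<in> sets (P n) \<and> E n \<noteq> {}" if "1 \<le> n" for n
      using E'(1)[OF that] prob_space.not_empty[OF prob[OF that]] by (auto simp: E_def good_event_def)
    show "e \<longlonglongrightarrow> 0" by (rule e_lim)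
    show "eventually (\<lambda>n. good_event n (e n * (\<mu> n * th n)) (E n)) sequentially"
      using ev eventually_ge_at_top[of 1] by eventually_elim (use E'(1) in \<open>simp add: \<kappa>_def\<close>)
    show "(\<lambda>n. measure (P n) (E n)) \<longlonglongrightarrow> 1"
    proof (rule tendsto_sandwich)
      have "(\<lambda>n. 1 - 6 * \<xi> n) \<longlonglongrightarrow> 1 - 6 * 0" by (intro tendsto_intros xi_lim)
      then show "(\<lambda>n. 1 - 6 * \<xi> n) \<longlonglongrightarrow> 1" by simp
      show "eventually (\<lambda>n. 1 - 6 * \<xi> n \<le> measure (P n) (E n)) sequentially"
        using ev eventually_ge_at_top[of 1] by eventually_elim (use E'(2) in simp)
      show "eventually (\<lambda>n. measure (P n) (E n) \<le> 1) sequentially"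
        using eventually_ge_at_top[of 1] by eventually_elim (rule prob_space.prob_le_1[OF prob])
    qed (rule tendsto_const)
  qed
qed

lemma good_events_cutoff_data:
  assumes E: "\<And>n. 1 \<le> n \<Longrightarrow> E n \<in> sets (P n)"
    and good: "eventually (\<lambda>n. good_event n (e n * (\<mu> n * th n)) (E n)) sequentially"
    and w: "\<And>n. 1 \<le> n \<Longrightarrow> \<omega> n \<in> E n"
  defines "p' \<equiv> \<lambda>n i. p n i * C n (i + 1) (\<omega> n)" and "q' \<equiv> \<lambda>n i. q n i * C n i (\<omega> n)"
  shows "cutoff_family (\<lambda>n. slowed_chain n (K n) (\<lambda>i. C n i (\<omega> n))) p' q' \<pi> M c0"
    and "eventually (\<lambda>n. \<bar>cutoff_family.th p' q' \<pi> M n - \<mu> n * th n\<bar> \<le> e n * (\<mu> n * th n)) sequentially"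
    and "eventually (\<lambda>n. cutoff_family.al p' q' \<pi> M n \<le> e n * (\<mu> n * th n)) sequentially"
proof -
  show fam: "cutoff_family (\<lambda>n. slowed_chain n (K n) (\<lambda>i. C n i (\<omega> n))) p' q' \<pi> M c0"
    unfolding p'_def q'_def using E w sets.sets_into_space by (intro slowed_cutoff_family) blast
  interpret L: cutoff_family "\<lambda>n. slowed_chain n (K n) (\<lambda>i. C n i (\<omega> n))" p' q' \<pi> M c0 by (rule fam)
  have "eventually (\<lambda>n. \<bar>L.th n - \<mu> n * th n\<bar> \<le> e n * (\<mu> n * th n) \<and> L.al n \<le> e n * (\<mu> n * th n)) sequentially"
    using good eventually_ge_at_top[of 1]
  proof eventually_elim
    case (elim n)
    then show ?case using w[of n] 
      unfolding L.th_def L.al_def unfolding good_event_def p'_def q'_def by blast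
  qed
  then show "eventually (\<lambda>n. \<bar>L.th n - \<mu> n * th n\<bar> \<le> e n * (\<mu> n * th n)) sequentially"
    "eventually (\<lambda>n. L.al n \<le> e n * (\<mu> n * th n)) sequentially"
    by (auto elim: eventually_mono)
qed

lemma mu_th_pos: "1 \<le> n \<Longrightarrow> 0 < \<mu> n * th n"
  using th_al[of n] mu_ge_1[of n] by simp

lemma slowed_cont_cutoff:
  assumes cut: "has_cutoff (\<lambda>n. mixing_time_cont n (K n) (\<pi> n))"
    and small: "(\<lambda>n. \<nu> n * al n / (\<mu> n * th n)) \<longlonglongrightarrow> 0"
  shows "\<exists>E. (\<forall>n\<ge>1. E n \<in> sets (P n) \<and> E n \<noteq> {}) \<and> (\<lambda>n. measure (P n) (E n)) \<longlonglongrightarrow> 1 \<and>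
    (\<forall>\<omega>. (\<forall>n\<ge>1. \<omega> n \<in> E n) \<longrightarrow>
      has_cutoff_time (\<lambda>n. mixing_time_cont n (slowed_chain n (K n) (\<lambda>i. C n i (\<omega> n))) (\<pi> n)) (\<lambda>n. \<mu> n * th n))"
proof -
  obtain E e where E: "\<And>n. 1 \<le> n \<Longrightarrow> E n \<in> sets (P n) \<and> E n \<noteq> {}"
    "(\<lambda>n. measure (P n) (E n)) \<longlonglongrightarrow> 1" and e: "e \<longlonglongrightarrow> 0"
    "eventually (\<lambda>n. good_event n (e n * (\<mu> n * th n)) (E n)) sequentially"
    using good_events[OF alpha_small_from_cont_cutoff[OF cut] small] by blast
  show ?thesis
  proof (intro exI[of _ E] conjI allI impI)
    fix \<omega> assume "\<forall>n\<ge>1. \<omega> n \<in> E n"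
    then have w: "\<And>n. 1 \<le> n \<Longrightarrow> \<omega> n \<in> E n" by blast
    note data = good_events_cutoff_data[OF conjunct1[OF E(1)] e(2) w]
    show "has_cutoff_time (\<lambda>n. mixing_time_cont n (slowed_chain n (K n) (\<lambda>i. C n i (\<omega> n))) (\<pi> n)) (\<lambda>n. \<mu> n * th n)"
      by (rule cutoff_family.cont_cutoff[OF data(1) mu_th_pos e(1) data(2,3)])
  qed (use E in auto)
qed

lemma slowed_disc_cutoff:
  assumes d: "0 < \<delta>" and holding: "\<And>n i. 1 \<le> n \<Longrightarrow> i \<le> n \<Longrightarrow> p n i + q n i \<le> 1 - \<delta>"
    and cut: "has_cutoff (\<lambda>n. mixing_time_disc n (K n) (\<pi> n))"
    and small: "(\<lambda>n. \<nu> n * al n / (\<mu> n * th n)) \<longlonglongrightarrow> 0"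
  shows "\<exists>E. (\<forall>n\<ge>1. E n \<in> sets (P n) \<and> E n \<noteq> {}) \<and> (\<lambda>n. measure (P n) (E n)) \<longlonglongrightarrow> 1 \<and>
    (\<forall>\<omega>. (\<forall>n\<ge>1. \<omega> n \<in> E n) \<longrightarrow>
      has_cutoff_time (\<lambda>n. mixing_time_disc n (slowed_chain n (K n) (\<lambda>i. C n i (\<omega> n))) (\<pi> n)) (\<lambda>n. \<mu> n * th n))"
proof -
  obtain E e where E: "\<And>n. 1 \<le> n \<Longrightarrow> E n \<in> sets (P n) \<and> E n \<noteq> {}"
    "(\<lambda>n. measure (P n) (E n)) \<longlonglongrightarrow> 1" and e: "e \<longlonglongrightarrow> 0"
    "eventually (\<lambda>n. good_event n (e n * (\<mu> n * th n)) (E n)) sequentially"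
    using good_events[OF alpha_small_from_disc_cutoff[OF d holding cut] small] by blast
  show ?thesis
  proof (intro exI[of _ E] conjI allI impI)
    fix \<omega> assume "\<forall>n\<ge>1. \<omega> n \<in> E n"
    then have w: "\<And>n. 1 \<le> n \<Longrightarrow> \<omega> n \<in> E n" by blast
    note data = good_events_cutoff_data[OF conjunct1[OF E(1)] e(2) w]
    show "has_cutoff_time (\<lambda>n. mixing_time_disc n (slowed_chain n (K n) (\<lambda>i. C n i (\<omega> n))) (\<pi> n)) (\<lambda>n. \<mu> n * th n)"
    proof (rule cutoff_family.disc_cutoff[OF data(1) mu_th_pos e(1) data(2,3) d])
      fix n i :: nat assume n: "1 \<le> n" and i: "i \<le> n"
      have "\<omega> n \<in> space (P n)" using E(1)[OF n] w[OF n] sets.sets_into_space by blast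
      then have "p n i * C n (i + 1) (\<omega> n) + q n i * C n i (\<omega> n) \<le> p n i + q n i"
        using C_range[OF n] i by (intro bd_slowed(2)[OF bd_n[OF n]]) auto
      then show "p n i * C n (i + 1) (\<omega> n) + q n i * C n i (\<omega> n) \<le> 1 - \<delta>" using holding[OF n i] by linarith
    qed
  qed (use E in auto)
qed

end

theorem theorem1p5:
  fixes K :: "nat \<Rightarrow> real mat" and \<pi> :: "nat \<Rightarrow> nat \<Rightarrow> real"
    and P :: "nat \<Rightarrow> 'a measure" and C :: "nat \<Rightarrow> nat \<Rightarrow> 'a \<Rightarrow> real"
    and Q :: "nat \<Rightarrow> nat \<Rightarrow> 'b measure"
    and X :: "nat \<Rightarrow> nat \<Rightarrow> nat \<Rightarrow> 'b \<Rightarrow> nat" and S :: "nat \<Rightarrow> nat \<Rightarrow> nat \<Rightarrow> 'b \<Rightarrow> real"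
    and M :: "nat \<Rightarrow> nat" and \<mu> \<nu> \<theta> \<alpha> \<beta> :: "nat \<Rightarrow> real"
    and L :: "nat \<Rightarrow> 'a \<Rightarrow> real mat"
  assumes chain: "\<And>n. n \<ge> 1 \<Longrightarrow> birth_death_chain n (K n)"
    and irred: "\<And>n. n \<ge> 1 \<Longrightarrow> irreducible_chain n (K n)"
    and stat: "\<And>n. n \<ge> 1 \<Longrightarrow> stationary_distribution n (K n) (\<pi> n)"
    and prob: "\<And>n. n \<ge> 1 \<Longrightarrow> prob_space (P n)"
    and C_range: "\<And>n i \<omega>. n \<ge> 1 \<Longrightarrow> i \<in> {1..n} \<Longrightarrow> \<omega> \<in> space (P n) \<Longrightarrow> C n i \<omega> \<in> {0<..<1}"
    and C_indep: "\<And>n. n \<ge> 1 \<Longrightarrow> prob_space.indep_vars (P n) (\<lambda>_. borel) (C n) {1..n}"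
    and C_ident: "\<And>n i. n \<ge> 1 \<Longrightarrow> i \<in> {1..n} \<Longrightarrow>
                    distr (P n) borel (C n i) = distr (P n) borel (C n 1)"
    and L_def: "\<And>n \<omega>. L n \<omega> = slowed_chain n (K n) (\<lambda>i. C n i \<omega>)"
    and C_int: "\<And>n. n \<ge> 1 \<Longrightarrow> integrable (P n) (\<lambda>\<omega>. 1 / C n 1 \<omega>)"
    and C_int2: "\<And>n. n \<ge> 1 \<Longrightarrow> integrable (P n) (\<lambda>\<omega>. (1 / C n 1 \<omega>)\<^sup>2)"
    and \<mu>_def: "\<And>n. n \<ge> 1 \<Longrightarrow> \<mu> n = prob_space.expectation (P n) (\<lambda>\<omega>. 1 / C n 1 \<omega>)"
    and \<nu>_def: "\<And>n. n \<ge> 1 \<Longrightarrow> \<nu> n = sqrt (prob_space.variance (P n) (\<lambda>\<omega>. 1 / C n 1 \<omega>))"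
    and M_state: "\<And>n. n \<ge> 1 \<Longrightarrow> M n \<le> n"
    and M_left: "(INF n\<in>{1..}. \<Sum>x\<in>{0..M n}. \<pi> n x) > 0"
    and M_right: "(INF n\<in>{1..}. \<Sum>x\<in>{M n..n}. \<pi> n x) > 0"
    and realization: "\<And>n j. n \<ge> 1 \<Longrightarrow> j \<le> n \<Longrightarrow> chain_with_clock (Q n j) n (K n) j (X n j) (S n j)"
    and \<theta>_def: "\<And>n. n \<ge> 1 \<Longrightarrow>
          \<theta> n = max (mean (Q n 0) (hit_disc (X n 0) (M n))) (mean (Q n n) (hit_disc (X n n) (M n)))"
    and \<alpha>_def: "\<And>n. n \<ge> 1 \<Longrightarrow>
          \<alpha> n = sqrt (max (var (Q n 0) (hit_cont (X n 0) (S n 0) (M n)))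
                           (var (Q n n) (hit_cont (X n n) (S n n) (M n))))"
    and \<beta>_def: "\<And>n. n \<ge> 1 \<Longrightarrow>
          \<beta> n = sqrt (max (var (Q n 0) (hit_disc (X n 0) (M n))) (var (Q n n) (hit_disc (X n n) (M n))))"
  shows "(has_cutoff (\<lambda>n. mixing_time_cont n (K n) (\<pi> n)) \<and>
          (\<lambda>n. \<nu> n * \<alpha> n / (\<mu> n * \<theta> n)) \<longlonglongrightarrow> 0 \<longrightarrow>
          (\<exists>E. (\<forall>n\<ge>1. E n \<in> sets (P n) \<and> E n \<noteq> {}) \<and> (\<lambda>n. measure (P n) (E n)) \<longlonglongrightarrow> 1 \<and>
               (\<forall>\<omega>. (\<forall>n\<ge>1. \<omega> n \<in> E n) \<longrightarrow>
                  has_cutoff_time (\<lambda>n. mixing_time_cont n (L n (\<omega> n)) (\<pi> n)) (\<lambda>n. \<mu> n * \<theta> n))))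
       \<and> ((INF (n, i)\<in>Sigma {1..} (\<lambda>n. {0..n}). K n $$ (i, i)) > 0 \<and>
          has_cutoff (\<lambda>n. mixing_time_disc n (K n) (\<pi> n)) \<and>
          (\<lambda>n. \<nu> n * \<beta> n / (\<mu> n * \<theta> n)) \<longlonglongrightarrow> 0 \<longrightarrow>
          (\<exists>E. (\<forall>n\<ge>1. E n \<in> sets (P n) \<and> E n \<noteq> {}) \<and> (\<lambda>n. measure (P n) (E n)) \<longlonglongrightarrow> 1 \<and>
               (\<forall>\<omega>. (\<forall>n\<ge>1. \<omega> n \<in> E n) \<longrightarrow>
                  has_cutoff_time (\<lambda>n. mixing_time_disc n (L n (\<omega> n)) (\<pi> n)) (\<lambda>n. \<mu> n * \<theta> n))))"
proof -
  define p where "p = (\<lambda>n. up_rate n (K n))"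
  define q where "q = (\<lambda>n. down_rate (K n))"
  have B: "bd_rates n (p n) (q n) (\<pi> n)" if "1 \<le> n" for n
    unfolding p_def q_def by (rule irreducible_stationary_bd[OF that chain[OF that] irred[OF that] stat[OF that]])
  have mat: "bd_matrix n (K n) (p n) (q n)" if "1 \<le> n" for n
    unfolding p_def q_def by (rule birth_death_chain_matrix(1)[OF chain[OF that]])
  have pi_nn: "0 \<le> \<pi> n x" if "1 \<le> n" "x \<le> n" for n x
    using bd_rates.pi_pos[OF B[OF that(1)] that(2)] by simp
  obtain cl where cl: "0 < cl" "\<And>n. 1 \<le> n \<Longrightarrow> cl \<le> (\<Sum>x\<in>{0..M n}. \<pi> n x)"
  proof -
    have "\<exists>c>0. \<forall>n\<in>{1..}. c \<le> (\<Sum>x\<in>{0..M n}. \<pi> n x)"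
    proof (rule INF_pos_imp_uniform_bound[OF M_left], rule sum_nonneg)
      fix n x assume "n \<in> {1..}" "x \<in> {0..M n}"
      then show "0 \<le> \<pi> n x" using M_state[of n] by (intro pi_nn) auto
    qed
    then show ?thesis using that by auto
  qed
  obtain cr where cr: "0 < cr" "\<And>n. 1 \<le> n \<Longrightarrow> cr \<le> (\<Sum>x\<in>{M n..n}. \<pi> n x)"
  proof -
    have "\<exists>c>0. \<forall>n\<in>{1..}. c \<le> (\<Sum>x\<in>{M n..n}. \<pi> n x)"
      by (rule INF_pos_imp_uniform_bound[OF M_right]) (use pi_nn in \<open>auto intro!: sum_nonneg\<close>)
    then show ?thesis using that by auto
  qed
  interpret slowed_family K p q \<pi> M "min cl cr" P C \<mu> \<nu>
  proof (intro slowed_family.intro cutoff_family.intro slowed_family_axioms.intro)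
    show "cutoff_regular n (p n) (q n) (\<pi> n) (M n) (min cl cr)" if "1 \<le> n" for n
      using B[OF that] M_state[OF that] cl(2)[OF that] cr(2)[OF that]
      by (auto simp: cutoff_regular_def cum_def atLeast0AtMost)
    show "0 < min cl cr" using cl cr by simp
  qed ((rule mat prob C_range C_indep C_ident C_int C_int2 \<mu>_def \<nu>_def; assumption)+)
  have theta: "\<theta> n = th n" and alpha: "\<alpha> n = al n" if n: "1 \<le> n" for n
    using bd_rates.hitting_parameters(1,2)[OF B[OF n] mat[OF n] M_state[OF n] realization[OF n] realization[OF n]]
      th_al[OF n] by (auto simp: \<theta>_def[OF n] \<alpha>_def[OF n] th_def al_def)
  have transfer: "has_cutoff_time T (\<lambda>n. \<mu> n * th n) \<Longrightarrow> has_cutoff_time T (\<lambda>n. \<mu> n * \<theta> n)" for T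
  proof -
    assume a: "has_cutoff_time T (\<lambda>n. \<mu> n * th n)"
    have "eventually (\<lambda>n. T n \<epsilon> / ereal (\<mu> n * th n) = T n \<epsilon> / ereal (\<mu> n * \<theta> n)) sequentially" for \<epsilon>
      using eventually_ge_at_top[of 1] by eventually_elim (simp add: theta)
    then have iff: "((\<lambda>n. T n \<epsilon> / ereal (\<mu> n * th n)) \<longlonglongrightarrow> 1) \<longleftrightarrow> ((\<lambda>n. T n \<epsilon> / ereal (\<mu> n * \<theta> n)) \<longlonglongrightarrow> 1)" for \<epsilon>
      by (rule tendsto_cong)
    show "has_cutoff_time T (\<lambda>n. \<mu> n * \<theta> n)"
      using a theta unfolding has_cutoff_time_def iff by auto
  qed
  show ?thesis
  proof (intro conjI impI; elim conjE)
    assume cut: "has_cutoff (\<lambda>n. mixing_time_cont n (K n) (\<pi> n))"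
      and small: "(\<lambda>n. \<nu> n * \<alpha> n / (\<mu> n * \<theta> n)) \<longlonglongrightarrow> 0"
    have "eventually (\<lambda>n. \<nu> n * \<alpha> n / (\<mu> n * \<theta> n) = \<nu> n * al n / (\<mu> n * th n)) sequentially"
      using eventually_ge_at_top[of 1] by eventually_elim (simp add: theta alpha)
    then have "(\<lambda>n. \<nu> n * al n / (\<mu> n * th n)) \<longlonglongrightarrow> 0" using small by (simp add: tendsto_cong)
    from slowed_cont_cutoff[OF cut this]
    show "\<exists>E. (\<forall>n\<ge>1. E n \<in> sets (P n) \<and> E n \<noteq> {}) \<and> (\<lambda>n. measure (P n) (E n)) \<longlonglongrightarrow> 1 \<and>
       (\<forall>\<omega>. (\<forall>n\<ge>1. \<omega> n \<in> E n) \<longrightarrow>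
          has_cutoff_time (\<lambda>n. mixing_time_cont n (L n (\<omega> n)) (\<pi> n)) (\<lambda>n. \<mu> n * \<theta> n))"
      unfolding L_def using transfer by blast
  next
    assume hold: "(INF (n, i)\<in>Sigma {1..} (\<lambda>n. {0..n}). K n $$ (i, i)) > 0"
      and cut: "has_cutoff (\<lambda>n. mixing_time_disc n (K n) (\<pi> n))"
      and small: "(\<lambda>n. \<nu> n * \<beta> n / (\<mu> n * \<theta> n)) \<longlonglongrightarrow> 0"
    have diag: "K n $$ (i, i) = 1 - p n i - q n i" if "1 \<le> n" "i \<le> n" for n i
      using mat[OF that(1)] that(2) by (simp add: bd_matrix_def)
    have diag_nonneg: "0 \<le> K n $$ (i, i)" if "1 \<le> n" "i \<le> n" for n i
      using bd_rates.pq_le[OF B[OF that(1)] that(2)] diag[OF that] by linarith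
    have "\<exists>c>0. \<forall>(n, i)\<in>Sigma {1..} (\<lambda>n. {0..n}). c \<le> K n $$ (i, i)"
    proof -
      have "\<exists>c>0. \<forall>z\<in>Sigma {1..} (\<lambda>n. {0..n}). c \<le> (case z of (n, i) \<Rightarrow> K n $$ (i, i))"
        by (rule INF_pos_imp_uniform_bound[OF hold]) (use diag_nonneg in auto)
      then show ?thesis by (simp add: case_prod_beta)
    qed
    then obtain \<delta> where d: "0 < \<delta>" "\<And>n i. 1 \<le> n \<Longrightarrow> i \<le> n \<Longrightarrow> \<delta> \<le> K n $$ (i, i)" by auto
    have holding: "p n i + q n i \<le> 1 - \<delta>" if "1 \<le> n" "i \<le> n" for n i
      using d(2)[OF that] diag[OF that] by linarith
    (* This lets the smallness of \<nu> \<beta> be used as smallness of \<nu> \<alpha>. *)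
    have beta: "sqrt \<delta> * al n \<le> \<beta> n" if n: "1 \<le> n" for n
    proof -
      interpret B: bd_rates n "p n" "q n" "\<pi> n" by (rule B[OF n])
      interpret R: bd_rates n B.rp B.rq B.r\<pi> by (rule B.reflect)
      have v: "var (Q n 0) (hit_disc (X n 0) (M n)) = B.W 0 (M n) - B.h 0 (M n)"
        "var (Q n n) (hit_disc (X n n) (M n)) = R.W 0 (n - M n) - R.h 0 (n - M n)"
        using B.hitting_parameters(3,4)[OF mat[OF n] M_state[OF n] realization[OF n] realization[OF n]] by auto
      have "\<delta> * B.W 0 (M n) \<le> B.W 0 (M n) - B.h 0 (M n)"
        using holding[OF n] d(1) M_state[OF n] by (intro B.lazy_discrete_variance) auto
      moreover have "\<delta> * R.W 0 (n - M n) \<le> R.W 0 (n - M n) - R.h 0 (n - M n)"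
      proof (rule R.lazy_discrete_variance)
        show "B.rp i + B.rq i \<le> 1 - \<delta>" if "i \<le> n" for i using holding[OF n, of "n - i"] by simp
      qed (use d in auto)
      ultimately have "\<delta> * max (B.W 0 (M n)) (R.W 0 (n - M n)) \<le>
          max (var (Q n 0) (hit_disc (X n 0) (M n))) (var (Q n n) (hit_disc (X n n) (M n)))"
        unfolding v by (auto simp: max_def)
      then have "sqrt (\<delta> * max (B.W 0 (M n)) (R.W 0 (n - M n))) \<le> \<beta> n"
        unfolding \<beta>_def[OF n] by (rule real_sqrt_le_mono)
      then show ?thesis by (simp add: real_sqrt_mult al_def bd_alpha_def)
    qed
    have "(\<lambda>n. \<nu> n * al n / (\<mu> n * th n)) \<longlonglongrightarrow> 0"
    proof (rule tendsto_sandwich[OF _ _ tendsto_const])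
      show "(\<lambda>n. 1 / sqrt \<delta> * (\<nu> n * \<beta> n / (\<mu> n * \<theta> n))) \<longlonglongrightarrow> 0"
        using tendsto_mult[OF tendsto_const small, of "1 / sqrt \<delta>"] by simp
      show "eventually (\<lambda>n. 0 \<le> \<nu> n * al n / (\<mu> n * th n)) sequentially"
        using eventually_ge_at_top[of 1]
      proof eventually_elim
        case (elim n)
        then show ?case using nu_nonneg[OF elim] th_al[OF elim] mu_ge_1[OF elim] by simp
      qed
      show "eventually (\<lambda>n. \<nu> n * al n / (\<mu> n * th n) \<le> 1 / sqrt \<delta> * (\<nu> n * \<beta> n / (\<mu> n * \<theta> n))) sequentially"
        using eventually_ge_at_top[of 1]
      proof eventually_elim
        case (elim n)
        have "al n \<le> 1 / sqrt \<delta> * \<beta> n" using beta[OF elim] d(1) by (simp add: pos_le_divide_eq mult.commute)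
        then have "\<nu> n * al n \<le> \<nu> n * (1 / sqrt \<delta> * \<beta> n)" by (intro mult_left_mono nu_nonneg elim)
        then have "\<nu> n * al n / (\<mu> n * th n) \<le> \<nu> n * (1 / sqrt \<delta> * \<beta> n) / (\<mu> n * th n)"
          using mu_th_pos[OF elim] by (intro divide_right_mono) auto
        then show ?case by (simp add: theta[OF elim])
      qed
    qed
    from slowed_disc_cutoff[OF d(1) holding cut this]
    show "\<exists>E. (\<forall>n\<ge>1. E n \<in> sets (P n) \<and> E n \<noteq> {}) \<and> (\<lambda>n. measure (P n) (E n)) \<longlonglongrightarrow> 1 \<and>
       (\<forall>\<omega>. (\<forall>n\<ge>1. \<omega> n \<in> E n) \<longrightarrow>
          has_cutoff_time (\<lambda>n. mixing_time_disc n (L n (\<omega> n)) (\<pi> n)) (\<lambda>n. \<mu> n * \<theta> n))"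
      unfolding L_def using transfer by blast
  qed
qed

end
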